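(* Let $\mathbf{k}$ be a field (of arbitrary characteristic) and let $Q$ be a Dynkin quiver with vertex set $Q_0=\{1,\dots,r\}$ and Coxeter number $h$. Let $\Pi=\Pi(Q)$ be the preprojective algebra of $Q$ over $\mathbf{k}$, graded by path length, let $C$ be the adjacency matrix of the double quiver $\overline{Q}$, and let $P$ be the Nakayama permutation matrix of $\Pi$. Then the (matrix-valued) Hilbert series of $\Pi$ is $$h_{\Pi}(t)=\frac{1+Pt^{h}}{1-Ct+t^{2}}$$ as an identity in the ring $M_r(\mathbb{Z})[[t]]$.
   Context: A quiver is Dynkin if its underlying graph is a Dynkin diagram of type $A_n$, $D_n$, $E_6$, $E_7$ or $E_8$. Its Coxeter number $h$ is $n+1$, $2n-2$, $12$, $18$, $30$ respectively. The double quiver $\overline{Q}$ is obtained from $Q$ by adding an opposite arrow $\alpha^*:j\to i$ for each arrow $\alpha:i\to j$ of $Q$. For an arrow $\alpha: i\to j$ write $t(\alpha)=i$ and $h(\alpha)=j$; paths are composed from left to right, so $\alpha\alpha^*$ is a cycle at $t(\alpha)$. For $i\in Q_0$ the mesh relation at $i$ is $$\rho_i=\sum_{\alpha\in Q_1:\,t(\alpha)=i}\alpha\alpha^*-\sum_{\alpha\in Q_1:\,h(\alpha)=i}\alpha^*\alpha\in\mathbf{k}\overline{Q}.$$ The preprojective algebra is $\Pi(Q)=\mathbf{k}\overline{Q}/(\rho_i\mid i\in Q_0)$, graded by path length; each graded piece $\Pi_n$ is finite dimensional. Let $e_i$ be the idempotent at vertex $i$ and $A=\mathbf{k}Q_0=\prod_i\mathbf{k}e_i$.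 For a finite dimensional $A$-$A$-bimodule $M$, its dimension matrix is $[M]=(\dim_{\mathbf{k}}e_iMe_j)_{i,j}\in M_r(\mathbb{Z})$. The Hilbert series is $h_\Pi(t)=\sum_{n\ge0}[\Pi_n]t^n\in M_r(\mathbb{Z})[[t]]$. The adjacency matrix of $\overline{Q}$ is $C=[\mathbf{k}\overline{Q}_1]=[V]+[V]^{t}$, where $V=\mathbf{k}Q_1$. For $Q$ Dynkin, $\Pi$ is a finite dimensional self-injective algebra with a Nakayama automorphism $\nu:\Pi\to\Pi$, i.e. an algebra automorphism such that ${}_{\nu}\Pi\cong\operatorname{Hom}_{\mathbf{k}}(\Pi,\mathbf{k})$ as $\Pi$-$\Pi$-bimodules, where ${}_\nu\Pi$ is $\Pi$ with left action twisted by $\nu$. It induces a permutation of $Q_0$, also denoted $\nu$: $\nu(i)$ is the unique vertex with $\Pi\nu(e_i)\cong\Pi e_{\nu(i)}$ as $\Pi$-modules. The Nakayama permutation matrix is $P=(\delta_{\nu(i)j})_{i,j\in Q_0}$. The matrices $P$ and $C$ commute, so the fraction is unambiguous; it denotes the product of $1+Pt^h$ with the inverse of $1-Ct+t^2$ in $M_r(\mathbb{Z})[[t]]$, where $1$ is the identity matrix and $t^2$ is $t^2$ times the identity matrix. *)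

theory Defs
  imports
    "HOL-Analysis.Analysis"
    "HOL-Computational_Algebra.Formal_Power_Series"
    "HOL-Algebra.QuotRing"
    "HOL-Algebra.Embedded_Algebras"
    "Graph_Theory.Digraph"
    "Graph_Theory.Arc_Walk"
begin

section \<open>Square matrices as a ring\<close>

text \<open>
  The library's product on \<open>'a ^ 'v ^ 'v\<close> as an instance of class \<open>times\<close> is componentwise.
  The type below is a copy of \<open>'a ^ 'v ^ 'v\<close> on which \<open>*\<close> is the matrix product \<open>**\<close>, so that
  \<open>(int, 'v) sqmat fps\<close>, with the library's Cauchy product, is the ring
  \<open>M_r(Z)[[t]]\<close> for \<open>r = CARD('v)\<close>. In this noncommutative ring, a series \<open>f\<close> with
  constant term \<open>1\<close> has the two-sided inverse \<open>fps_right_inverse f 1\<close>.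
\<close>

typedef ('a, 'v) sqmat = "UNIV :: ('a ^ ('v::finite) ^ 'v) set"
  morphisms mat_of Sqmat by auto

lemmas sqmat_simps = Sqmat_inverse[OF UNIV_I] mat_of_inverse

instantiation sqmat :: (ring_1, finite) ring_1
begin

definition "0 = Sqmat 0"
definition "1 = Sqmat (mat 1)"
definition "A + B = Sqmat (mat_of A + mat_of B)"
definition "A - B = Sqmat (mat_of A - mat_of B)"
definition "- A = Sqmat (- mat_of A)"
definition "A * B = Sqmat (mat_of A ** mat_of B)"

instance
proof
  fix A B C :: "('a, 'b) sqmat"
  show "A + B + C = A + (B + C)" "A + B = B + A" "0 + A = A" "- A + A = 0" "A - B = A + - B"
    by (simp_all add: plus_sqmat_def zero_sqmat_def uminus_sqmat_def minus_sqmat_def sqmat_simps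
        algebra_simps)
  show "A * B * C = A * (B * C)"
    by (simp add: times_sqmat_def sqmat_simps matrix_mul_assoc)
  show "1 * A = A" "A * 1 = A"
    by (simp_all add: times_sqmat_def one_sqmat_def sqmat_simps)
  show "A * (B + C) = A * B + A * C"
    by (simp add: times_sqmat_def plus_sqmat_def sqmat_simps matrix_add_ldistrib)
  show "(A + B) * C = A * C + B * C"
    by (simp add: times_sqmat_def plus_sqmat_def sqmat_simps matrix_matrix_mult_def
        Sqmat_inject vec_eq_iff sum.distrib distrib_right)
  have "(mat 1 :: 'a ^ 'b ^ 'b) \<noteq> 0"
    by (auto simp: mat_def vec_eq_iff)
  then show "(0 :: ('a, 'b) sqmat) \<noteq> 1"
    by (simp add: zero_sqmat_def one_sqmat_def Sqmat_inject)
qed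

end


section \<open>Path algebras\<close>

text \<open>
  A quiver is a \<open>pre_digraph\<close>, with \<open>tail a\<close> the source \<open>t(a)\<close> and \<open>head a\<close> the target \<open>h(a)\<close>.
  A path is a triple of its start, its list of arrows (composed from left to right) and its end;
  the trivial path at \<open>i\<close> is \<open>(i, [], i)\<close>.
\<close>

type_synonym ('v, 'a) path = "'v \<times> 'a list \<times> 'v"

definition paths :: "('v, 'a) pre_digraph \<Rightarrow> ('v, 'a) path set" where
  "paths G = {(u, p, v). pre_digraph.awalk G u p v}"

definition basis :: "('v, 'a) path \<Rightarrow> ('v, 'a) path \<Rightarrow> 'k::field" where
  "basis p = (\<lambda>q. if q = p then 1 else 0)"

text \<open>
  The path algebra consists of the finitely supported functions on paths. The coefficient of a
  path in a product is the sum over all ways of cutting this path into two paths.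
\<close>

definition path_algebra :: "('v, 'a) pre_digraph \<Rightarrow> (('v, 'a) path \<Rightarrow> 'k::field) ring" where
  "path_algebra G =
    \<lparr> carrier = {f. finite {p. f p \<noteq> 0} \<and> {p. f p \<noteq> 0} \<subseteq> paths G},
      mult = (\<lambda>f g (u, p, w). \<Sum>n\<le>length p. \<Sum>v\<in>verts G. f (u, take n p, v) * g (v, drop n p, w)),
      one = (\<lambda>q. \<Sum>i\<in>verts G. basis (i, [], i) q),
      zero = (\<lambda>_. 0),
      add = (\<lambda>f g q. f q + g q) \<rparr>"

definition path_scalar :: "('v, 'a) pre_digraph \<Rightarrow> 'k::field \<Rightarrow> ('v, 'a) path \<Rightarrow> 'k" where
  "path_scalar G c = (\<lambda>q. c * \<one>\<^bsub>path_algebra G\<^esub> q)"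

definition path_degree :: "('v, 'a) pre_digraph \<Rightarrow> nat \<Rightarrow> (('v, 'a) path \<Rightarrow> 'k::field) set" where
  "path_degree G n = {f \<in> carrier (path_algebra G). \<forall>u p v. f (u, p, v) \<noteq> 0 \<longrightarrow> length p = n}"

text \<open>
  The dimension matrix of a bimodule \<open>M\<close> over the span of orthogonal idempotents \<open>e i\<close>, where \<open>M\<close>
  lies in a ring \<open>R\<close> that contains the ground field as its subfield \<open>K\<close>.
\<close>

definition dim_matrix ::
  "('b, 'm) ring_scheme \<Rightarrow> 'b set \<Rightarrow> ('v::finite \<Rightarrow> 'b) \<Rightarrow> 'b set \<Rightarrow> (int, 'v) sqmat" where
  "dim_matrix R K e M =
    Sqmat (\<chi> i j. int (ring.dim R K {e i \<otimes>\<^bsub>R\<^esub> x \<otimes>\<^bsub>R\<^esub> e j | x. x \<in> M}))"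


section \<open>The preprojective algebra\<close>

datatype 'a darrow = Arr 'a | Opp 'a

definition double_quiver :: "('v, 'a) pre_digraph \<Rightarrow> ('v, 'a darrow) pre_digraph" where
  "double_quiver Q =
    \<lparr> verts = verts Q,
      arcs = Arr ` arcs Q \<union> Opp ` arcs Q,
      tail = (\<lambda>b. case b of Arr a \<Rightarrow> tail Q a | Opp a \<Rightarrow> head Q a),
      head = (\<lambda>b. case b of Arr a \<Rightarrow> head Q a | Opp a \<Rightarrow> tail Q a) \<rparr>"

definition mesh_relation ::
  "('v, 'a) pre_digraph \<Rightarrow> 'v \<Rightarrow> ('v, 'a darrow) path \<Rightarrow> 'k::field" where
  "mesh_relation Q i = (\<lambda>q.
      (\<Sum>a\<in>{a \<in> arcs Q. tail Q a = i}. basis (i, [Arr a, Opp a], i) q)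
    - (\<Sum>a\<in>{a \<in> arcs Q. head Q a = i}. basis (i, [Opp a, Arr a], i) q))"

definition mesh_ideal :: "('v, 'a) pre_digraph \<Rightarrow> (('v, 'a darrow) path \<Rightarrow> 'k::field) set" where
  "mesh_ideal Q = genideal (path_algebra (double_quiver Q)) (mesh_relation Q ` verts Q)"

type_synonym ('v, 'a, 'k) preproj = "(('v, 'a darrow) path \<Rightarrow> 'k) set"

definition preproj_algebra :: "('v, 'a) pre_digraph \<Rightarrow> ('v, 'a, 'k::field) preproj ring" where
  "preproj_algebra Q = path_algebra (double_quiver Q) Quot mesh_ideal Q"

definition preproj_class ::
  "('v, 'a) pre_digraph \<Rightarrow> (('v, 'a darrow) path \<Rightarrow> 'k::field) \<Rightarrow> ('v, 'a, 'k) preproj" where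
  "preproj_class Q f = mesh_ideal Q +>\<^bsub>path_algebra (double_quiver Q)\<^esub> f"

definition preproj_scalar :: "('v, 'a) pre_digraph \<Rightarrow> 'k::field \<Rightarrow> ('v, 'a, 'k) preproj" where
  "preproj_scalar Q c = preproj_class Q (path_scalar (double_quiver Q) c)"

definition preproj_idem :: "('v, 'a) pre_digraph \<Rightarrow> 'v \<Rightarrow> ('v, 'a, 'k::field) preproj" where
  "preproj_idem Q i = preproj_class Q (basis (i, [], i))"

definition preproj_degree :: "('v, 'a) pre_digraph \<Rightarrow> nat \<Rightarrow> ('v, 'a, 'k::field) preproj set" where
  "preproj_degree Q n = preproj_class Q ` path_degree (double_quiver Q) n"

definition hilbert_series ::
  "'k::field itself \<Rightarrow> ('v::finite, 'a) pre_digraph \<Rightarrow> (int, 'v) sqmat fps" where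
  "hilbert_series _ Q = Abs_fps (\<lambda>n.
    dim_matrix (preproj_algebra Q) (range (preproj_scalar Q :: 'k \<Rightarrow> _)) (preproj_idem Q)
      (preproj_degree Q n))"

definition adjacency_matrix ::
  "'k::field itself \<Rightarrow> ('v::finite, 'a) pre_digraph \<Rightarrow> (int, 'v) sqmat" where
  "adjacency_matrix _ G =
    dim_matrix (path_algebra G) (range (path_scalar G :: 'k \<Rightarrow> _)) (\<lambda>i. basis (i, [], i))
      (path_degree G 1)"


section \<open>Nakayama automorphisms\<close>

definition preproj_dual ::
  "('v, 'a) pre_digraph \<Rightarrow> (('v, 'a, 'k::field) preproj \<Rightarrow> 'k) set" where
  "preproj_dual Q =
    {f \<in> extensional (carrier (preproj_algebra Q)).
      (\<forall>x\<in>carrier (preproj_algebra Q). \<forall>y\<in>carrier (preproj_algebra Q).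
        f (x \<oplus>\<^bsub>preproj_algebra Q\<^esub> y) = f x + f y) \<and>
      (\<forall>c. \<forall>x\<in>carrier (preproj_algebra Q).
        f (preproj_scalar Q c \<otimes>\<^bsub>preproj_algebra Q\<^esub> x) = c * f x)}"

text \<open>
  The bimodule structure on the dual is \<open>(a f b)(y) = f (b y a)\<close>; in the twisted bimodule, \<open>a\<close>
  acts on the left as multiplication by \<open>\<nu> a\<close>. Linearity of \<open>\<phi>\<close> over the ground field is
  the case where \<open>a\<close> is a scalar.
\<close>

definition nakayama_automorphism ::
  "('v, 'a) pre_digraph \<Rightarrow> (('v, 'a, 'k::field) preproj \<Rightarrow> ('v, 'a, 'k) preproj) \<Rightarrow> bool" where
  "nakayama_automorphism Q \<nu> \<longleftrightarrow>
    (let R = preproj_algebra Q in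
      \<nu> \<in> ring_iso R R \<and>
      (\<forall>c. \<nu> (preproj_scalar Q c) = preproj_scalar Q c) \<and>
      (\<exists>\<phi>. bij_betw \<phi> (carrier R) (preproj_dual Q) \<and>
        (\<forall>x\<in>carrier R. \<forall>y\<in>carrier R. \<forall>z\<in>carrier R. \<phi> (x \<oplus>\<^bsub>R\<^esub> y) z = \<phi> x z + \<phi> y z) \<and>
        (\<forall>a\<in>carrier R. \<forall>x\<in>carrier R. \<forall>b\<in>carrier R. \<forall>y\<in>carrier R.
          \<phi> (\<nu> a \<otimes>\<^bsub>R\<^esub> x \<otimes>\<^bsub>R\<^esub> b) y = \<phi> x (b \<otimes>\<^bsub>R\<^esub> y \<otimes>\<^bsub>R\<^esub> a))))"

definition left_ideal_of :: "('b, 'm) ring_scheme \<Rightarrow> 'b \<Rightarrow> 'b set" where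
  "left_ideal_of R e = {x \<otimes>\<^bsub>R\<^esub> e | x. x \<in> carrier R}"

definition left_ideals_isomorphic :: "('b, 'm) ring_scheme \<Rightarrow> 'b set \<Rightarrow> 'b set \<Rightarrow> bool" where
  "left_ideals_isomorphic R M N \<longleftrightarrow>
    (\<exists>\<psi>. bij_betw \<psi> M N \<and>
      (\<forall>x\<in>M. \<forall>y\<in>M. \<psi> (x \<oplus>\<^bsub>R\<^esub> y) = \<psi> x \<oplus>\<^bsub>R\<^esub> \<psi> y) \<and>
      (\<forall>a\<in>carrier R. \<forall>x\<in>M. \<psi> (a \<otimes>\<^bsub>R\<^esub> x) = a \<otimes>\<^bsub>R\<^esub> \<psi> x))"

text \<open>
  At most one \<open>\<sigma>\<close> satisfies this for a given \<open>\<nu>\<close>, up to its values outside the vertex set.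
\<close>

definition nakayama_permutation ::
  "('v, 'a) pre_digraph \<Rightarrow> (('v, 'a, 'k::field) preproj \<Rightarrow> ('v, 'a, 'k) preproj) \<Rightarrow>
    ('v \<Rightarrow> 'v) \<Rightarrow> bool" where
  "nakayama_permutation Q \<nu> \<sigma> \<longleftrightarrow>
    (\<forall>i\<in>verts Q. \<sigma> i \<in> verts Q \<and>
      left_ideals_isomorphic (preproj_algebra Q)
        (left_ideal_of (preproj_algebra Q) (\<nu> (preproj_idem Q i)))
        (left_ideal_of (preproj_algebra Q) (preproj_idem Q (\<sigma> i))))"

definition permutation_matrix :: "('v::finite \<Rightarrow> 'v) \<Rightarrow> (int, 'v) sqmat" where
  "permutation_matrix \<sigma> = Sqmat (\<chi> i j. if \<sigma> i = j then 1 else 0)"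


section \<open>Dynkin quivers\<close>

datatype dynkin_type = Dynkin_A nat | Dynkin_D nat | Dynkin_E6 | Dynkin_E7 | Dynkin_E8

fun dynkin_valid :: "dynkin_type \<Rightarrow> bool" where
  "dynkin_valid (Dynkin_A n) \<longleftrightarrow> n \<ge> 1"
| "dynkin_valid (Dynkin_D n) \<longleftrightarrow> n \<ge> 4"
| "dynkin_valid _ \<longleftrightarrow> True"

fun dynkin_rank :: "dynkin_type \<Rightarrow> nat" where
  "dynkin_rank (Dynkin_A n) = n"
| "dynkin_rank (Dynkin_D n) = n"
| "dynkin_rank Dynkin_E6 = 6"
| "dynkin_rank Dynkin_E7 = 7"
| "dynkin_rank Dynkin_E8 = 8"

fun coxeter_number :: "dynkin_type \<Rightarrow> nat" where
  "coxeter_number (Dynkin_A n) = n + 1"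
| "coxeter_number (Dynkin_D n) = 2 * n - 2"
| "coxeter_number Dynkin_E6 = 12"
| "coxeter_number Dynkin_E7 = 18"
| "coxeter_number Dynkin_E8 = 30"

text \<open>
  The vertices of the diagram of rank \<open>r\<close> are \<open>1, \<dots>, r\<close>. Types D and E are a chain
  on \<open>1, \<dots>, r - 1\<close> with the vertex \<open>r\<close> attached to \<open>r - 2\<close> and to \<open>3\<close>, respectively.
\<close>

definition chain_edges :: "nat \<Rightarrow> nat set set" where
  "chain_edges n = {{i, i + 1} | i. 1 \<le> i \<and> i < n}"

fun dynkin_edges :: "dynkin_type \<Rightarrow> nat set set" where
  "dynkin_edges (Dynkin_A n) = chain_edges n"
| "dynkin_edges (Dynkin_D n) = insert {n - 2, n} (chain_edges (n - 1))"
| "dynkin_edges Dynkin_E6 = insert {3, 6} (chain_edges 5)"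
| "dynkin_edges Dynkin_E7 = insert {3, 7} (chain_edges 6)"
| "dynkin_edges Dynkin_E8 = insert {3, 8} (chain_edges 7)"

text \<open>
  The second \<open>bij_betw\<close> says that every edge of the diagram comes from exactly one arrow and that
  there are no other arrows.
\<close>

definition dynkin_quiver :: "('v, 'a) pre_digraph \<Rightarrow> dynkin_type \<Rightarrow> bool" where
  "dynkin_quiver Q T \<longleftrightarrow>
    fin_digraph Q \<and> dynkin_valid T \<and>
    (\<exists>f. bij_betw f {1..dynkin_rank T} (verts Q) \<and>
      bij_betw (\<lambda>a. {tail Q a, head Q a}) (arcs Q) ((`) f ` dynkin_edges T))"

end

theory Submission
  imports Defs "HOL-Library.Function_Algebras"
begin

text \<open>
  Let \<open>S\<close> be the set of elements of \<open>\<Pi>\<close> that are annihilated on the right by all arrows. The mesh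
  ideal \<open>I\<close> satisfies \<open>I\<^sub>n\<^sub>+\<^sub>2 e\<^sub>j = \<Sum>\<^sub>b I\<^sub>n\<^sub>+\<^sub>1 b + (kQ)\<^sub>n \<rho>\<^sub>j\<close>, where \<open>b\<close> runs over the arrows of the double
  quiver that end at \<open>j\<close>, and \<open>x \<rho>\<^sub>j\<close> lies in the first summand exactly when \<open>x\<close> represents an element
  of \<open>S\<close>. Counting dimensions gives \<open>h\<^sub>\<Pi>(t) (1 - C t + t\<^sup>2) = 1 + t\<^sup>2 h\<^sub>S(t)\<close> for every quiver.

  The functional \<open>\<phi>(1)\<close>, for a bimodule isomorphism \<open>\<phi>\<close> from the twisted \<open>\<Pi>\<close> to its dual, shows that
  \<open>S e\<^sub>j\<close> is one-dimensional and contained in \<open>e\<^sub>i \<Pi>\<^sub>m\<close> for \<open>i = \<sigma>(j)\<close> and some degree \<open>m\<close>. Let \<open>v\<close> be a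
  positive eigenvector of \<open>C\<close> for the eigenvalue \<open>2 cos (\<pi>/h)\<close>. The numbers \<open>w\<^sub>n = ([\<Pi>\<^sub>n] v)\<^sub>i\<close> are
  nonnegative and satisfy the Chebyshev recurrence, except for one impulse at \<open>n = m + 2\<close>. Hence they
  are a sum of two shifted sine waves that change sign under \<open>n \<mapsto> n + h\<close>, the second one starting at
  the impulse, and they can only be nonnegative if the impulse comes at \<open>n = h\<close> and they vanish from
  \<open>n = h - 1\<close> on.

  So the right-hand side is \<open>1 + P\<^sup>T t\<^sup>h\<close>, and \<open>P\<^sup>T = [\<Pi>\<^sub>h\<^sub>-\<^sub>2]\<close> is a polynomial in the symmetric matrix \<open>C\<close>,
  which gives \<open>P\<^sup>T = P\<close>.
\<close>


section \<open>Dimensions of vector spaces mapped into a ring\<close>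

text \<open>Nothing relates the given isomorphism \<open>\<phi>\<close> to the grading, so the
  degree \<open>m\<close> of \<open>S e_j\<close> is at first unknown and may depend on
  \<open>j\<close>, and nothing links \<open>\<Pi>\<close> with \<open>h\<close>. The Coxeter number
  enters only through the eigenvalue \<open>2 cos (\<pi>/h)\<close>; nonnegativity of dimensions is
  what ties it to \<open>m\<close>. Weighting by an eigenvector turns the matrix recurrence into one
  scalar recurrence per row, with a single impulse in each row because \<open>\<sigma>\<close> is
  injective. Since the weights are positive, the vanishing of a weighted sum can be read back entry
  by entry, so the finite dimension of \<open>\<Pi>\<close> comes out of the argument.

  All counting takes place among subspaces of the path algebra. There an element of positive degree
  has unique coefficients at its last arrows, which makes the sum over arrows direct and lets its
  overlap with the multiples of a mesh relation be found by comparing coefficients, in every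
  characteristic.

  The transpose of \<open>P\<close> appears because \<open>S e_j\<close> is supported in row
  \<open>\<sigma> j\<close> and column \<open>j\<close>. Its symmetry says that
  \<open>\<sigma>\<close> is an involution, which is obtained from the shape of the recurrence and
  not from the automorphism.\<close>

locale scalar_space = vector_space scale
  for scale :: "'a::field \<Rightarrow> 'b::ab_group_add \<Rightarrow> 'b"
begin

definition finite_dim :: "'b set \<Rightarrow> bool" where
  "finite_dim U \<longleftrightarrow> (\<exists>B. finite B \<and> U \<subseteq> span B)"

lemma finite_dim_mono: "finite_dim V \<Longrightarrow> U \<subseteq> V \<Longrightarrow> finite_dim U"
  unfolding finite_dim_def by blast

lemma finite_dim_extend_basis:
  assumes U: "subspace U" "finite_dim U" and B: "independent B" "B \<subseteq> U"
  obtains D where "B \<subseteq> D" "D \<subseteq> U" "independent D" "span D = U" "finite D"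
proof -
  obtain D where D: "B \<subseteq> D" "D \<subseteq> U" "independent D" "U \<subseteq> span D"
    using maximal_independent_subset_extend[OF B(2,1)] by metis
  obtain E where "finite E" "U \<subseteq> span E"
    using U(2) unfolding finite_dim_def by blast
  then have "finite D"
    using independent_span_bound[of E D] D by blast
  moreover have "span D = U"
    using D span_minimal[OF D(2) U(1)] by blast
  ultimately show thesis using that D by blast
qed

lemma finite_dim_basis:
  assumes "subspace U" "finite_dim U"
  obtains D where "independent D" "span D = U" "finite D" "card D = dim U"
proof -
  obtain D where D: "independent D" "span D = U" "finite D"
    using finite_dim_extend_basis[OF assms independent_empty] by blast
  then show thesis using that[of D] dim_span_eq_card_independent by metis
qed

text \<open>Rank-nullity for \<open>T\<close> on \<open>U\<close> followed by reduction modulo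
  \<open>A\<close>, without forming a quotient: the images of a basis of \<open>U\<close> modulo the
  kernel extend a basis of \<open>A\<close> one vector at a time. It serves both for the direct sum
  over arrows and for the overlap of the two summands of the mesh ideal.\<close>

lemma dim_sum_image:
  assumes lin: "module_hom scale scale T"
    and U: "subspace U" "finite_dim U" and A: "subspace A" "finite_dim A"
  shows "dim {a + T u | a u. a \<in> A \<and> u \<in> U} + dim {u \<in> U. T u \<in> A} = dim A + dim U"
proof -
  interpret T: module_hom scale scale T by (fact lin)
  let ?K = "{u \<in> U. T u \<in> A}"
  have K: "subspace ?K"
    using U(1) A(1) by (auto simp: subspace_def T.add T.scale T.zero)
  have "finite_dim ?K" using finite_dim_mono[OF U(2)] by auto
  then obtain BK where BK: "independent BK" "span BK = ?K" "finite BK" "card BK = dim ?K"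
    using finite_dim_basis[OF K] by blast
  have "BK \<subseteq> U" using BK(2) span_superset[of BK] by blast
  then obtain B where B: "BK \<subseteq> B" "B \<subseteq> U" "independent B" "span B = U" "finite B"
    using finite_dim_extend_basis[OF U BK(1)] by blast
  obtain BA where BA: "independent BA" "span BA = A" "finite BA" "card BA = dim A"
    using finite_dim_basis[OF A] by blast
  have step: "\<exists>D. finite D \<and> independent D \<and> span D = {a + T u | a u. a \<in> A \<and> u \<in> span S} \<and>
      card D = dim A + card S" if "finite S" "S \<subseteq> B - BK" for S
    using that
  proof (induction S rule: finite_induct)
    case empty
    show ?case
      using BA by (intro exI[of _ BA]) (auto simp: T.zero)
  next
    case (insert b S)
    then obtain D where D: "finite D" "independent D"
      "span D = {a + T u | a u. a \<in> A \<and> u \<in> span S}" "card D = dim A + card S"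
      by auto
    have nin: "T b \<notin> span D"
    proof
      assume "T b \<in> span D"
      then obtain a u where au: "T b = a + T u" "a \<in> A" "u \<in> span S" using D(3) by auto
      have "T (b - u) = a" using au(1) T.diff by simp
      moreover have "b - u \<in> U"
        using insert.prems B(2,4) au(3) U(1) span_mono[of S B]
        by (intro subspace_diff[OF U(1)]) auto
      ultimately have "b - u \<in> span BK" using au(2) BK(2) by simp
      then have "b - u \<in> span (B - {b})"
        using span_mono[of BK "B - {b}"] B(1) insert.prems by blast
      moreover have "u \<in> span (B - {b})"
        using span_mono[of S "B - {b}"] insert.prems insert.hyps(2) au(3) by blast
      ultimately have "b - u + u \<in> span (B - {b})" by (rule span_add)
      then show False using B(3) insert.prems unfolding dependent_def by auto
    qed
    then have "T b \<notin> D" using span_base by blast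
    moreover have "span (insert (T b) D) = {a + T u | a u. a \<in> A \<and> u \<in> span (insert b S)}"
    proof (intro Set.set_eqI iffI)
      fix x assume "x \<in> span (insert (T b) D)"
      then obtain k where "x - scale k (T b) \<in> span D" by (auto simp: span_insert)
      then obtain a u where au: "x - scale k (T b) = a + T u" "a \<in> A" "u \<in> span S"
        using D(3) by auto
      have "x = a + T (scale k b + u)"
        using au(1) by (simp add: T.add T.scale algebra_simps)
      moreover have "scale k b + u \<in> span (insert b S)"
        using au(3) span_mono[of S "insert b S"]
        by (intro span_add span_scale) (auto intro: span_base)
      ultimately show "x \<in> {a + T u | a u. a \<in> A \<and> u \<in> span (insert b S)}"
        using au(2) by blast
    next
      fix x assume "x \<in> {a + T u | a u. a \<in> A \<and> u \<in> span (insert b S)}"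
      then obtain a u k where au: "x = a + T u" "a \<in> A" "u - scale k b \<in> span S"
        by (auto simp: span_insert)
      have "x - scale k (T b) = a + T (u - scale k b)"
        using au(1) by (simp add: T.diff T.scale)
      then have "x - scale k (T b) \<in> span D" using au(2,3) D(3) by auto
      then show "x \<in> span (insert (T b) D)" by (auto simp: span_insert)
    qed
    moreover have "independent (insert (T b) D)"
      using nin D(2) independent_insertI by blast
    ultimately show ?case
      using D insert.hyps by (intro exI[of _ "insert (T b) D"]) auto
  qed
  obtain D where D: "independent D" "span D = {a + T u | a u. a \<in> A \<and> u \<in> span (B - BK)}"
    "card D = dim A + card (B - BK)"
    using step[of "B - BK"] B(5) by auto
  have "{a + T u | a u. a \<in> A \<and> u \<in> span (B - BK)} = {a + T u | a u. a \<in> A \<and> u \<in> U}"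
  proof (intro Set.set_eqI iffI)
    fix x assume "x \<in> {a + T u | a u. a \<in> A \<and> u \<in> span (B - BK)}"
    then show "x \<in> {a + T u | a u. a \<in> A \<and> u \<in> U}"
      using B(4) span_mono[of "B - BK" B] by blast
  next
    fix x assume "x \<in> {a + T u | a u. a \<in> A \<and> u \<in> U}"
    then obtain a u where au: "x = a + T u" "a \<in> A" "u \<in> U" by auto
    have "u \<in> span (BK \<union> (B - BK))" using au(3) B(1,4) by (simp add: Un_absorb1)
    then obtain k u' where k: "u = k + u'" "k \<in> span BK" "u' \<in> span (B - BK)"
      unfolding span_Un by blast
    then have "a + T k \<in> A" using BK(2) au(2) A(1) subspace_add by blast
    then show "x \<in> {a + T u | a u. a \<in> A \<and> u \<in> span (B - BK)}"
      using au(1) k by (auto simp: T.add) (metis add.assoc)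
  qed
  then have "dim {a + T u | a u. a \<in> A \<and> u \<in> U} = dim A + card (B - BK)"
    using D dim_span_eq_card_independent by metis
  moreover have "card (B - BK) = dim U - dim ?K" "dim ?K \<le> dim U"
    using B BK by (metis card_Diff_subset dim_span_eq_card_independent,
        metis card_mono dim_span_eq_card_independent)
  ultimately show ?thesis by simp
qed

lemma dim_insert_notin:
  assumes "subspace U" "finite_dim U" "x \<notin> U"
  shows "dim (span (insert x U)) = Suc (dim U)"
proof -
  obtain D where D: "independent D" "span D = U" "finite D" "card D = dim U"
    using finite_dim_basis[OF assms(1,2)] by blast
  have "independent (insert x D)" using D assms(3) independent_insertI by blast
  moreover have "span (insert x U) = span (insert x D)"
    using D(2) by (metis span_insert span_span)
  moreover have "x \<notin> D" using D(2) assms(3) span_base by blast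
  ultimately show ?thesis using D dim_span_eq_card_independent by (metis card_insert_disjoint)
qed

lemma dim_0 [simp]: "dim {0} = 0"
  using dim_span_eq_card_independent[OF independent_empty] by simp

text \<open>Bridge between two notions of dimension: \<open>dim\<close> on function spaces, where
  the counting is done, and \<open>ring.dim\<close> over a subfield, in which the Hilbert series is
  defined. \<open>N\<close> is the kernel of \<open>cl\<close>; the basis vectors of
  \<open>U\<close> outside \<open>U \<inter> N\<close> give successive line extensions of the
  image.\<close>

lemma dim_linear_image_ring:
  fixes R :: "('r, 'm) ring_scheme" and sc :: "'a \<Rightarrow> 'r" and cl :: "'b \<Rightarrow> 'r"
  assumes R: "ring R" and K: "subfield (range sc) R"
    and U: "subspace U" "finite_dim U" and N: "subspace N"
    and car: "\<And>x. x \<in> U \<Longrightarrow> cl x \<in> carrier R"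
    and add: "\<And>x y. x \<in> U \<Longrightarrow> y \<in> U \<Longrightarrow> cl (x + y) = cl x \<oplus>\<^bsub>R\<^esub> cl y"
    and scl: "\<And>c x. x \<in> U \<Longrightarrow> cl (scale c x) = sc c \<otimes>\<^bsub>R\<^esub> cl x"
    and eq: "\<And>x y. x \<in> U \<Longrightarrow> y \<in> U \<Longrightarrow> cl x = cl y \<longleftrightarrow> x - y \<in> N"
  shows "int (ring.dim R (range sc) (cl ` U)) = int (dim U) - int (dim (U \<inter> N))"
proof -
  interpret R: ring R by (fact R)
  have I: "subspace (U \<inter> N)" using U(1) N by (rule subspace_inter)
  have "finite_dim (U \<inter> N)" using finite_dim_mono[OF U(2)] by auto
  then obtain BK where BK: "independent BK" "span BK = U \<inter> N" "finite BK" "card BK = dim (U \<inter> N)"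
    using finite_dim_basis[OF I] by blast
  have "BK \<subseteq> U" using BK(2) span_superset[of BK] by blast
  then obtain B where B: "BK \<subseteq> B" "B \<subseteq> U" "independent B" "span B = U" "finite B"
    using finite_dim_extend_basis[OF U BK(1)] by blast
  have cl0: "cl 0 = \<zero>\<^bsub>R\<^esub>"
    using add[of 0 0] subspace_0[OF U(1)] car[of 0] by (simp add: R.add.r_cancel_one')
  have subU: "x \<in> U" if "x \<in> span S" "S \<subseteq> B" for x S
    using that span_mono[of S B] B(4) by blast
  have step: "R.dimension (card S) (range sc) (cl ` span S)" if "finite S" "S \<subseteq> B - BK" for S
    using that
  proof (induction S rule: finite_induct)
    case empty
    show ?case using cl0 by simp
  next
    case (insert b S)
    have bU: "b \<in> U" using insert.prems B(2) by auto
    have sU: "x \<in> U" if "x \<in> span S" for x using that insert.prems by (intro subU[of x S]) auto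
    have nin: "cl b \<notin> cl ` span S"
    proof
      assume "cl b \<in> cl ` span S"
      then obtain u where u: "u \<in> span S" "cl b = cl u" by auto
      then have "b - u \<in> U \<inter> N" using eq[of b u] bU sU subspace_diff[OF U(1)] by auto
      then have "b - u \<in> span BK" using BK(2) by simp
      then have "b - u \<in> span (B - {b})"
        using span_mono[of BK "B - {b}"] B(1) insert.prems by blast
      moreover have "u \<in> span (B - {b})"
        using span_mono[of S "B - {b}"] insert.prems insert.hyps(2) u(1) by blast
      ultimately have "b - u + u \<in> span (B - {b})" by (rule span_add)
      then show False using B(3) insert.prems unfolding dependent_def by auto
    qed
    have "cl ` span (insert b S) = R.line_extension (range sc) (cl b) (cl ` span S)"
    proof (intro Set.set_eqI iffI)
      fix y assume "y \<in> cl ` span (insert b S)"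
      then obtain x k where x: "y = cl x" "x - scale k b \<in> span S" by (auto simp: span_insert)
      have "y = cl (scale k b + (x - scale k b))" using x by simp
      also have "\<dots> = cl (scale k b) \<oplus>\<^bsub>R\<^esub> cl (x - scale k b)"
        using x sU bU subspace_scale[OF U(1)] by (intro add) auto
      also have "\<dots> = sc k \<otimes>\<^bsub>R\<^esub> cl b \<oplus>\<^bsub>R\<^esub> cl (x - scale k b)"
        using scl[OF bU] by simp
      finally show "y \<in> R.line_extension (range sc) (cl b) (cl ` span S)"
        using x(2) unfolding R.line_extension_def set_add_def' r_coset_def by blast
    next
      fix y assume "y \<in> R.line_extension (range sc) (cl b) (cl ` span S)"
      then obtain k s where y: "y = sc k \<otimes>\<^bsub>R\<^esub> cl b \<oplus>\<^bsub>R\<^esub> cl s" "s \<in> span S"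
        unfolding R.line_extension_def set_add_def' r_coset_def by blast
      have "y = cl (scale k b + s)"
        using y bU sU subspace_scale[OF U(1)] scl[OF bU] by (subst add) auto
      moreover have "scale k b + s \<in> span (insert b S)"
        using y(2) by (simp add: span_insert)
          (metis add_diff_cancel_left')
      ultimately show "y \<in> cl ` span (insert b S)" by blast
    qed
    then show ?case
      using R.Suc_dim[OF car[OF bU] nin insert.IH] insert by simp
  qed
  have img: "cl ` U = cl ` span (B - BK)"
  proof (intro Set.set_eqI iffI)
    fix y assume "y \<in> cl ` U"
    then obtain x where x: "x \<in> U" "y = cl x" by auto
    have "x \<in> span (BK \<union> (B - BK))" using x(1) B(1,4) by (simp add: Un_absorb1)
    then obtain k u' where k: "x = k + u'" "k \<in> span BK" "u' \<in> span (B - BK)"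
      unfolding span_Un by blast
    have "x - u' \<in> N" using k BK(2) by simp
    then have "cl x = cl u'" using eq[of x u'] x(1) subU[OF k(3)] by auto
    then show "y \<in> cl ` span (B - BK)" using x k by auto
  next
    fix y assume "y \<in> cl ` span (B - BK)"
    then show "y \<in> cl ` U" using subU by auto
  qed
  have card: "card (B - BK) = dim U - dim (U \<inter> N)" "dim (U \<inter> N) \<le> dim U"
    using B BK by (metis card_Diff_subset dim_span_eq_card_independent,
        metis card_mono dim_span_eq_card_independent)
  then have d: "R.dimension (dim U - dim (U \<inter> N)) (range sc) (cl ` U)"
    using step[of "B - BK"] B(5) img by simp
  have "R.dim (range sc) (cl ` U) = dim U - dim (U \<inter> N)"
    unfolding R.dim_def using d R.dimension_is_inj[OF K] by blast
  then show ?thesis using card(2) by (simp add: of_nat_diff)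
qed

end


section \<open>Positive eigenvectors of Dynkin diagrams\<close>

lemma sin_multiple_add: "sin (real (n + 2) * \<theta>) + sin (real n * \<theta>) = 2 * cos \<theta> * sin (real (n + 1) * \<theta>)"
  using sin_plus_sin[of "real (n + 2) * \<theta>" "real n * \<theta>"] by (simp add: algebra_simps add_divide_distrib)

text \<open>Up to the factor \<open>sin \<theta>\<close>, \<open>w\<close> is a free sine wave plus
  the response to the impulse. If the impulse came after \<open>h\<close>, the free wave would
  already be negative at \<open>h\<close>. Once it has come, \<open>w (n + h) = - w n\<close>, so
  nonnegativity makes both vanish, and the zero just before the impulse rules out
  \<open>d < h\<close>.\<close>

lemma nonneg_chebyshev_sequence:
  fixes w :: "nat \<Rightarrow> real" and h d :: nat and v c :: real
  defines "\<theta> \<equiv> pi / h"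
  assumes h: "h \<ge> 2" and d: "d \<ge> 2" and v: "v > 0"
    and w0: "w 0 = v" and w1: "w 1 = 2 * cos \<theta> * v"
    and rec: "\<And>n. w (n + 2) = 2 * cos \<theta> * w (n + 1) - w n + (if n + 2 = d then c else 0)"
    and nonneg: "\<And>n. w n \<ge> 0"
  shows "d = h" and "\<And>n. n \<ge> h - 1 \<Longrightarrow> w n = 0"
proof -
  \<comment> \<open>Response to the impulse, scaled by \<open>sin \<theta>\<close> to avoid
    division. It is started at \<open>n = d - 1\<close>, where it is \<open>sin 0\<close>, so that
    the sign change under a shift by \<open>h\<close> is available one index before the
    impulse.\<close>
  define e where "e n = (if d \<le> n + 1 then c * sin (real (n + 1 - d) * \<theta>) else 0)" for n
  define g where "g n = v * sin (real (n + 1) * \<theta>) + e n" for n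
  have s: "sin (real (n + 2) * \<theta>) = 2 * cos \<theta> * sin (real (n + 1) * \<theta>) - sin (real n * \<theta>)" for n
    using sin_multiple_add[of n \<theta>] by simp
  have e_rec: "e (n + 2) = 2 * cos \<theta> * e (n + 1) - e n + (if n + 2 = d then c * sin \<theta> else 0)" for n
  proof -
    have "n + 3 < d \<or> n + 3 = d \<or> n + 2 = d \<or> (\<exists>m. n + 1 = d + m)" by presburger
    then consider "n + 3 < d" | "n + 3 = d" | "n + 2 = d" | m where "n + 1 = d + m" by blast
    then show ?thesis
    proof cases
      case (4 m)
      then have "n + 2 + 1 - d = m + 2" "n + 1 + 1 - d = m + 1" "n + 1 - d = m"
        "d \<le> n + 1" "n + 2 \<noteq> d" by auto
      then have G: "e (n + 2) = c * sin (real (m + 2) * \<theta>)"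
        "e (n + 1) = c * sin (real (m + 1) * \<theta>)" "e n = c * sin (real m * \<theta>)"
        unfolding e_def by (simp_all add: numeral_3_eq_3)
      show ?thesis
        unfolding G s using \<open>n + 2 \<noteq> d\<close> by (simp add: algebra_simps)
    qed (auto simp: e_def)
  qed
  have g_rec: "g (n + 2) = 2 * cos \<theta> * g (n + 1) - g n + (if n + 2 = d then c * sin \<theta> else 0)" for n
  proof -
    have "sin (real (n + 2 + 1) * \<theta>) = 2 * cos \<theta> * sin (real (n + 1 + 1) * \<theta>) - sin (real (n + 1) * \<theta>)"
      using s[of "n + 1"] by (simp add: numeral_3_eq_3)
    then show ?thesis
      unfolding g_def e_rec by (simp only: \<open>sin (real (n + 2 + 1) * \<theta>) = _\<close>) (simp only: algebra_simps)
  qed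
  have th: "0 < \<theta>" "\<theta> < pi" using h by (auto simp: \<theta>_def field_simps)
  then have sp: "sin \<theta> > 0" by (rule sin_gt_zero)
  have hth: "real h * \<theta> = pi" using h by (simp add: \<theta>_def)
  have wg: "w n * sin \<theta> = g n \<and> w (n + 1) * sin \<theta> = g (n + 1)" for n
  proof (induction n)
    case 0
    show ?case using w0 w1 d sin_double[of \<theta>] by (auto simp: g_def e_def algebra_simps)
  next
    case (Suc n)
    have "w (n + 2) * sin \<theta> = 2 * cos \<theta> * (w (n + 1) * sin \<theta>) - w n * sin \<theta>
      + (if n + 2 = d then c else 0) * sin \<theta>"
      unfolding rec[of n] by (simp add: algebra_simps)
    also have "\<dots> = g (n + 2)" using Suc g_rec[of n] by simp
    finally show ?case using Suc by simp
  qed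
  have anti: "sin (real (n + h) * \<theta>) = - sin (real n * \<theta>)" for n
    using hth by (simp add: distrib_right)
  have dh: "d \<le> h"
  proof (rule ccontr)
    assume "\<not> d \<le> h"
    \<comment> \<open>At \<open>n = h\<close> the response is still zero (for
      \<open>d = h + 1\<close> it is \<open>sin 0\<close>), and the free wave has value
      \<open>- v * sin \<theta>\<close>.\<close>
    have "w h * sin \<theta> = v * sin (real (1 + h) * \<theta>) + (if d \<le> h + 1 then c * sin (real (h + 1 - d) * \<theta>) else 0)"
      using wg[of h] unfolding g_def e_def by (simp add: add.commute)
    also have "\<dots> = - v * sin \<theta>"
      using \<open>\<not> d \<le> h\<close> anti[of 1] by auto
    finally have "w h * sin \<theta> < 0" using v sp by simp
    moreover have "w h * sin \<theta> \<ge> 0" using nonneg[of h] sp by simp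
    ultimately show False by simp
  qed
  have g_anti: "g (n + h) = - g n" if "d \<le> n + 1" for n
  proof -
    have "n + h + 1 - d = n + 1 - d + h" using that by simp
    then show ?thesis using that anti[of "n + 1"] anti[of "n + 1 - d"] unfolding g_def e_def
      by (simp add: add.commute add.left_commute)
  qed
  have w_zero: "w n = 0" if "d \<le> n + 1" for n
  proof -
    have "w (n + h) * sin \<theta> = - (w n * sin \<theta>)" using wg[of n] wg[of "n + h"] g_anti[OF that] by simp
    then have "w (n + h) + w n = 0" using sp by (simp add: algebra_simps)
      (metis add_eq_0_iff mult_cancel_left mult_minus_right less_irrefl mult.commute)
    then show ?thesis using nonneg[of n] nonneg[of "n + h"] by linarith
  qed
  \<comment> \<open>The response vanishes at \<open>d - 1\<close>, so the free wave has a zero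
    there. The first positive zero of the sine is at \<open>pi\<close>, whence \<open>d\<close> is
    at least \<open>h\<close>.\<close>
  have "g (d - 1) = 0" using w_zero[of "d - 1"] wg[of "d - 1"] by simp
  then have "sin (real d * \<theta>) = 0" using d v by (simp add: g_def e_def)
  moreover have "0 < real d * \<theta>" using d th by simp
  ultimately have "\<not> real d * \<theta> < pi" using sin_gt_zero by force
  then have "real h * \<theta> \<le> real d * \<theta>" using hth by simp
  then have "h \<le> d" using th by simp
  then show "d = h" using dh by simp
  then show "w n = 0" if "n \<ge> h - 1" for n
    using w_zero[of n] that by simp
qed

section \<open>Explicit positive eigenvectors of chains and three-armed stars\<close>

lemma chain_edge_iff:
  "{i, j} \<in> chain_edges n \<longleftrightarrow> (j = i + 1 \<and> 1 \<le> i \<and> i < n) \<or> (i = j + 1 \<and> 1 \<le> j \<and> j < n)"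
  unfolding chain_edges_def by (auto simp: doubleton_eq_iff)

lemma chain_eigenvector:
  fixes n :: nat
  defines "\<theta> \<equiv> pi / (n + 1)"
  assumes i: "i \<in> {1..n}"
  shows "(\<Sum>j | j \<in> {1..n} \<and> {i, j} \<in> chain_edges n. sin (real j * \<theta>)) = 2 * cos \<theta> * sin (real i * \<theta>)"
proof -
  obtain k where k: "i = k + 1" using i by (metis atLeastAtMost_iff le_add_diff_inverse2)
  have "real (n + 1) * \<theta> = pi" by (simp add: \<theta>_def)
  then have e: "sin (real (n + 1) * \<theta>) = 0" by (metis sin_pi)
  have N: "{j. j \<in> {1..n} \<and> {i, j} \<in> chain_edges n} = {j \<in> {i + 1, i - 1}. 1 \<le> j \<and> j \<le> n}"
    using i by (auto simp: chain_edge_iff)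
  \<comment> \<open>A neighbour missing at an end of the chain has index \<open>0\<close> or
    \<open>n + 1\<close>, where the sine is zero, so both indices next to \<open>i\<close> may be
    summed.\<close>
  also have "(\<Sum>j\<in>\<dots>. sin (real j * \<theta>)) = (\<Sum>j\<in>{i + 1, i - 1}. sin (real j * \<theta>))"
  proof (rule sum.mono_neutral_left)
    show "\<forall>j\<in>{i + 1, i - 1} - {j \<in> {i + 1, i - 1}. 1 \<le> j \<and> j \<le> n}. sin (real j * \<theta>) = 0"
    proof
      fix j assume "j \<in> {i + 1, i - 1} - {j \<in> {i + 1, i - 1}. 1 \<le> j \<and> j \<le> n}"
      then have "j = 0 \<or> j = n + 1" using i by auto
      then show "sin (real j * \<theta>) = 0" using e by auto
    qed
  qed auto
  also have "\<dots> = 2 * cos \<theta> * sin (real i * \<theta>)"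
    using sin_multiple_add[of k \<theta>] k by simp
  finally show ?thesis .
qed

text \<open>
  The eigenvector on a star with arms of lengths \<open>c\<close>, \<open>r - c\<close> and \<open>2\<close> (the center included) is
  \<open>sin (k \<theta>)\<close> along each arm, scaled to be \<open>1\<close> at the center; only the equation at the center
  is a condition on \<open>\<theta>\<close>.
\<close>

lemma star_eigenvector:
  fixes c r :: nat and \<theta> :: real
  defines "v \<equiv> \<lambda>k. if k \<le> c then sin (real k * \<theta>) / sin (real c * \<theta>)
    else if k < r then sin (real (r - k) * \<theta>) / sin (real (r - c) * \<theta>)
    else sin \<theta> / sin (2 * \<theta>)"
  assumes c: "2 \<le> c" "c + 2 \<le> r" and th: "0 < \<theta>" "real c * \<theta> < pi" "real (r - c) * \<theta> < pi"
    and center: "sin (real (c - 1) * \<theta>) / sin (real c * \<theta>) +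
      sin (real (r - c - 1) * \<theta>) / sin (real (r - c) * \<theta>) + sin \<theta> / sin (2 * \<theta>) = 2 * cos \<theta>"
    and i: "i \<in> {1..r}"
  shows "v i > 0"
    and "(\<Sum>j | j \<in> {1..r} \<and> {i, j} \<in> insert {c, r} (chain_edges (r - 1)). v j) = 2 * cos \<theta> * v i"
proof -
  have pos: "sin (real k * \<theta>) > 0" if "0 < k" "k \<le> c \<or> k \<le> r - c" for k
  proof (rule sin_gt_zero)
    show "0 < real k * \<theta>" using that th by simp
    have "real k * \<theta> \<le> real c * \<theta> \<or> real k * \<theta> \<le> real (r - c) * \<theta>"
      using that th by auto
    then show "real k * \<theta> < pi" using th by linarith
  qed
  have pc: "sin (real c * \<theta>) > 0" "sin (real (r - c) * \<theta>) > 0" "sin (2 * \<theta>) > 0" "sin \<theta> > 0"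
    using pos[of c] pos[of "r - c"] pos[of 2] pos[of 1] c by auto
  show "v i > 0"
  proof -
    have "r - i \<le> r - c" if "\<not> i \<le> c" using that by simp
    then show ?thesis
      using i c pos[of i] pos[of "r - i"] pc unfolding v_def
      by (auto simp del: of_nat_diff)
  qed
  have vc: "v c = 1" using pc by (simp add: v_def)
  have v': "v k = sin (real (r - k) * \<theta>) / sin (real (r - c) * \<theta>)" if "c \<le> k" "k < r" for k
    using that pc by (auto simp: v_def le_less)
  have v0: "v 0 = 0" by (simp add: v_def)
  consider "i < c" | "i = c" | "c < i" "i < r" | "i = r" using i by fastforce
  then show "(\<Sum>j | j \<in> {1..r} \<and> {i, j} \<in> insert {c, r} (chain_edges (r - 1)). v j) = 2 * cos \<theta> * v i"
  proof cases
    case 1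
    obtain k where k: "i = k + 1" using i by (metis atLeastAtMost_iff le_add_diff_inverse2)
    have "{j. j \<in> {1..r} \<and> {i, j} \<in> insert {c, r} (chain_edges (r - 1))} = {i + 1, i - 1} - {0}"
      using 1 i c by (auto simp: chain_edge_iff doubleton_eq_iff)
    also have "(\<Sum>j\<in>\<dots>. v j) = (\<Sum>j\<in>{i + 1, i - 1}. v j)"
      using v0 by (intro sum.mono_neutral_left) auto
    also have "\<dots> = v (k + 2) + v k" using k by simp
    also have "\<dots> = (sin (real (k + 2) * \<theta>) + sin (real k * \<theta>)) / sin (real c * \<theta>)"
      using 1 k by (simp add: v_def add_divide_distrib)
    also have "\<dots> = 2 * cos \<theta> * v i"
      unfolding sin_multiple_add using 1 k by (simp add: v_def)
    finally show ?thesis .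
  next
    case 2
    have "{j. j \<in> {1..r} \<and> {i, j} \<in> insert {c, r} (chain_edges (r - 1))} = {c - 1, c + 1, r}"
      using 2 c by (auto simp: chain_edge_iff doubleton_eq_iff)
    also have "(\<Sum>j\<in>\<dots>. v j) = v (c - 1) + v (c + 1) + v r"
    proof -
      have "c - 1 \<noteq> c + 1" "c - 1 \<noteq> r" "c + 1 \<noteq> r" using c by auto
      then show ?thesis by simp
    qed
    also have "\<dots> = 2 * cos \<theta>"
      using center c v'[of "c + 1"] by (simp add: v_def)
    finally show ?thesis using vc 2 by simp
  next
    case 3
    obtain k where k: "r - i = k + 1" using 3 by (metis Suc_diff_Suc Suc_eq_plus1)
    have rk: "r - (i - 1) = k + 2" "r - (i + 1) = k" using k 3 by auto
    have "{j. j \<in> {1..r} \<and> {i, j} \<in> insert {c, r} (chain_edges (r - 1))} = {i - 1, i + 1} - {r}"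
      using 3 c by (auto simp: chain_edge_iff doubleton_eq_iff)
    \<comment> \<open>The second arm stops at \<open>r - 1\<close>, while \<open>r\<close> is the
      leaf of the third arm. For \<open>i = r - 1\<close> the missing neighbour is replaced by
      \<open>sin 0\<close>, since \<open>k = 0\<close> there.\<close>
    also have "(\<Sum>j\<in>\<dots>. v j) = v (i - 1) + sin (real k * \<theta>) / sin (real (r - c) * \<theta>)"
    proof (cases "i + 1 = r")
      case True
      then have "{i - 1, i + 1} - {r} = {i - 1}" "k = 0" using k by auto
      then show ?thesis by simp
    next
      case False
      then have "{i - 1, i + 1} - {r} = {i - 1, i + 1}" using 3 by auto
      then show ?thesis using v'[of "i + 1"] 3 rk False by (simp del: of_nat_diff)
    qed
    also have "\<dots> = (sin (real (k + 2) * \<theta>) + sin (real k * \<theta>)) / sin (real (r - c) * \<theta>)"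
    proof -
      have "v (i - 1) = sin (real (k + 2) * \<theta>) / sin (real (r - c) * \<theta>)"
        using v'[of "i - 1"] 3 unfolding rk by simp
      then show ?thesis by (simp only: add_divide_distrib)
    qed
    also have "\<dots> = 2 * cos \<theta> * v i"
      unfolding sin_multiple_add using v'[of i] 3 k by simp
    finally show ?thesis .
  next
    case 4
    have "{j. j \<in> {1..r} \<and> {i, j} \<in> insert {c, r} (chain_edges (r - 1))} = {c}"
      using 4 c by (auto simp: chain_edge_iff doubleton_eq_iff)
    moreover have "v r = sin \<theta> / sin (2 * \<theta>)" using c by (simp add: v_def)
    moreover have "cos \<theta> \<noteq> 0" using pc(3) unfolding sin_double by auto
    ultimately show ?thesis using vc 4 pc by (simp add: sin_double)
  qed
qed

lemma star_eigenvector_exists: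
  fixes c r :: nat and \<theta> :: real
  assumes "2 \<le> c" "c + 2 \<le> r" "0 < \<theta>" "real c * \<theta> < pi" "real (r - c) * \<theta> < pi"
    and "sin (real (c - 1) * \<theta>) / sin (real c * \<theta>) +
      sin (real (r - c - 1) * \<theta>) / sin (real (r - c) * \<theta>) + sin \<theta> / sin (2 * \<theta>) = 2 * cos \<theta>"
  shows "\<exists>v :: nat \<Rightarrow> real. \<forall>i\<in>{1..r}. v i > 0 \<and>
    (\<Sum>j | j \<in> {1..r} \<and> {i, j} \<in> insert {c, r} (chain_edges (r - 1)). v j) = 2 * cos \<theta> * v i"
  using star_eigenvector[OF assms] by (intro exI ballI conjI)

text \<open>These are the Chebyshev polynomials of the second kind in \<open>x / 2\<close>. They
  turn the equation at the center of a star of type E into a polynomial equation for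
  \<open>x\<close>.\<close>

lemma sin_multiples:
  fixes \<theta> :: real
  defines "x \<equiv> 2 * cos \<theta>"
  shows "sin (2 * \<theta>) = sin \<theta> * x" "sin (3 * \<theta>) = sin \<theta> * (x\<^sup>2 - 1)"
    "sin (4 * \<theta>) = sin \<theta> * (x ^ 3 - 2 * x)" "sin (5 * \<theta>) = sin \<theta> * (x ^ 4 - 3 * x\<^sup>2 + 1)"
proof -
  show 2: "sin (2 * \<theta>) = sin \<theta> * x" by (simp add: x_def sin_double)
  have "sin (3 * \<theta>) = x * sin (2 * \<theta>) - sin \<theta>"
    using sin_multiple_add[of 1 \<theta>] by (simp add: x_def)
  then show 3: "sin (3 * \<theta>) = sin \<theta> * (x\<^sup>2 - 1)" unfolding 2 by (simp add: algebra_simps power2_eq_square)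
  have "sin (4 * \<theta>) = x * sin (3 * \<theta>) - sin (2 * \<theta>)"
    using sin_multiple_add[of 2 \<theta>] by (simp add: x_def)
  then show 4: "sin (4 * \<theta>) = sin \<theta> * (x ^ 3 - 2 * x)" unfolding 2 3 by (simp add: algebra_simps power2_eq_square power3_eq_cube)
  have "sin (5 * \<theta>) = x * sin (4 * \<theta>) - sin (3 * \<theta>)"
    using sin_multiple_add[of 3 \<theta>] by (simp add: x_def)
  then show "sin (5 * \<theta>) = sin \<theta> * (x ^ 4 - 3 * x\<^sup>2 + 1)" unfolding 3 4 by (simp add: algebra_simps power2_eq_square power3_eq_cube power4_eq_xxxx)
qed

lemma add_fractions_eqI:
  fixes x :: "'a :: field"
  assumes "b \<noteq> 0" "d \<noteq> 0" "x \<noteq> 0" and "a * d * x + c * b * x + b * d = x * x * b * d"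
  shows "a / b + c / d + 1 / x = x"
  using assms by (simp add: divide_simps) (simp add: algebra_simps)

text \<open>\<open>2 * cos \<theta>\<close> is the Perron eigenvalue of the diagram. Type A is a
  chain; type D is a star with center \<open>n - 2\<close> and arms \<open>n - 2\<close>,
  \<open>2\<close>, \<open>2\<close>; type E of rank \<open>r\<close> is a star with center
  \<open>3\<close> and arms \<open>3\<close>, \<open>r - 3\<close>, \<open>2\<close>. For the stars
  the work is in the equation at the center.\<close>

lemma dynkin_eigenvector:
  assumes "dynkin_valid T"
  defines "\<theta> \<equiv> pi / coxeter_number T"
  obtains v :: "nat \<Rightarrow> real" where
    "\<And>i. i \<in> {1..dynkin_rank T} \<Longrightarrow> v i > 0"
    "\<And>i. i \<in> {1..dynkin_rank T} \<Longrightarrow>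
      (\<Sum>j | j \<in> {1..dynkin_rank T} \<and> {i, j} \<in> dynkin_edges T. v j) = 2 * cos \<theta> * v i"
proof (cases T)
  case (Dynkin_A n)
  show thesis
  proof (rule that[of "\<lambda>k. sin (real k * \<theta>)"])
    fix i assume i: "i \<in> {1..dynkin_rank T}"
    have "pi * real i < pi * real (n + 1)" using i Dynkin_A by simp
    then show "0 < sin (real i * \<theta>)"
      using i Dynkin_A by (intro sin_gt_zero) (auto simp: \<theta>_def field_simps)
    show "(\<Sum>j | j \<in> {1..dynkin_rank T} \<and> {i, j} \<in> dynkin_edges T. sin (real j * \<theta>)) =
        2 * cos \<theta> * sin (real i * \<theta>)"
      using i chain_eigenvector[of i n] Dynkin_A by (simp add: \<theta>_def add.commute)
  qed
next
  case (Dynkin_D n)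
  then have n: "n \<ge> 4" using assms by simp
  have th: "\<theta> = pi / real (2 * n - 2)" using Dynkin_D by (simp add: \<theta>_def)
  have pos: "0 < \<theta>" using n th by simp
  \<comment> \<open>As \<open>(n - 1) * \<theta> = pi / 2\<close>, the sines along the long arm near
    the center are cosines of \<open>\<theta>\<close> and \<open>2 * \<theta>\<close>, and the
    equation at the center reduces to double-angle formulas.\<close>
  have n1: "real (n - 2) * \<theta> = pi / 2 - \<theta>" "real (n - 3) * \<theta> = pi / 2 - 2 * \<theta>"
    using n by (simp_all add: th of_nat_diff field_simps)
  have sn: "sin (real (n - 2) * \<theta>) = cos \<theta>" "sin (real (n - 3) * \<theta>) = cos (2 * \<theta>)"
    unfolding n1 sin_diff by simp_all
  have small: "\<theta> \<le> pi / 6"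
    using n unfolding th by (intro divide_left_mono) auto
  have cp: "cos \<theta> > 0" using pos small pi_gt_zero by (intro cos_gt_zero) linarith+
  have sp: "sin \<theta> > 0" using pos small pi_gt_zero by (intro sin_gt_zero) linarith+
  have sub: "n - (n - 2) = 2" "n - 2 - 1 = n - 3" using n by auto
  have center: "sin (real (n - 2 - 1) * \<theta>) / sin (real (n - 2) * \<theta>) +
      sin (real (n - (n - 2) - 1) * \<theta>) / sin (real (n - (n - 2)) * \<theta>) + sin \<theta> / sin (2 * \<theta>) = 2 * cos \<theta>"
    unfolding sub sn using cp sp
    by (simp add: cos_double_cos sin_double divide_simps) (simp add: algebra_simps power2_eq_square)
  have lt: "real (n - 2) * \<theta> < pi" "real (n - (n - 2)) * \<theta> < pi"
    using n1 pos small sub by auto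
  have "\<exists>v :: nat \<Rightarrow> real. \<forall>i\<in>{1..n}. v i > 0 \<and>
      (\<Sum>j | j \<in> {1..n} \<and> {i, j} \<in> insert {n - 2, n} (chain_edges (n - 1)). v j) = 2 * cos \<theta> * v i"
    using pos lt center n by (intro star_eigenvector_exists) auto
  then show thesis
    using Dynkin_D by (elim exE, intro that) auto
next
  case Dynkin_E6
  then have th: "\<theta> = pi / 12" by (simp add: \<theta>_def)
  define x where "x = 2 * cos \<theta>"
  have pos: "0 < \<theta>" "real 3 * \<theta> < pi" "real (6 - 3) * \<theta> < pi" using pi_gt_zero by (auto simp: th)
  have nz: "sin \<theta> \<noteq> 0" "sin (2 * \<theta>) \<noteq> 0" "sin (3 * \<theta>) \<noteq> 0"
    by (intro order.strict_implies_not_eq[THEN not_sym] sin_gt_zero; simp add: th)+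
  \<comment> \<open>Here \<open>2 * \<theta> = pi / 6\<close>; squaring away the root of 3 gives the
    quartic satisfied by \<open>x\<close>.\<close>
  have "x\<^sup>2 - 2 = 2 * cos (2 * \<theta>)" by (simp add: x_def cos_double_cos power_mult_distrib)
  also have "\<dots> = sqrt 3" by (simp add: th cos_30)
  finally have "(x\<^sup>2 - 2)\<^sup>2 = 3" by simp
  then have x: "x ^ 4 - 4 * x\<^sup>2 + 1 = 0" by (simp add: power2_eq_square power4_eq_xxxx algebra_simps)
  have center: "sin (real (3 - 1) * \<theta>) / sin (real 3 * \<theta>) +
      sin (real (6 - 3 - 1) * \<theta>) / sin (real (6 - 3) * \<theta>) + sin \<theta> / sin (2 * \<theta>) = 2 * cos \<theta>"
  proof -
    have "x / (x\<^sup>2 - 1) + x / (x\<^sup>2 - 1) + 1 / x = x"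
    proof (rule add_fractions_eqI)
      show "x \<noteq> 0" "x\<^sup>2 - 1 \<noteq> 0" "(x\<^sup>2 - 1) \<noteq> 0"
        using nz unfolding sin_multiples x_def by auto
      \<comment> \<open>Cleared of denominators, the equation at the center contains the quartic as
        a factor. The cofactor \<open>x\<^sup>2 - 1\<close> remains because the two arms of length 3
        share this denominator.\<close>
      have "x * (x\<^sup>2 - 1) * x + x * (x\<^sup>2 - 1) * x + (x\<^sup>2 - 1) * (x\<^sup>2 - 1) - x * x * (x\<^sup>2 - 1) * (x\<^sup>2 - 1) =
          - (x\<^sup>2 - 1) * (x ^ 4 - 4 * x\<^sup>2 + 1)"
        by (simp add: algebra_simps eval_nat_numeral)
      then show "x * (x\<^sup>2 - 1) * x + x * (x\<^sup>2 - 1) * x + (x\<^sup>2 - 1) * (x\<^sup>2 - 1) = x * x * (x\<^sup>2 - 1) * (x\<^sup>2 - 1)"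
        using x by simp
    qed
    then show ?thesis
      using nz(1) by (simp add: sin_multiples x_def)
  qed
  have "\<exists>v :: nat \<Rightarrow> real. \<forall>i\<in>{1..6}. v i > 0 \<and>
      (\<Sum>j | j \<in> {1..6} \<and> {i, j} \<in> insert {3, 6} (chain_edges (6 - 1)). v j) = 2 * cos \<theta> * v i"
    using pos center by (intro star_eigenvector_exists) auto
  then show thesis
    using Dynkin_E6 by (elim exE, intro that) auto
next
  case Dynkin_E7
  then have th: "\<theta> = pi / 18" by (simp add: \<theta>_def)
  define x where "x = 2 * cos \<theta>"
  have pos: "0 < \<theta>" "real 3 * \<theta> < pi" "real (7 - 3) * \<theta> < pi" using pi_gt_zero by (auto simp: th)
  have nz: "sin \<theta> \<noteq> 0" "sin (2 * \<theta>) \<noteq> 0" "sin (3 * \<theta>) \<noteq> 0" "sin (4 * \<theta>) \<noteq> 0"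
    by (intro order.strict_implies_not_eq[THEN not_sym] sin_gt_zero; simp add: th)+
  have y: "x\<^sup>2 - 2 = 2 * cos (2 * \<theta>)" by (simp add: x_def cos_double_cos power_mult_distrib)
  \<comment> \<open>Here \<open>6 * \<theta> = pi / 3\<close>, so the triple-angle formula at
    \<open>2 * \<theta>\<close> gives a cubic for \<open>x\<^sup>2 - 2\<close>.\<close>
  have "cos (3 * (2 * \<theta>)) = 1 / 2" by (simp add: th cos_60)
  then have "(x\<^sup>2 - 2) ^ 3 - 3 * (x\<^sup>2 - 2) - 1 = 0"
    unfolding y cos_treble_cos by (simp add: power_mult_distrib)
  then have x: "x ^ 6 - 6 * x ^ 4 + 9 * x\<^sup>2 - 3 = 0" by (simp add: algebra_simps eval_nat_numeral)
  have center: "sin (real (3 - 1) * \<theta>) / sin (real 3 * \<theta>) +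
      sin (real (7 - 3 - 1) * \<theta>) / sin (real (7 - 3) * \<theta>) + sin \<theta> / sin (2 * \<theta>) = 2 * cos \<theta>"
  proof -
    have "x / (x\<^sup>2 - 1) + (x\<^sup>2 - 1) / (x ^ 3 - 2 * x) + 1 / x = x"
    proof (rule add_fractions_eqI)
      show "x \<noteq> 0" "x\<^sup>2 - 1 \<noteq> 0" "(x ^ 3 - 2 * x) \<noteq> 0"
        using nz unfolding sin_multiples x_def by auto
      have "x * (x ^ 3 - 2 * x) * x + (x\<^sup>2 - 1) * (x\<^sup>2 - 1) * x + (x\<^sup>2 - 1) * (x ^ 3 - 2 * x) - x * x * (x\<^sup>2 - 1) * (x ^ 3 - 2 * x) =
          - x * (x ^ 6 - 6 * x ^ 4 + 9 * x\<^sup>2 - 3)"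
        by (simp add: algebra_simps eval_nat_numeral)
      then show "x * (x ^ 3 - 2 * x) * x + (x\<^sup>2 - 1) * (x\<^sup>2 - 1) * x + (x\<^sup>2 - 1) * (x ^ 3 - 2 * x) = x * x * (x\<^sup>2 - 1) * (x ^ 3 - 2 * x)"
        using x by simp
    qed
    then show ?thesis
      using nz(1) by (simp add: sin_multiples x_def)
  qed
  have "\<exists>v :: nat \<Rightarrow> real. \<forall>i\<in>{1..7}. v i > 0 \<and>
      (\<Sum>j | j \<in> {1..7} \<and> {i, j} \<in> insert {3, 7} (chain_edges (7 - 1)). v j) = 2 * cos \<theta> * v i"
    using pos center by (intro star_eigenvector_exists) auto
  then show thesis
    using Dynkin_E7 by (elim exE, intro that) auto
next
  case Dynkin_E8
  then have th: "\<theta> = pi / 30" by (simp add: \<theta>_def)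
  define x where "x = 2 * cos \<theta>"
  define u where "u = 2 * cos (2 * \<theta>)"
  have pos: "0 < \<theta>" "real 3 * \<theta> < pi" "real (8 - 3) * \<theta> < pi" using pi_gt_zero by (auto simp: th)
  have nz: "sin \<theta> \<noteq> 0" "sin (2 * \<theta>) \<noteq> 0" "sin (3 * \<theta>) \<noteq> 0" "sin (5 * \<theta>) \<noteq> 0"
    by (intro order.strict_implies_not_eq[THEN not_sym] sin_gt_zero; simp add: th)+
  have y: "u = x\<^sup>2 - 2" by (simp add: x_def u_def cos_double_cos power_mult_distrib)
  have c2: "2 * cos (2 * (2 * \<theta>)) = u\<^sup>2 - 2"
    unfolding cos_double_cos[of "2 * \<theta>"] by (simp add: u_def power_mult_distrib)
  have c3: "2 * cos (3 * (2 * \<theta>)) = u ^ 3 - 3 * u"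
    unfolding cos_treble_cos by (simp add: u_def power_mult_distrib)
  \<comment> \<open>Here \<open>10 * \<theta> = pi / 3\<close>, and the sum formula replaces a
    five-fold angle formula. The resulting quintic in \<open>u\<close> has the spurious root
    \<open>1\<close>, which belongs to the angle \<open>pi / 3\<close> in place of
    \<open>2 * \<theta>\<close> and is excluded by monotonicity of the cosine.\<close>
  have "cos (5 * (2 * \<theta>)) + cos (2 * \<theta>) = 2 * cos (3 * (2 * \<theta>)) * cos (2 * (2 * \<theta>))"
    using cos_plus_cos[of "5 * (2 * \<theta>)" "2 * \<theta>"] by (simp add: algebra_simps)
  moreover have "cos (5 * (2 * \<theta>)) = 1 / 2" by (simp add: th cos_60)
  ultimately have "1 + u = (2 * cos (3 * (2 * \<theta>))) * (2 * cos (2 * (2 * \<theta>)))"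
    unfolding u_def by simp
  then have "1 + u = (u ^ 3 - 3 * u) * (u\<^sup>2 - 2)"
    unfolding c2 c3 .
  then have "(u - 1) * (u ^ 4 + u ^ 3 - 4 * u\<^sup>2 - 4 * u + 1) = 0" by (simp add: algebra_simps eval_nat_numeral)
  moreover have "u \<noteq> 1"
  proof
    assume "u = 1"
    then have "cos (2 * \<theta>) = cos (pi / 3)" by (simp add: u_def cos_60)
    moreover have "cos (pi / 3) < cos (2 * \<theta>)" by (intro cos_monotone_0_pi) (auto simp: th)
    ultimately show False by simp
  qed
  ultimately have "u ^ 4 + u ^ 3 - 4 * u\<^sup>2 - 4 * u + 1 = 0" by simp
  then have x: "x ^ 8 - 7 * x ^ 6 + 14 * x ^ 4 - 8 * x\<^sup>2 + 1 = 0" unfolding y by (simp add: algebra_simps eval_nat_numeral)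
  have center: "sin (real (3 - 1) * \<theta>) / sin (real 3 * \<theta>) +
      sin (real (8 - 3 - 1) * \<theta>) / sin (real (8 - 3) * \<theta>) + sin \<theta> / sin (2 * \<theta>) = 2 * cos \<theta>"
  proof -
    have "x / (x\<^sup>2 - 1) + (x ^ 3 - 2 * x) / (x ^ 4 - 3 * x\<^sup>2 + 1) + 1 / x = x"
    proof (rule add_fractions_eqI)
      show "x \<noteq> 0" "x\<^sup>2 - 1 \<noteq> 0" "(x ^ 4 - 3 * x\<^sup>2 + 1) \<noteq> 0"
        using nz unfolding sin_multiples x_def by auto
      have "x * (x ^ 4 - 3 * x\<^sup>2 + 1) * x + (x ^ 3 - 2 * x) * (x\<^sup>2 - 1) * x + (x\<^sup>2 - 1) * (x ^ 4 - 3 * x\<^sup>2 + 1) - x * x * (x\<^sup>2 - 1) * (x ^ 4 - 3 * x\<^sup>2 + 1) =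
          - (x ^ 8 - 7 * x ^ 6 + 14 * x ^ 4 - 8 * x\<^sup>2 + 1)"
        by (simp add: algebra_simps eval_nat_numeral)
      then show "x * (x ^ 4 - 3 * x\<^sup>2 + 1) * x + (x ^ 3 - 2 * x) * (x\<^sup>2 - 1) * x + (x\<^sup>2 - 1) * (x ^ 4 - 3 * x\<^sup>2 + 1) = x * x * (x\<^sup>2 - 1) * (x ^ 4 - 3 * x\<^sup>2 + 1)"
        using x by simp
    qed
    then show ?thesis
      using nz(1) by (simp add: sin_multiples x_def)
  qed
  have "\<exists>v :: nat \<Rightarrow> real. \<forall>i\<in>{1..8}. v i > 0 \<and>
      (\<Sum>j | j \<in> {1..8} \<and> {i, j} \<in> insert {3, 8} (chain_edges (8 - 1)). v j) = 2 * cos \<theta> * v i"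
    using pos center by (intro star_eigenvector_exists) auto
  then show thesis
    using Dynkin_E8 by (elim exE, intro that) auto
qed


section \<open>Path algebras\<close>

text \<open>
  Higher-order resolution in induction proofs leaves eta-expanded functions behind, on which these
  rules would fire; they are used only for pointwise reasoning.
\<close>

declare plus_fun_apply [simp del] zero_fun_apply [simp del] minus_apply [simp del] uminus_apply [simp del]

text \<open>The product of \<open>path_algebra\<close> with \<open>UNIV\<close> as vertex set. It
  makes sense for arbitrary functions, since a path has finitely many cuts, so associativity and
  bilinearity need no carrier conditions.\<close>

definition path_mult ::
  "(('v::finite, 'b) path \<Rightarrow> 'k::field) \<Rightarrow> (('v, 'b) path \<Rightarrow> 'k) \<Rightarrow> ('v, 'b) path \<Rightarrow> 'k"
  (infixl \<open>\<star>\<close> 70) where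
  "f \<star> g = (\<lambda>(u, p, w). \<Sum>n\<le>length p. \<Sum>v\<in>UNIV. f (u, take n p, v) * g (v, drop n p, w))"

definition path_one :: "('v::finite, 'b) path \<Rightarrow> 'k::field" where
  "path_one = (\<lambda>(u, p, w). if p = [] \<and> u = w then 1 else 0)"

definition fun_scale :: "'k::field \<Rightarrow> ('p \<Rightarrow> 'k) \<Rightarrow> 'p \<Rightarrow> 'k" (infixr \<open>*\<^sub>F\<close> 75) where
  "c *\<^sub>F f = (\<lambda>q. c * f q)"

global_interpretation FS: scalar_space "fun_scale :: 'k::field \<Rightarrow> ('p \<Rightarrow> 'k) \<Rightarrow> 'p \<Rightarrow> 'k"
  by unfold_locales (auto simp: fun_scale_def fun_eq_iff plus_fun_apply algebra_simps)

lemma fun_scale_apply: "(c *\<^sub>F f) q = c * f q"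
  by (simp add: fun_scale_def)

lemmas pointwise = plus_fun_apply zero_fun_apply minus_apply uminus_apply fun_scale_apply

lemma sum_fun_apply: "(\<Sum>a\<in>A. f a) q = (\<Sum>a\<in>A. (f a q :: 'k::comm_monoid_add))"
  by (induction A rule: infinite_finite_induct) (auto simp: pointwise)

lemma path_mult_apply:
  "(f \<star> g) (u, p, w) = (\<Sum>n\<le>length p. \<Sum>v\<in>UNIV. f (u, take n p, v) * g (v, drop n p, w))"
  by (simp add: path_mult_def)

lemma path_mult_distrib_right: "(f + g) \<star> h = f \<star> h + g \<star> h"
  by (auto simp: fun_eq_iff pointwise path_mult_apply algebra_simps sum.distrib)

lemma path_mult_distrib_left: "h \<star> (f + g) = h \<star> f + h \<star> g"
  by (auto simp: fun_eq_iff pointwise path_mult_apply algebra_simps sum.distrib)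

lemma path_mult_scale_left [simp]: "(c *\<^sub>F f) \<star> g = c *\<^sub>F (f \<star> g)"
  by (auto simp: fun_eq_iff pointwise path_mult_apply sum_distrib_left mult.assoc)

lemma path_mult_scale_right [simp]: "f \<star> (c *\<^sub>F g) = c *\<^sub>F (f \<star> g)"
  by (auto simp: fun_eq_iff pointwise path_mult_apply sum_distrib_left mult.left_commute)

lemma path_mult_zero [simp]: "0 \<star> f = 0" "f \<star> 0 = 0"
  by (auto simp: fun_eq_iff pointwise path_mult_apply)

lemma path_mult_diff: "f \<star> (g - h) = f \<star> g - f \<star> h" "(g - h) \<star> f = g \<star> f - h \<star> f"
  by (auto simp: fun_eq_iff pointwise path_mult_apply algebra_simps sum_subtractf)

lemma path_mult_sum_left: "(\<Sum>a\<in>A. f a) \<star> g = (\<Sum>a\<in>A. f a \<star> g)"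
  by (induction A rule: infinite_finite_induct) (auto simp: path_mult_distrib_right)

lemma path_mult_sum_right: "f \<star> (\<Sum>a\<in>A. g a) = (\<Sum>a\<in>A. f \<star> g a)"
  by (induction A rule: infinite_finite_induct) (auto simp: path_mult_distrib_left)

lemma module_hom_mult_right: "module_hom fun_scale fun_scale (\<lambda>f. f \<star> g)"
  by unfold_locales (auto simp: path_mult_distrib_right)

lemma path_mult_assoc: "(f \<star> g) \<star> h = f \<star> (g \<star> h)"
proof (rule ext)
  fix q :: "('a, 'b) path"
  obtain u p w where q: "q = (u, p, w)" by (cases q) auto
  let ?l = "length p"
  \<comment> \<open>\<open>t m n\<close> collects the contributions of cutting \<open>p\<close> at
    the positions \<open>m\<close> and \<open>n\<close> with \<open>m \<le> n\<close>. Both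
    bracketings sum it over the same pairs, parametrized by \<open>(n, m)\<close> or by
    \<open>(m, n - m)\<close>.\<close>
  define t where "t m n = (\<Sum>v\<in>UNIV. \<Sum>x\<in>UNIV.
    f (u, take m p, x) * g (x, take (n - m) (drop m p), v) * h (v, drop n p, w))" for m n
  have "((f \<star> g) \<star> h) q = (\<Sum>n\<le>?l. \<Sum>v\<in>UNIV. \<Sum>m\<le>n. \<Sum>x\<in>UNIV.
      f (u, take m p, x) * g (x, take (n - m) (drop m p), v) * h (v, drop n p, w))"
    unfolding q path_mult_apply
    by (intro sum.cong refl) (auto simp: sum_distrib_right min_def take_drop intro!: sum.cong)
  also have "\<dots> = (\<Sum>n\<le>?l. \<Sum>m\<le>n. t m n)"
    unfolding t_def by (intro sum.cong refl sum.swap)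
  also have "\<dots> = (\<Sum>(n, m)\<in>(SIGMA n:{..?l}. {..n}). t m n)"
    by (rule sum.Sigma) auto
  also have "\<dots> = (\<Sum>(m, n)\<in>(SIGMA m:{..?l}. {..?l - m}). t m (m + n))"
    by (rule sum.reindex_bij_witness[where i = "\<lambda>(m, n). (m + n, m)" and j = "\<lambda>(n, m). (m, n - m)"])
      auto
  also have "\<dots> = (\<Sum>m\<le>?l. \<Sum>n\<le>?l - m. t m (m + n))"
    by (rule sum.Sigma[symmetric]) auto
  also have "\<dots> = (\<Sum>m\<le>?l. \<Sum>n\<le>?l - m. \<Sum>x\<in>UNIV. \<Sum>v\<in>UNIV.
      f (u, take m p, x) * g (x, take n (drop m p), v) * h (v, drop (m + n) p, w))"
  proof (intro sum.cong refl)
    fix m n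
    show "t m (m + n) = (\<Sum>x\<in>UNIV. \<Sum>v\<in>UNIV.
        f (u, take m p, x) * g (x, take n (drop m p), v) * h (v, drop (m + n) p, w))"
      unfolding t_def by (subst sum.swap) simp
  qed
  also have "\<dots> = (\<Sum>m\<le>?l. \<Sum>x\<in>UNIV. \<Sum>n\<le>?l - m. \<Sum>v\<in>UNIV.
      f (u, take m p, x) * g (x, take n (drop m p), v) * h (v, drop (m + n) p, w))"
    by (intro sum.cong refl sum.swap)
  also have "\<dots> = (f \<star> (g \<star> h)) q"
    unfolding q path_mult_apply
    by (intro sum.cong refl) (auto simp: sum_distrib_left mult.assoc add.commute intro!: sum.cong)
  finally show "((f \<star> g) \<star> h) q = (f \<star> (g \<star> h)) q" .
qed

lemma basis_mult_apply:
  "(basis (u, q, v) \<star> f) (u', p, w) =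
    (if u' = u \<and> (\<exists>l. p = q @ l) then f (v, drop (length q) p, w) else 0)"
proof -
  have "(basis (u, q, v) \<star> f) (u', p, w) = (\<Sum>n\<le>length p. \<Sum>x\<in>UNIV.
      (if u' = u \<and> take n p = q \<and> x = v then f (x, drop n p, w) else 0))"
    unfolding path_mult_apply basis_def by (intro sum.cong refl) auto
  also have "\<dots> = (\<Sum>n\<le>length p. (if u' = u \<and> take n p = q then f (v, drop n p, w) else 0))"
    by (intro sum.cong refl) auto
  also have "\<dots> = (\<Sum>n\<le>length p. (if n = length q then
      (if u' = u \<and> take n p = q then f (v, drop n p, w) else 0) else 0))"
    by (intro sum.cong refl) auto
  also have "\<dots> = (if length q \<le> length p \<and> u' = u \<and> take (length q) p = q
      then f (v, drop (length q) p, w) else 0)"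
    by auto
  also have "\<dots> = (if u' = u \<and> (\<exists>l. p = q @ l) then f (v, drop (length q) p, w) else 0)"
    by (auto split: if_splits) (metis append_take_drop_id)
  finally show ?thesis .
qed

lemma mult_basis_apply:
  "(f \<star> basis (v, q, w)) (u, p, w') =
    (if w' = w \<and> (\<exists>l. p = l @ q) then f (u, take (length p - length q) p, v) else 0)"
proof -
  have "(f \<star> basis (v, q, w)) (u, p, w') = (\<Sum>n\<le>length p. \<Sum>x\<in>UNIV.
      (if w' = w \<and> drop n p = q \<and> x = v then f (u, take n p, x) else 0))"
    unfolding path_mult_apply basis_def by (intro sum.cong refl) auto
  also have "\<dots> = (\<Sum>n\<le>length p. (if w' = w \<and> drop n p = q then f (u, take n p, v) else 0))"
    by (intro sum.cong refl) auto
  also have "\<dots> = (\<Sum>n\<le>length p. (if n = length p - length q then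
      (if w' = w \<and> drop n p = q then f (u, take n p, v) else 0) else 0))"
    by (intro sum.cong refl) auto
  also have "\<dots> = (if w' = w \<and> drop (length p - length q) p = q
      then f (u, take (length p - length q) p, v) else 0)"
    by auto
  also have "\<dots> = (if w' = w \<and> (\<exists>l. p = l @ q) then f (u, take (length p - length q) p, v) else 0)"
    by (auto split: if_splits) (metis append_take_drop_id)
  finally show ?thesis .
qed

lemma basis_mult_basis:
  "basis (u, p, v) \<star> basis (v', q, w) = (if v = v' then basis (u, p @ q, w) else 0)"
proof (rule ext)
  fix r :: "('a, 'b) path"
  obtain x l y where r: "r = (x, l, y)" by (cases r) auto
  show "(basis (u, p, v) \<star> basis (v', q, w)) r = (if v = v' then basis (u, p @ q, w) else 0) r"
    unfolding r basis_mult_apply by (auto simp: basis_def pointwise)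
qed

lemma path_one_eq: "path_one = (\<Sum>i\<in>UNIV. basis (i, [], i))"
proof (rule ext)
  fix r :: "('a, 'b) path"
  obtain x l y where r: "r = (x, l, y)" by (cases r) auto
  have "(\<Sum>i\<in>UNIV. basis (i, [], i)) r = (\<Sum>i\<in>UNIV. if i = x then (if l = [] \<and> x = y then 1 else 0) else (0 :: 'c))"
    unfolding r sum_fun_apply by (intro sum.cong) (auto simp: basis_def)
  then show "path_one r = (\<Sum>i\<in>UNIV. basis (i, [], i) :: _ \<Rightarrow> 'c) r"
    by (simp add: r path_one_def)
qed

lemma path_one_mult [simp]: "path_one \<star> f = f"
proof (rule ext)
  fix r :: "('a, 'b) path"
  obtain x l y where r: "r = (x, l, y)" by (cases r) auto
  show "(path_one \<star> f) r = f r"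
    by (simp add: r path_one_eq path_mult_sum_left sum_fun_apply basis_mult_apply)
qed

lemma path_mult_one [simp]: "f \<star> path_one = f"
proof (rule ext)
  fix r :: "('a, 'b) path"
  obtain x l y where r: "r = (x, l, y)" by (cases r) auto
  show "(f \<star> path_one) r = f r"
    by (simp add: r path_one_eq path_mult_sum_right sum_fun_apply mult_basis_apply)
qed

lemma fun_eq_sum_basis:
  assumes "finite {q. f q \<noteq> 0}"
  shows "f = (\<Sum>q | f q \<noteq> 0. f q *\<^sub>F basis q)"
proof (rule ext)
  fix r
  have "(\<Sum>q | f q \<noteq> 0. f q *\<^sub>F basis q) r = (\<Sum>q | f q \<noteq> 0. if q = r then f q else 0)"
    unfolding sum_fun_apply by (intro sum.cong) (auto simp: basis_def fun_scale_apply)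
  also have "\<dots> = f r" using assms by (simp add: sum.delta)
  finally show "f r = (\<Sum>q | f q \<noteq> 0. f q *\<^sub>F basis q) r" by simp
qed


text \<open>\<open>K\<close> fixes the coefficient field as a type for the sets introduced
  below.\<close>

locale finite_quiver =
  fixes G :: "('v::finite, 'b) pre_digraph" and K :: "'k::field itself"
  assumes verts_UNIV: "verts G = UNIV" and finite_arcs: "finite (arcs G)"
begin

abbreviation F :: "(('v, 'b) path \<Rightarrow> 'k) set" where
  "F \<equiv> carrier (path_algebra G)"

lemma F_iff: "f \<in> F \<longleftrightarrow> finite {q. f q \<noteq> 0} \<and> (\<forall>q. f q \<noteq> 0 \<longrightarrow> q \<in> paths G)"
  by (auto simp: path_algebra_def)

lemma path_algebra_simps [simp]:
  "mult (path_algebra G) = path_mult"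
  "one (path_algebra G) = path_one"
  "zero (path_algebra G) = 0"
  "add (path_algebra G) = (+)"
  by (auto simp: path_algebra_def path_mult_def verts_UNIV path_one_eq fun_eq_iff pointwise sum_fun_apply)

lemma path_Nil [simp]: "(u, [], w) \<in> paths G \<longleftrightarrow> u = w"
  by (auto simp: paths_def pre_digraph.awalk_def pre_digraph.cas.simps verts_UNIV)

lemma path_Cons [simp]:
  "(u, b # p, w) \<in> paths G \<longleftrightarrow> b \<in> arcs G \<and> tail G b = u \<and> (head G b, p, w) \<in> paths G"
  by (auto simp: paths_def pre_digraph.awalk_def pre_digraph.cas.simps verts_UNIV)

lemma path_append: "(u, p @ q, w) \<in> paths G \<longleftrightarrow> (\<exists>v. (u, p, v) \<in> paths G \<and> (v, q, w) \<in> paths G)"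
  by (induction p arbitrary: u) auto

lemma path_snoc [simp]:
  "(u, p @ [b], w) \<in> paths G \<longleftrightarrow> (u, p, tail G b) \<in> paths G \<and> b \<in> arcs G \<and> head G b = w"
  by (auto simp: path_append)

lemma basis_F: "q \<in> paths G \<Longrightarrow> basis q \<in> F"
  by (auto simp: F_iff basis_def)

lemma zero_F [simp]: "0 \<in> F"
  by (simp add: F_iff pointwise)

lemma add_F: "f \<in> F \<Longrightarrow> g \<in> F \<Longrightarrow> f + g \<in> F"
proof -
  assume "f \<in> F" "g \<in> F"
  moreover have "{q. (f + g) q \<noteq> 0} \<subseteq> {q. f q \<noteq> 0} \<union> {q. g q \<noteq> 0}" by (auto simp: pointwise)
  moreover from calculation have "finite {q. (f + g) q \<noteq> 0}"
    by (auto simp: F_iff elim: finite_subset)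
  ultimately show ?thesis unfolding F_iff by blast
qed

lemma scale_F: "f \<in> F \<Longrightarrow> c *\<^sub>F f \<in> F"
  unfolding F_iff by (auto simp: fun_scale_apply elim: finite_subset[rotated])

lemma uminus_F: "f \<in> F \<Longrightarrow> - f \<in> F"
  unfolding F_iff by (auto simp: pointwise)

lemma diff_F: "f \<in> F \<Longrightarrow> g \<in> F \<Longrightarrow> f - g \<in> F"
  using add_F[of f "- g"] uminus_F[of g] by simp

lemma sum_F: "(\<And>a. a \<in> A \<Longrightarrow> f a \<in> F) \<Longrightarrow> (\<Sum>a\<in>A. f a) \<in> F"
  by (induction A rule: infinite_finite_induct) (auto simp: add_F)

lemma subspace_F: "FS.subspace F"
  by (auto simp: FS.subspace_def add_F scale_F)

lemma one_F: "path_one \<in> F"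
  unfolding path_one_eq by (intro sum_F basis_F) simp

lemma F_induct [consumes 1, case_names basis zero add scale]:
  assumes "f \<in> F" and "\<And>q. q \<in> paths G \<Longrightarrow> P (basis q)" and "P 0"
    and "\<And>f g. P f \<Longrightarrow> P g \<Longrightarrow> P (f + g)" and "\<And>c f. P f \<Longrightarrow> P (c *\<^sub>F f)"
  shows "P f"
proof -
  have "P (\<Sum>q\<in>A. f q *\<^sub>F basis q)" if "A \<subseteq> paths G" for A
    using that by (induction A rule: infinite_finite_induct) (auto intro: assms)
  moreover have "{q. f q \<noteq> 0} \<subseteq> paths G" "finite {q. f q \<noteq> 0}" using assms(1) by (auto simp: F_iff)
  ultimately have "P (\<Sum>q | f q \<noteq> 0. f q *\<^sub>F basis q)" and fin: "finite {q. f q \<noteq> 0}" by blast+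
  then show ?thesis by (simp only: fun_eq_sum_basis[OF fin, symmetric])
qed

lemma mult_F:
  assumes f: "f \<in> F" and g: "g \<in> F"
  shows "f \<star> g \<in> F"
  using f
proof (induction rule: F_induct)
  case (basis q)
  obtain u p v where q: "q = (u, p, v)" by (cases q) auto
  show ?case
    using g
  proof (induction rule: F_induct)
    case (basis r)
    obtain v' s w where r: "r = (v', s, w)" by (cases r) auto
    show ?case
      using basis \<open>q \<in> paths G\<close> unfolding q r basis_mult_basis
      by (auto intro!: basis_F simp: path_append)
  qed (auto simp: path_mult_distrib_left add_F scale_F)
qed (auto simp: path_mult_distrib_right add_F scale_F)

lemma ring_path_algebra: "ring (path_algebra G :: (('v, 'b) path \<Rightarrow> 'k) ring)"
proof (rule ringI)
  show "abelian_group (path_algebra G :: (('v, 'b) path \<Rightarrow> 'k) ring)"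
  proof (rule abelian_groupI)
    fix x assume "x \<in> F"
    then show "\<exists>y\<in>F. y \<oplus>\<^bsub>path_algebra G\<^esub> x = \<zero>\<^bsub>path_algebra G\<^esub>"
      by (intro bexI[of _ "- x"]) (auto simp: uminus_F)
  qed (simp_all add: add_F ac_simps)
  show "monoid (path_algebra G :: (('v, 'b) path \<Rightarrow> 'k) ring)"
    by (rule monoidI) (simp_all add: mult_F one_F path_mult_assoc)
qed (simp_all add: path_mult_distrib_left path_mult_distrib_right)


section \<open>Homogeneous components between two vertices\<close>

definition Fn :: "nat \<Rightarrow> 'v \<Rightarrow> 'v \<Rightarrow> (('v, 'b) path \<Rightarrow> 'k) set" where
  "Fn n i j = {f. \<forall>u p w. f (u, p, w) \<noteq> 0 \<longrightarrow> (u, p, w) \<in> paths G \<and> u = i \<and> w = j \<and> length p = n}"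

definition comp :: "nat \<Rightarrow> 'v \<Rightarrow> 'v \<Rightarrow> (('v, 'b) path \<Rightarrow> 'k) \<Rightarrow> ('v, 'b) path \<Rightarrow> 'k" where
  "comp n i j f = (\<lambda>(u, p, w). if u = i \<and> w = j \<and> length p = n then f (u, p, w) else 0)"

lemma finite_paths_length: "finite {(u, p, w). (u, p, w) \<in> paths G \<and> length p = n}"
proof (rule finite_subset)
  have "set p \<subseteq> arcs G" if "(u, p, w) \<in> paths G" for u p w
    using that by (induction p arbitrary: u) auto
  then show "{(u, p, w). (u, p, w) \<in> paths G \<and> length p = n} \<subseteq>
      UNIV \<times> {p. set p \<subseteq> arcs G \<and> length p = n} \<times> UNIV" by blast
  show "finite ((UNIV :: 'v set) \<times> {p. set p \<subseteq> arcs G \<and> length p = n} \<times> (UNIV :: 'v set))"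
    by (intro finite_cartesian_product finite_lists_length_eq finite_arcs finite)
qed

text \<open>Finite support is automatic in a fixed degree, since finitely many arrows give finitely
  many paths of each length. This is why \<open>Fn\<close> does not demand it.\<close>

lemma Fn_subset_F: "Fn n i j \<subseteq> F"
proof
  fix f assume f: "f \<in> Fn n i j"
  then have "{q. f q \<noteq> 0} \<subseteq> {(u, p, w). (u, p, w) \<in> paths G \<and> length p = n}"
    unfolding Fn_def by auto
  then have "finite {q. f q \<noteq> 0}" using finite_paths_length finite_subset by blast
  then show "f \<in> F" using f by (auto simp: F_iff Fn_def)
qed

lemma subspace_Fn: "FS.subspace (Fn n i j)"
  by (auto simp: FS.subspace_def Fn_def pointwise) (metis add_0)+

lemma finite_dim_Fn: "FS.finite_dim (Fn n i j)"
  unfolding FS.finite_dim_def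
proof (intro exI conjI subsetI)
  let ?P = "{(u, p, w). (u, p, w) \<in> paths G \<and> length p = n}"
  show "finite (basis ` ?P)" using finite_paths_length by blast
  fix f assume f: "f \<in> Fn n i j"
  have "f = (\<Sum>q | f q \<noteq> 0. f q *\<^sub>F basis q)"
    using f Fn_subset_F F_iff by (intro fun_eq_sum_basis) blast
  also have "\<dots> \<in> FS.span (basis ` ?P)"
    using f by (intro FS.span_sum FS.span_scale FS.span_base) (auto simp: Fn_def)
  finally show "f \<in> FS.span (basis ` ?P)" .
qed

lemma comp_in_Fn: "f \<in> F \<Longrightarrow> comp n i j f \<in> Fn n i j"
  by (auto simp: Fn_def comp_def F_iff split: if_splits)

lemma comp_Fn: "f \<in> Fn n i j \<Longrightarrow> comp m k l f = (if m = n \<and> k = i \<and> l = j then f else 0)"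
  by (auto simp: Fn_def comp_def fun_eq_iff pointwise)

lemma comp_add: "comp n i j (f + g) = comp n i j f + comp n i j g"
  by (auto simp: comp_def fun_eq_iff pointwise)

lemma comp_scale: "comp n i j (c *\<^sub>F f) = c *\<^sub>F comp n i j f"
  by (auto simp: comp_def fun_eq_iff pointwise)

lemma comp_zero [simp]: "comp n i j 0 = 0"
  by (auto simp: comp_def fun_eq_iff pointwise)

lemma F_eq_sum_comp:
  assumes "f \<in> F"
  obtains N where "f = (\<Sum>n<N. \<Sum>i\<in>UNIV. \<Sum>j\<in>UNIV. comp n i j f)"
proof -
  have fin: "finite {q. f q \<noteq> 0}" using assms by (simp add: F_iff)
  define N where "N = Suc (Max (insert 0 ((\<lambda>(u, p, w). length p) ` {q. f q \<noteq> 0})))"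
  have N: "length p < N" if "f (u, p, w) \<noteq> 0" for u p w
    unfolding N_def less_Suc_eq_le using that fin by (intro Max_ge) (auto simp: image_iff)
  have "f r = (\<Sum>n<N. \<Sum>i\<in>UNIV. \<Sum>j\<in>UNIV. comp n i j f) r" for r
  proof -
    obtain u p w where r: "r = (u, p, w)" by (cases r) auto
    have "(\<Sum>n<N. \<Sum>i\<in>UNIV. \<Sum>j\<in>UNIV. comp n i j f) r =
        (\<Sum>n<N. \<Sum>i\<in>UNIV. \<Sum>j\<in>UNIV. if j = w then (if u = i \<and> length p = n then f r else 0) else 0)"
      unfolding sum_fun_apply r comp_def by (intro sum.cong) auto
    also have "\<dots> = (\<Sum>n<N. \<Sum>i\<in>UNIV. if i = u then (if length p = n then f r else 0) else 0)"
      by (intro sum.cong refl) auto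
    also have "\<dots> = (\<Sum>n<N. if n = length p then f r else 0)"
      by (intro sum.cong refl) auto
    also have "\<dots> = f r" using N[of u p w] r by (auto simp: sum.delta)
    finally show ?thesis by simp
  qed
  then have "f = (\<Sum>n<N. \<Sum>i\<in>UNIV. \<Sum>j\<in>UNIV. comp n i j f)" by (rule ext)
  then show thesis by (rule that)
qed

lemma mult_Fn:
  assumes f: "f \<in> Fn m i k" and g: "g \<in> Fn n k j"
  shows "f \<star> g \<in> Fn (m + n) i j"
  unfolding Fn_def
proof (intro CollectI allI impI)
  fix u p w assume "(f \<star> g) (u, p, w) \<noteq> 0"
  then obtain l where l: "l \<le> length p" "(\<Sum>v\<in>UNIV. f (u, take l p, v) * g (v, drop l p, w)) \<noteq> 0"
    unfolding path_mult_apply by (meson atMost_iff sum.not_neutral_contains_not_neutral)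
  then obtain v where "f (u, take l p, v) * g (v, drop l p, w) \<noteq> 0"
    by (meson sum.not_neutral_contains_not_neutral)
  then have "f (u, take l p, v) \<noteq> 0" "g (v, drop l p, w) \<noteq> 0" by auto
  then have "(u, take l p, v) \<in> paths G \<and> u = i \<and> v = k \<and> length (take l p) = m"
    "(v, drop l p, w) \<in> paths G \<and> v = k \<and> w = j \<and> length (drop l p) = n"
    using f g unfolding Fn_def by blast+
  then show "(u, p, w) \<in> paths G \<and> u = i \<and> w = j \<and> length p = m + n"
    using path_append[of u "take l p" "drop l p" w] l(1) by auto
qed

lemma basis_Fn: "(i, p, j) \<in> paths G \<Longrightarrow> basis (i, p, j) \<in> Fn (length p) i j"
  by (auto simp: Fn_def basis_def)

lemma idem_mult_Fn:
  assumes "f \<in> Fn n i j"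
  shows "basis (k, [], k) \<star> f = (if k = i then f else 0)"
    and "f \<star> basis (k, [], k) = (if k = j then f else 0)"
  using assms by (auto simp: fun_eq_iff pointwise basis_mult_apply mult_basis_apply Fn_def)


section \<open>Splitting off the last arrow\<close>

definition arr :: "'b \<Rightarrow> ('v, 'b) path \<Rightarrow> 'k" where
  "arr b = basis (tail G b, [b], head G b)"

text \<open>Right division by \<open>b\<close>: an element of positive degree is uniquely a sum of
  products \<open>x \<star> arr b\<close> over the arrows, and this is the factor \<open>x\<close>.
  The test on \<open>w\<close> makes the factor end where \<open>b\<close> starts.\<close>

definition last_coeff :: "'b \<Rightarrow> (('v, 'b) path \<Rightarrow> 'k) \<Rightarrow> ('v, 'b) path \<Rightarrow> 'k" where
  "last_coeff b z = (\<lambda>(u, p, w). if w = tail G b then z (u, p @ [b], head G b) else 0)"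

lemma arr_Fn: "b \<in> arcs G \<Longrightarrow> arr b \<in> Fn 1 (tail G b) (head G b)"
  unfolding arr_def using basis_Fn[of "tail G b" "[b]" "head G b"] by simp

lemma last_coeff_add: "last_coeff b (f + g) = last_coeff b f + last_coeff b g"
  by (auto simp: last_coeff_def fun_eq_iff pointwise)

lemma last_coeff_scale: "last_coeff b (c *\<^sub>F f) = c *\<^sub>F last_coeff b f"
  by (auto simp: last_coeff_def fun_eq_iff pointwise)

lemma last_coeff_zero [simp]: "last_coeff b 0 = 0"
  by (auto simp: last_coeff_def fun_eq_iff pointwise)

lemma last_coeff_sum: "last_coeff b (\<Sum>a\<in>A. f a) = (\<Sum>a\<in>A. last_coeff b (f a))"
  by (induction A rule: infinite_finite_induct) (auto simp: last_coeff_add)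

lemma last_coeff_Fn: "z \<in> Fn (Suc n) i j \<Longrightarrow> last_coeff b z \<in> Fn n i (tail G b)"
  unfolding Fn_def last_coeff_def
proof (intro CollectI allI impI)
  fix u p w
  assume z: "z \<in> {f. \<forall>u p w. f (u, p, w) \<noteq> 0 \<longrightarrow> (u, p, w) \<in> paths G \<and> u = i \<and> w = j \<and> length p = Suc n}"
    and nz: "(case (u, p, w) of (u, p, w) \<Rightarrow> if w = tail G b then z (u, p @ [b], head G b) else 0) \<noteq> 0"
  then have "w = tail G b" "z (u, p @ [b], head G b) \<noteq> 0" by (auto split: if_splits)
  then have "(u, p @ [b], head G b) \<in> paths G \<and> u = i \<and> length (p @ [b]) = Suc n" using z by blast
  then show "(u, p, w) \<in> paths G \<and> u = i \<and> w = tail G b \<and> length p = n"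
    using \<open>w = tail G b\<close> by auto
qed

lemma last_coeff_eq_0:
  assumes "z \<in> Fn n i j" and "b \<notin> arcs G \<or> head G b \<noteq> j"
  shows "last_coeff b z = 0"
proof -
  have "z (u, p @ [b], head G b) = 0" for u p
  proof (rule ccontr)
    assume "z (u, p @ [b], head G b) \<noteq> 0"
    then have "(u, p @ [b], head G b) \<in> paths G \<and> head G b = j"
      using assms(1) unfolding Fn_def by blast
    then show False using assms(2) by auto
  qed
  then show ?thesis by (auto simp: last_coeff_def fun_eq_iff pointwise)
qed

lemma last_coeff_mult_arr:
  assumes "x \<in> Fn n i (tail G b)"
  shows "last_coeff c (x \<star> arr b) = (if c = b then x else 0)"
proof (rule ext)
  fix r :: "('v, 'b) path"
  obtain u p w where r: "r = (u, p, w)" by (cases r) auto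
  have "x (u, p, w) = 0" if "w \<noteq> tail G b" using assms that unfolding Fn_def by blast
  then show "last_coeff c (x \<star> arr b) r = (if c = b then x else 0) r"
    unfolding r last_coeff_def arr_def by (auto simp: mult_basis_apply pointwise)
qed

lemma Fn_eq_sum_last_coeff:
  assumes "z \<in> Fn (Suc n) i j"
  shows "z = (\<Sum>b\<in>{b \<in> arcs G. head G b = j}. last_coeff b z \<star> arr b)"
proof (rule ext)
  fix r :: "('v, 'b) path"
  obtain u p w where r: "r = (u, p, w)" by (cases r) auto
  let ?B = "{b \<in> arcs G. head G b = j}"
  have fin: "finite ?B" using finite_arcs by auto
  show "z r = (\<Sum>b\<in>?B. last_coeff b z \<star> arr b) r"
  proof (cases p rule: rev_cases)
    case Nil
    then have "z r = 0" using assms r unfolding Fn_def by fastforce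
    moreover have "(last_coeff b z \<star> arr b) r = 0" for b
      unfolding r Nil arr_def by (auto simp: mult_basis_apply)
    ultimately show ?thesis by (simp add: sum_fun_apply)
  next
    case (snoc q c)
    have "(\<Sum>b\<in>?B. last_coeff b z \<star> arr b) r = (\<Sum>b\<in>?B. if b = c then (if w = j then z r else 0) else 0)"
      unfolding sum_fun_apply
      by (intro sum.cong refl) (auto simp: r snoc arr_def mult_basis_apply last_coeff_def)
    also have "\<dots> = (if c \<in> ?B \<and> w = j then z r else 0)" using fin by (simp add: sum.delta)
    also have "\<dots> = z r"
    proof -
      have "c \<in> ?B \<and> w = j" if "z r \<noteq> 0"
      proof -
        have "(u, q @ [c], w) \<in> paths G \<and> w = j"
          using that assms unfolding Fn_def r snoc by blast
        then show ?thesis by auto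
      qed
      then show ?thesis by auto
    qed
    finally show ?thesis by simp
  qed
qed

text \<open>
  This is the direct sum of the spaces \<open>X (tail G b) \<star> arr b\<close> over the arrows \<open>b\<close> that end at \<open>j\<close>;
  for the other arrows, \<open>last_coeff b\<close> vanishes on \<open>Fn (Suc n) i j\<close>.
\<close>

definition extend :: "('v \<Rightarrow> (('v, 'b) path \<Rightarrow> 'k) set) \<Rightarrow> nat \<Rightarrow> 'v \<Rightarrow> 'v \<Rightarrow> (('v, 'b) path \<Rightarrow> 'k) set" where
  "extend X n i j = {z \<in> Fn (Suc n) i j. \<forall>b\<in>arcs G. last_coeff b z \<in> X (tail G b)}"

lemma subspace_extend:
  assumes "\<And>k. FS.subspace (X k)"
  shows "FS.subspace (extend X n i j)"
  using subspace_Fn[of "Suc n" i j] assms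
  by (auto simp: extend_def FS.subspace_def last_coeff_add last_coeff_scale)

lemma dim_extend:
  assumes X: "\<And>k. FS.subspace (X k)" "\<And>k. X k \<subseteq> Fn n i k"
  shows "FS.dim (extend X n i j) = (\<Sum>b | b \<in> arcs G \<and> head G b = j. FS.dim (X (tail G b)))"
proof -
  \<comment> \<open>A filtration of the direct sum: \<open>E B\<close> allows nonzero coefficients
    only at arrows of \<open>B\<close>. Passing to \<open>insert c B\<close> adds the multiples of
    \<open>arr c\<close>, which meet \<open>E B\<close> only in zero because
    \<open>last_coeff c\<close> recovers their left factor.\<close>
  define E where "E B = {z \<in> Fn (Suc n) i j.
    \<forall>b\<in>arcs G. last_coeff b z \<in> (if b \<in> B then X (tail G b) else {0})}" for B
  have X0: "0 \<in> X k" for k using X(1) FS.subspace_0 by blast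
  have subE: "FS.subspace (E B)" for B
    using subspace_Fn[of "Suc n" i j] X(1) unfolding E_def FS.subspace_def
    by (auto simp: last_coeff_add last_coeff_scale)
  have fdE: "FS.finite_dim (E B)" for B
    by (rule FS.finite_dim_mono[OF finite_dim_Fn]) (auto simp: E_def)
  have dimE: "FS.dim (E B) = (\<Sum>b\<in>B. FS.dim (X (tail G b)))"
    if "finite B" "B \<subseteq> {b \<in> arcs G. head G b = j}" for B
    using that
  proof (induction B rule: finite_induct)
    case empty
    have "E {} = {0}"
    proof -
      have "z = 0" if "z \<in> E {}" for z
      proof -
        have "z = (\<Sum>b\<in>{b \<in> arcs G. head G b = j}. last_coeff b z \<star> arr b)"
          using that Fn_eq_sum_last_coeff unfolding E_def by blast
        also have "\<dots> = 0"
          by (rule sum.neutral) (use that in \<open>auto simp: E_def\<close>)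
        finally show ?thesis .
      qed
      then show ?thesis using FS.subspace_0[OF subE] by blast
    qed
    then show ?case by simp
  next
    case (insert c B)
    have c: "c \<in> arcs G" "head G c = j" using insert.prems by auto
    have mult: "x \<star> arr c \<in> Fn (Suc n) i j" if "x \<in> X (tail G c)" for x
      using mult_Fn[OF subsetD[OF X(2) that] arr_Fn[OF c(1)]] c(2) by simp
    have lc: "last_coeff b (x \<star> arr c) = (if b = c then x else 0)" if "x \<in> X (tail G c)" for x b
      using last_coeff_mult_arr[OF subsetD[OF X(2) that]] .
    have "E (insert c B) = {a + x \<star> arr c | a x. a \<in> E B \<and> x \<in> X (tail G c)}"
    proof (intro equalityI subsetI)
      fix z assume z: "z \<in> E (insert c B)"
      define x where "x = last_coeff c z"
      have x: "x \<in> X (tail G c)" using z c unfolding E_def x_def by auto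
      have "last_coeff b (z - x \<star> arr c) = last_coeff b z - (if b = c then x else 0)" for b
        using last_coeff_add[of b "z - x \<star> arr c" "x \<star> arr c"] lc[OF x, of b] by (simp add: algebra_simps)
      then have "z - x \<star> arr c \<in> E B"
        using z mult[OF x] insert.hyps(2) FS.subspace_diff[OF subspace_Fn]
        unfolding E_def by (auto simp: x_def)
      then show "z \<in> {a + x \<star> arr c | a x. a \<in> E B \<and> x \<in> X (tail G c)}"
        using x by (intro CollectI exI[of _ "z - x \<star> arr c"] exI[of _ x]) auto
    next
      fix z assume "z \<in> {a + x \<star> arr c | a x. a \<in> E B \<and> x \<in> X (tail G c)}"
      then obtain a x where z: "z = a + x \<star> arr c" "a \<in> E B" "x \<in> X (tail G c)" by blast
      have "last_coeff b z = last_coeff b a + (if b = c then x else 0)" for b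
        unfolding z(1) last_coeff_add lc[OF z(3)] ..
      moreover have "z \<in> Fn (Suc n) i j"
        using z(2) mult[OF z(3)] FS.subspace_add[OF subspace_Fn] unfolding z(1) E_def by blast
      moreover have "last_coeff c a = 0" using z(2) c insert.hyps(2) unfolding E_def by auto
      ultimately show "z \<in> E (insert c B)"
        using z(2,3) unfolding E_def by auto
    qed
    moreover have "{x \<in> X (tail G c). x \<star> arr c \<in> E B} = {0}"
    proof -
      have "x = 0" if "x \<in> X (tail G c)" "x \<star> arr c \<in> E B" for x
        using lc[OF that(1), of c] that(2) c insert.hyps(2) unfolding E_def by auto
      then show ?thesis using X0 FS.subspace_0[OF subE] by auto
    qed
    moreover have fdX: "FS.finite_dim (X (tail G c))"
      by (rule FS.finite_dim_mono[OF finite_dim_Fn X(2)])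
    ultimately have "FS.dim (E (insert c B)) = FS.dim (E B) + FS.dim (X (tail G c))"
      using FS.dim_sum_image[OF module_hom_mult_right[of "arr c"] X(1)[of "tail G c"] fdX
          subE[of B] fdE[of B]] by simp
    then show ?case using insert by simp
  qed
  have "(last_coeff b z \<in> (if b \<in> {b \<in> arcs G. head G b = j} then X (tail G b) else {0})) \<longleftrightarrow>
      last_coeff b z \<in> X (tail G b)" if "z \<in> Fn (Suc n) i j" for b z
    using last_coeff_eq_0[OF that, of b] X0[of "tail G b"] by (cases "b \<in> arcs G \<and> head G b = j") auto
  then have "E {b \<in> arcs G. head G b = j} = extend X n i j"
    unfolding E_def extend_def by blast
  moreover have "finite {b \<in> arcs G. head G b = j}" using finite_arcs by simp
  ultimately show ?thesis using dimE[of "{b \<in> arcs G. head G b = j}"] by simp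
qed

definition arrow_count :: "'v \<Rightarrow> 'v \<Rightarrow> nat" where
  "arrow_count i j = card {b \<in> arcs G. tail G b = i \<and> head G b = j}"

lemma sum_arrows_into:
  "(\<Sum>b | b \<in> arcs G \<and> head G b = j. f (tail G b)) = (\<Sum>k\<in>UNIV. arrow_count k j * f k)"
proof -
  have "(\<Sum>b | b \<in> arcs G \<and> head G b = j. f (tail G b)) =
      (\<Sum>k\<in>UNIV. \<Sum>b | b \<in> {b \<in> arcs G. head G b = j} \<and> tail G b = k. f (tail G b))"
    using finite_arcs by (intro sum.group[symmetric]) auto
  also have "\<dots> = (\<Sum>k\<in>UNIV. arrow_count k j * f k)"
  proof (rule sum.cong[OF refl])
    fix k
    have "{b. b \<in> {b \<in> arcs G. head G b = j} \<and> tail G b = k} = {b \<in> arcs G. tail G b = k \<and> head G b = j}"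
      by blast
    then show "(\<Sum>b | b \<in> {b \<in> arcs G. head G b = j} \<and> tail G b = k. f (tail G b)) = arrow_count k j * f k"
      unfolding arrow_count_def by simp
  qed
  finally show ?thesis .
qed

lemma extend_Fn: "extend (Fn n i) n i j = Fn (Suc n) i j"
  using last_coeff_Fn by (auto simp: extend_def)

lemma dim_Fn_Suc: "FS.dim (Fn (Suc n) i j) = (\<Sum>k\<in>UNIV. arrow_count k j * FS.dim (Fn n i k))"
  using dim_extend[of "Fn n i", OF subspace_Fn order_refl, of j]
    sum_arrows_into[where f = "\<lambda>k. FS.dim (Fn n i k)"] unfolding extend_Fn by simp

lemma dim_Fn_0: "FS.dim (Fn 0 i j) = (if i = j then 1 else 0)"
proof (cases "i = j")
  case True
  have "Fn 0 i j = FS.span {basis (i, [], i)}"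
  proof
    show "FS.span {basis (i, [], i)} \<subseteq> Fn 0 i j"
      using basis_Fn[of i "[]" i] True by (intro FS.span_minimal subspace_Fn) auto
    show "Fn 0 i j \<subseteq> FS.span {basis (i, [], i)}"
    proof
      fix f assume f: "f \<in> Fn 0 i j"
      have "f = f (i, [], i) *\<^sub>F basis (i, [], i)"
        using f True by (auto simp: Fn_def fun_eq_iff pointwise basis_def)
      then show "f \<in> FS.span {basis (i, [], i)}"
        by (metis FS.span_base FS.span_scale singletonI)
    qed
  qed
  moreover have "basis (i, [], i) \<noteq> (0 :: ('v, 'b) path \<Rightarrow> 'k)"
    by (auto simp: basis_def fun_eq_iff pointwise)
  then have "FS.independent {basis (i, [], i) :: ('v, 'b) path \<Rightarrow> 'k}"
    by simp
  ultimately show ?thesis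
    using True FS.dim_span_eq_card_independent by fastforce
next
  case False
  have "f = 0" if "f \<in> Fn 0 i j" for f
  proof -
    have "f (u, p, w) = 0" for u p w
    proof (rule ccontr)
      assume "f (u, p, w) \<noteq> 0"
      then have "(u, p, w) \<in> paths G \<and> u = i \<and> w = j \<and> length p = 0"
        using that unfolding Fn_def by blast
      then show False using False by auto
    qed
    then show ?thesis by (auto simp: fun_eq_iff pointwise)
  qed
  then have "Fn 0 i j = {0}" using FS.subspace_0[OF subspace_Fn] by blast
  then show ?thesis using False by simp
qed

lemma dim_Fn_1: "FS.dim (Fn 1 i j) = arrow_count i j"
  using dim_Fn_Suc[of 0 i j] by (simp add: dim_Fn_0 if_distrib cong: if_cong)

end


section \<open>The mesh ideal\<close>

fun opposite :: "'a darrow \<Rightarrow> 'a darrow" where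
  "opposite (Arr a) = Opp a"
| "opposite (Opp a) = Arr a"

fun arrow_sign :: "'a darrow \<Rightarrow> 'k::field" where
  "arrow_sign (Arr a) = 1"
| "arrow_sign (Opp a) = - 1"

locale preprojective_quiver =
  fixes Q :: "('v::finite, 'a) pre_digraph" and K :: "'k::field itself"
  assumes verts_Q: "verts Q = UNIV" and finite_arcs_Q: "finite (arcs Q)"

sublocale preprojective_quiver \<subseteq> finite_quiver "double_quiver Q" K
  by unfold_locales (auto simp: double_quiver_def verts_Q finite_arcs_Q)

context preprojective_quiver
begin

abbreviation G :: "('v, 'a darrow) pre_digraph" where
  "G \<equiv> double_quiver Q"

abbreviation \<rho> :: "'v \<Rightarrow> ('v, 'a darrow) path \<Rightarrow> 'k" where
  "\<rho> \<equiv> mesh_relation Q"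

abbreviation I :: "(('v, 'a darrow) path \<Rightarrow> 'k) set" where
  "I \<equiv> mesh_ideal Q"

lemma double_quiver_arrows [simp]:
  "tail G (Arr a) = tail Q a" "head G (Arr a) = head Q a"
  "tail G (Opp a) = head Q a" "head G (Opp a) = tail Q a"
  by (simp_all add: double_quiver_def)

lemma opposite_simps [simp]:
  "opposite (opposite b) = b"
  "tail G (opposite b) = head G b"
  "head G (opposite b) = tail G b"
  "opposite b \<in> arcs G \<longleftrightarrow> b \<in> arcs G"
  by (cases b; auto simp: double_quiver_def)+

lemma arrow_sign_nonzero [simp]: "arrow_sign b \<noteq> (0 :: 'k)"
  by (cases b) auto

text \<open>One signed sum over all arrows of the double quiver leaving \<open>i\<close>, so that
  arrows and their opposites are treated alike. From here on only the nonvanishing of the signs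
  matters.\<close>

lemma mesh_relation_eq:
  "\<rho> i = (\<Sum>b | b \<in> arcs G \<and> tail G b = i. arrow_sign b *\<^sub>F (arr b \<star> arr (opposite b)))"
proof -
  have s: "{b. b \<in> arcs G \<and> tail G b = i} =
      Arr ` {a \<in> arcs Q. tail Q a = i} \<union> Opp ` {a \<in> arcs Q. head Q a = i}"
    by (auto simp: double_quiver_def)
  have "(\<Sum>b | b \<in> arcs G \<and> tail G b = i. arrow_sign b *\<^sub>F (arr b \<star> arr (opposite b))) =
      (\<Sum>b\<in>Arr ` {a \<in> arcs Q. tail Q a = i}. arrow_sign b *\<^sub>F (arr b \<star> arr (opposite b))) +
      (\<Sum>b\<in>Opp ` {a \<in> arcs Q. head Q a = i}. arrow_sign b *\<^sub>F (arr b \<star> arr (opposite b)))"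
    unfolding s using finite_arcs_Q by (intro sum.union_disjoint) auto
  also have "(\<Sum>b\<in>Arr ` {a \<in> arcs Q. tail Q a = i}. arrow_sign b *\<^sub>F (arr b \<star> arr (opposite b))) =
      (\<Sum>a\<in>{a \<in> arcs Q. tail Q a = i}. basis (i, [Arr a, Opp a], i))"
    by (subst sum.reindex) (auto simp: inj_on_def arr_def basis_mult_basis intro!: sum.cong)
  also have "(\<Sum>b\<in>Opp ` {a \<in> arcs Q. head Q a = i}. arrow_sign b *\<^sub>F (arr b \<star> arr (opposite b))) =
      - (\<Sum>a\<in>{a \<in> arcs Q. head Q a = i}. basis (i, [Opp a, Arr a], i))"
    unfolding sum_negf[symmetric]
    by (subst sum.reindex) (auto simp: inj_on_def arr_def basis_mult_basis intro!: sum.cong)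
  finally show ?thesis
    unfolding mesh_relation_def by (auto simp: fun_eq_iff pointwise sum_fun_apply)
qed

lemma arr_F: "b \<in> arcs G \<Longrightarrow> arr b \<in> F"
  using arr_Fn Fn_subset_F by blast

lemma arr_opposite_Fn:
  assumes "b \<in> arcs G"
  shows "arr b \<star> arr (opposite b) \<in> Fn 2 (tail G b) (tail G b)"
  using mult_Fn[OF arr_Fn[OF assms], of "arr (opposite b)" 1 "tail G b"] arr_Fn[of "opposite b"] assms
  by (simp add: numeral_2_eq_2)

lemma mesh_relation_Fn: "\<rho> i \<in> Fn 2 i i"
  unfolding mesh_relation_eq
  by (intro FS.subspace_sum[OF subspace_Fn] FS.subspace_scale[OF subspace_Fn]) (use arr_opposite_Fn in auto)

lemma mesh_relation_F: "\<rho> i \<in> F"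
  using mesh_relation_Fn Fn_subset_F by blast

section \<open>The mesh ideal as a graded subspace\<close>

lemma ideal_I: "ideal I (path_algebra G)"
  unfolding mesh_ideal_def verts_Q using mesh_relation_F by (intro ring.genideal_ideal[OF ring_path_algebra]) auto

lemma I_subset_F: "I \<subseteq> F"
  using ideal.Icarr[OF ideal_I] by blast

lemma mesh_relation_I: "\<rho> i \<in> I"
  using ring.genideal_self[OF ring_path_algebra, of "range \<rho>"] mesh_relation_F
  unfolding mesh_ideal_def verts_Q by blast

lemma mult_I: "f \<in> F \<Longrightarrow> x \<in> I \<Longrightarrow> f \<star> x \<in> I" "f \<in> F \<Longrightarrow> x \<in> I \<Longrightarrow> x \<star> f \<in> I"
  using ideal.I_l_closed[OF ideal_I, of x f] ideal.I_r_closed[OF ideal_I, of x f] by simp_all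

lemma subspace_I: "FS.subspace I"
  unfolding FS.subspace_def
proof (intro conjI ballI allI)
  interpret ideal I "path_algebra G" by (fact ideal_I)
  show "0 \<in> I" using additive_subgroup.zero_closed[OF is_additive_subgroup] by simp
  show "x + y \<in> I" if "x \<in> I" "y \<in> I" for x y
    using additive_subgroup.a_closed[OF is_additive_subgroup that] by simp
  show "c *\<^sub>F x \<in> I" if "x \<in> I" for c x
    using mult_I(1)[OF scale_F[OF one_F, of c] that] by simp
qed

lemma mesh_multiple_I:
  assumes "(i, p, v) \<in> paths G" "(v, q, j) \<in> paths G"
  shows "basis (i, p, v) \<star> \<rho> v \<star> basis (v, q, j) \<in> I"
  by (intro mult_I basis_F assms mesh_relation_I)

text \<open>The multiples of mesh relations by paths on both sides already span an ideal, because
  multiplying by a further path just lengthens one of the two outer paths or gives zero. All later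
  statements on \<open>I\<close> are reduced to these homogeneous generators.\<close>

lemma I_eq_span:
  "I = FS.span {basis (i, p, v) \<star> \<rho> v \<star> basis (v, q, j) | i p v q j.
    (i, p, v) \<in> paths G \<and> (v, q, j) \<in> paths G}" (is "_ = FS.span ?S")
proof
  show "FS.span ?S \<subseteq> I"
    using mesh_multiple_I by (intro FS.span_minimal subspace_I) blast
  have S_F: "?S \<subseteq> F"
    using mesh_multiple_I I_subset_F by blast
  have SF: "FS.span ?S \<subseteq> F"
    using S_F by (intro FS.span_minimal subspace_F)
  have S_mem: "basis (i, p, v) \<star> \<rho> v \<star> basis (v, q, j) \<in> FS.span ?S"
    if "(i, p, v) \<in> paths G" "(v, q, j) \<in> paths G" for i p v q j
    by (rule FS.span_base) (use that in blast)
  have left: "f \<star> x \<in> FS.span ?S" if "f \<in> F" "x \<in> FS.span ?S" for f x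
    using that(1)
  proof (induction rule: F_induct)
    case (basis r)
    obtain i' p' v' where r: "r = (i', p', v')" by (cases r) auto
    have "FS.subspace {x. basis r \<star> x \<in> FS.span ?S}"
      by (auto simp: FS.subspace_def path_mult_distrib_left FS.span_add FS.span_scale FS.span_zero)
    moreover have "?S \<subseteq> {x. basis r \<star> x \<in> FS.span ?S}"
    proof
      fix x assume "x \<in> ?S"
      then obtain i p v q j where x: "x = basis (i, p, v) \<star> \<rho> v \<star> basis (v, q, j)"
        "(i, p, v) \<in> paths G" "(v, q, j) \<in> paths G" by blast
      have "basis r \<star> x = (basis r \<star> basis (i, p, v)) \<star> \<rho> v \<star> basis (v, q, j)"
        unfolding x by (simp add: path_mult_assoc)
      also have "\<dots> = (if v' = i then basis (i', p' @ p, v) \<star> \<rho> v \<star> basis (v, q, j) else 0)"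
        unfolding r basis_mult_basis by simp
      also have "\<dots> \<in> FS.span ?S"
      proof (cases "v' = i")
        case True
        then have "(i', p' @ p, v) \<in> paths G" using basis x r path_append by auto
        then show ?thesis using True S_mem[OF _ x(3)] by simp
      qed (simp add: FS.span_zero)
      finally show "x \<in> {x. basis r \<star> x \<in> FS.span ?S}" by simp
    qed
    ultimately show ?case using FS.span_minimal[of ?S] that(2) by blast
  qed (simp_all add: path_mult_distrib_right FS.span_add FS.span_scale FS.span_zero)
  have right: "x \<star> f \<in> FS.span ?S" if "f \<in> F" "x \<in> FS.span ?S" for f x
    using that(1)
  proof (induction rule: F_induct)
    case (basis r)
    obtain i' p' v' where r: "r = (i', p', v')" by (cases r) auto
    have "FS.subspace {x. x \<star> basis r \<in> FS.span ?S}"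
      by (auto simp: FS.subspace_def path_mult_distrib_right FS.span_add FS.span_scale FS.span_zero)
    moreover have "?S \<subseteq> {x. x \<star> basis r \<in> FS.span ?S}"
    proof
      fix x assume "x \<in> ?S"
      then obtain i p v q j where x: "x = basis (i, p, v) \<star> \<rho> v \<star> basis (v, q, j)"
        "(i, p, v) \<in> paths G" "(v, q, j) \<in> paths G" by blast
      have "x \<star> basis r = basis (i, p, v) \<star> \<rho> v \<star> (basis (v, q, j) \<star> basis r)"
        unfolding x by (simp add: path_mult_assoc)
      also have "\<dots> = (if j = i' then basis (i, p, v) \<star> \<rho> v \<star> basis (v, q @ p', v') else 0)"
        unfolding r basis_mult_basis by simp
      also have "\<dots> \<in> FS.span ?S"
      proof (cases "j = i'")
        case True
        then have "(v, q @ p', v') \<in> paths G" using basis x r path_append by auto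
        then show ?thesis using True S_mem[OF x(2)] by simp
      qed (simp add: FS.span_zero)
      finally show "x \<in> {x. x \<star> basis r \<in> FS.span ?S}" by simp
    qed
    ultimately show ?case using FS.span_minimal[of ?S] that(2) by blast
  qed (simp_all add: path_mult_distrib_left FS.span_add FS.span_scale FS.span_zero)
  have "ideal (FS.span ?S) (path_algebra G)"
  proof (rule idealI[OF ring_path_algebra])
    interpret R: ring "path_algebra G :: (('v, 'a darrow) path \<Rightarrow> 'k) ring" by (rule ring_path_algebra)
    have inv: "inv\<^bsub>add_monoid (path_algebra G)\<^esub> x = - x" if "x \<in> F" for x
      using R.minus_equality[of "- x" x] uminus_F[OF that] that unfolding a_inv_def by simp
    show "subgroup (FS.span ?S) (add_monoid (path_algebra G))"
    proof (rule subgroup.intro)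
      fix x assume x: "x \<in> FS.span ?S"
      then show "inv\<^bsub>add_monoid (path_algebra G)\<^esub> x \<in> FS.span ?S"
        using inv[of x] SF FS.span_neg[OF x] by (simp add: subset_iff)
    qed (use SF in \<open>simp_all add: FS.span_add FS.span_zero\<close>)
    show "x \<otimes>\<^bsub>path_algebra G\<^esub> a \<in> FS.span ?S" if "a \<in> FS.span ?S" "x \<in> F" for a x
      using left that by simp
    show "a \<otimes>\<^bsub>path_algebra G\<^esub> x \<in> FS.span ?S" if "a \<in> FS.span ?S" "x \<in> F" for a x
      using right that by simp
  qed
  moreover have "range \<rho> \<subseteq> FS.span ?S"
  proof
    fix x assume "x \<in> range \<rho>"
    then obtain v where v: "x = \<rho> v" by blast
    have "basis (v, [], v) \<star> \<rho> v \<star> basis (v, [], v) = \<rho> v"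
      using idem_mult_Fn[OF mesh_relation_Fn, of v v] by simp
    then show "x \<in> FS.span ?S" unfolding v
      by (intro FS.span_base CollectI exI[of _ v] exI[of _ "[]"] conjI) simp_all
  qed
  ultimately show "I \<subseteq> FS.span ?S"
    unfolding mesh_ideal_def verts_Q by (intro ring.genideal_minimal[OF ring_path_algebra]) auto
qed

lemma generator_Fn:
  assumes "(i, p, v) \<in> paths G" "(v, q, j) \<in> paths G"
  shows "basis (i, p, v) \<star> \<rho> v \<star> basis (v, q, j) \<in> Fn (length p + 2 + length q) i j"
  using assms by (intro mult_Fn[where k = v] basis_Fn mesh_relation_Fn)

text \<open>Typically \<open>S\<close> is a preimage under \<open>comp n i j\<close>: a generator is
  homogeneous, so \<open>comp\<close> either keeps it or kills it.\<close>

lemma I_induct: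
  assumes "x \<in> I" and "FS.subspace S"
    and "\<And>i p v q j. (i, p, v) \<in> paths G \<Longrightarrow> (v, q, j) \<in> paths G \<Longrightarrow>
      basis (i, p, v) \<star> \<rho> v \<star> basis (v, q, j) \<in> S"
  shows "x \<in> S"
proof -
  have "x \<in> FS.span {basis (i, p, v) \<star> \<rho> v \<star> basis (v, q, j) | i p v q j.
    (i, p, v) \<in> paths G \<and> (v, q, j) \<in> paths G}"
    using assms(1) by (simp only: I_eq_span)
  moreover have "\<dots> \<subseteq> S"
    by (intro FS.span_minimal assms(2)) (use assms(3) in blast)
  ultimately show ?thesis by (rule subsetD[rotated])
qed

lemma subspace_comp_vimage: "FS.subspace S \<Longrightarrow> FS.subspace {x. comp n i j x \<in> S}"
  by (auto simp: FS.subspace_def comp_add comp_scale)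

lemma comp_I:
  assumes "x \<in> I"
  shows "comp n i j x \<in> I"
proof -
  have "x \<in> {x. comp n i j x \<in> I}"
    using assms
  proof (rule I_induct)
    fix k p v q l assume pq: "(k, p, v) \<in> paths G" "(v, q, l) \<in> paths G"
    have "basis (k, p, v) \<star> \<rho> v \<star> basis (v, q, l) \<in> I"
      by (rule mesh_multiple_I[OF pq])
    then show "basis (k, p, v) \<star> \<rho> v \<star> basis (v, q, l) \<in> {x. comp n i j x \<in> I}"
      using comp_Fn[OF generator_Fn[OF pq], of n i j] FS.subspace_0[OF subspace_I] by auto
  qed (intro subspace_comp_vimage subspace_I)
  then show ?thesis by simp
qed

lemma I_low_degree:
  assumes "n < 2" "x \<in> I" "x \<in> Fn n i j"
  shows "x = 0"
proof -
  have "x \<in> {x. comp n i j x \<in> {0}}"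
    using assms(2)
  proof (rule I_induct)
    fix k p v q l assume pq: "(k, p, v) \<in> paths G" "(v, q, l) \<in> paths G"
    show "basis (k, p, v) \<star> \<rho> v \<star> basis (v, q, l) \<in> {x. comp n i j x \<in> {0}}"
      using comp_Fn[OF generator_Fn[OF pq], of n i j] assms(1) by auto
  qed (intro subspace_comp_vimage FS.subspace_single_0)
  then show ?thesis using comp_Fn[OF assms(3), of n i j] by simp
qed

section \<open>Dimension recurrence for the mesh ideal\<close>

definition In :: "nat \<Rightarrow> 'v \<Rightarrow> 'v \<Rightarrow> (('v, 'a darrow) path \<Rightarrow> 'k) set" where
  "In n i j = Fn n i j \<inter> I"

text \<open>
  \<open>Kn n i j\<close> is the preimage of the elements of \<open>e\<^sub>i \<Pi>\<^sub>n e\<^sub>j\<close> that are annihilated on the right by all arrows.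
\<close>

definition Kn :: "nat \<Rightarrow> 'v \<Rightarrow> 'v \<Rightarrow> (('v, 'a darrow) path \<Rightarrow> 'k) set" where
  "Kn n i j = {x \<in> Fn n i j. \<forall>b\<in>arcs G. tail G b = j \<longrightarrow> x \<star> arr b \<in> I}"

lemma subspace_In: "FS.subspace (In n i j)"
  unfolding In_def by (rule FS.subspace_inter[OF subspace_Fn subspace_I])

lemma subspace_Kn: "FS.subspace (Kn n i j)"
  using subspace_Fn[of n i j] subspace_I
  by (auto simp: FS.subspace_def Kn_def path_mult_distrib_right)

lemma In_subset_Kn: "In n i j \<subseteq> Kn n i j"
proof
  fix x assume x: "x \<in> In n i j"
  have "x \<star> arr b \<in> I" if "b \<in> arcs G" for b
    using x arr_F[OF that] by (intro mult_I(2)) (auto simp: In_def)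
  then show "x \<in> Kn n i j" using x by (simp add: In_def Kn_def)
qed

lemma finite_dim_In: "FS.finite_dim (In n i j)"
  by (rule FS.finite_dim_mono[OF finite_dim_Fn]) (auto simp: In_def)

lemma mult_mesh_eq:
  "x \<star> \<rho> j = (\<Sum>b | b \<in> arcs G \<and> tail G b = j. arrow_sign b *\<^sub>F ((x \<star> arr b) \<star> arr (opposite b)))"
  unfolding mesh_relation_eq path_mult_sum_right by (simp add: path_mult_assoc)

text \<open>In \<open>\<rho> j\<close> the arrow \<open>c\<close> occurs as the last one only in the
  term of \<open>b = opposite c\<close>, so up to sign the coefficient of
  \<open>x \<star> \<rho> j\<close> at \<open>c\<close> is
  \<open>x \<star> arr (opposite c)\<close>.\<close>

lemma last_coeff_mult_mesh:
  assumes "x \<in> Fn n i j" "c \<in> arcs G"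
  shows "last_coeff c (x \<star> \<rho> j) = (if head G c = j then arrow_sign (opposite c) *\<^sub>F (x \<star> arr (opposite c)) else 0)"
proof -
  have "last_coeff c ((x \<star> arr b) \<star> arr (opposite b)) = (if c = opposite b then x \<star> arr b else 0)"
    if "b \<in> arcs G" "tail G b = j" for b
  proof (rule last_coeff_mult_arr)
    show "x \<star> arr b \<in> Fn (n + 1) i (tail G (opposite b))"
      using mult_Fn[OF _ arr_Fn[OF that(1)], of x n i] assms(1) that by simp
  qed
  then have "last_coeff c (x \<star> \<rho> j) = (\<Sum>b | b \<in> arcs G \<and> tail G b = j.
      arrow_sign b *\<^sub>F (if c = opposite b then x \<star> arr b else 0))"
    unfolding mult_mesh_eq last_coeff_sum last_coeff_scale
    by (intro sum.cong refl) simp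
  also have "\<dots> = (\<Sum>b | b \<in> arcs G \<and> tail G b = j.
      if b = opposite c then arrow_sign b *\<^sub>F (x \<star> arr b) else 0)"
    by (intro sum.cong refl) auto
  also have "\<dots> = (if head G c = j then arrow_sign (opposite c) *\<^sub>F (x \<star> arr (opposite c)) else 0)"
    using finite_arcs assms(2) by (subst sum.delta) auto
  finally show ?thesis .
qed

text \<open>Up to nonzero signs, the last coefficients of \<open>x \<star> \<rho> j\<close> are the
  products of \<open>x\<close> with the arrows leaving \<open>j\<close>. Since last coefficients are
  unique, membership in the sum over arrows can be tested on each of them.\<close>

lemma mult_mesh_extend_iff:
  assumes "x \<in> Fn n i j"
  shows "x \<star> \<rho> j \<in> extend (In (n + 1) i) (n + 1) i j \<longleftrightarrow> x \<in> Kn n i j"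
proof -
  have m: "x \<star> \<rho> j \<in> Fn (Suc (n + 1)) i j"
    using mult_Fn[OF assms mesh_relation_Fn] by simp
  have a: "x \<star> arr b \<in> Fn (n + 1) i (head G b)" if "b \<in> arcs G" "tail G b = j" for b
    using mult_Fn[OF _ arr_Fn[OF that(1)], of x n i] assms that by simp
  have sc: "c *\<^sub>F y \<in> I \<longleftrightarrow> y \<in> I" if "c \<noteq> 0" for c :: 'k and y
  proof
    assume "c *\<^sub>F y \<in> I"
    then have "inverse c *\<^sub>F (c *\<^sub>F y) \<in> I" by (rule FS.subspace_scale[OF subspace_I])
    then show "y \<in> I" using that by simp
  qed (rule FS.subspace_scale[OF subspace_I])
  have "last_coeff c (x \<star> \<rho> j) \<in> In (n + 1) i (tail G c) \<longleftrightarrow>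
      (tail G (opposite c) = j \<longrightarrow> x \<star> arr (opposite c) \<in> I)" if "c \<in> arcs G" for c
    using last_coeff_mult_mesh[OF assms that] last_coeff_Fn[OF m, of c] sc[of "arrow_sign (opposite c)"]
      FS.subspace_0[OF subspace_I] FS.subspace_0[OF subspace_Fn]
    unfolding In_def by (cases "head G c = j") auto
  then have "x \<star> \<rho> j \<in> extend (In (n + 1) i) (n + 1) i j \<longleftrightarrow>
      (\<forall>c\<in>arcs G. tail G (opposite c) = j \<longrightarrow> x \<star> arr (opposite c) \<in> I)"
    using m unfolding extend_def by auto
  also have "\<dots> \<longleftrightarrow> (\<forall>c\<in>arcs G. tail G c = j \<longrightarrow> x \<star> arr c \<in> I)"
  proof (intro iffI ballI impI)
    fix c assume H: "\<forall>c\<in>arcs G. tail G (opposite c) = j \<longrightarrow> x \<star> arr (opposite c) \<in> I"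
      and "c \<in> arcs G" "tail G c = j"
    then show "x \<star> arr c \<in> I" using H[rule_format, of "opposite c"] by simp
  next
    fix c assume H: "\<forall>c\<in>arcs G. tail G c = j \<longrightarrow> x \<star> arr c \<in> I"
      and "c \<in> arcs G" "tail G (opposite c) = j"
    then show "x \<star> arr (opposite c) \<in> I" using H[rule_format, of "opposite c"] by simp
  qed
  finally show ?thesis using assms unfolding Kn_def by simp
qed

text \<open>The two summands sort the generators by their right-hand path \<open>q\<close>: for
  trivial \<open>q\<close> the generator is a multiple of \<open>\<rho> j\<close>, and otherwise the
  last arrow of \<open>q\<close> splits off and leaves a generator of degree one less.\<close>

lemma In_Suc_Suc:
  "In (n + 2) i j = {a + y \<star> \<rho> j | a y. a \<in> extend (In (n + 1) i) (n + 1) i j \<and> y \<in> Fn n i j}" (is "_ = ?S")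
proof
  have subE: "FS.subspace (extend (In (n + 1) i) (n + 1) i j)"
    by (intro subspace_extend subspace_In)
  have S: "FS.subspace ?S"
  proof -
    have "?S = {a + y | a y. a \<in> extend (In (n + 1) i) (n + 1) i j \<and> y \<in> (\<lambda>y. y \<star> \<rho> j) ` Fn n i j}"
      by blast
    moreover have "FS.subspace ((\<lambda>y. y \<star> \<rho> j) ` Fn n i j)"
      by (rule module_hom.subspace_image[OF module_hom_mult_right subspace_Fn])
    ultimately show ?thesis using FS.subspace_sums[OF subE] by simp
  qed
  show "In (n + 2) i j \<subseteq> ?S"
  proof
    fix x assume x: "x \<in> In (n + 2) i j"
    \<comment> \<open>An expression of \<open>x\<close> by generators may involve other degrees and
      vertices. Applying \<open>comp\<close> removes these, and it fixes \<open>x\<close>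
      itself.\<close>
    have "x \<in> {x. comp (n + 2) i j x \<in> ?S}"
    proof (rule I_induct[OF _ subspace_comp_vimage[OF S]])
      show "x \<in> I" using x by (simp add: In_def)
    next
      fix k p v q l assume pq: "(k, p, v) \<in> paths G" "(v, q, l) \<in> paths G"
      define g where "g = basis (k, p, v) \<star> \<rho> v \<star> basis (v, q, l)"
      have gF: "g \<in> Fn (length p + 2 + length q) k l" unfolding g_def by (rule generator_Fn[OF pq])
      show "basis (k, p, v) \<star> \<rho> v \<star> basis (v, q, l) \<in> {x. comp (n + 2) i j x \<in> ?S}"
      proof (cases "n = length p + length q \<and> i = k \<and> j = l")
        case False
        then have "comp (n + 2) i j g = 0" using comp_Fn[OF gF, of "n + 2" i j] by auto
        then show ?thesis using FS.subspace_0[OF S] unfolding g_def by simp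
      next
        case True
        then have cg: "comp (n + 2) i j g = g" using comp_Fn[OF gF, of "n + 2" i j] by auto
        have "g \<in> ?S"
        proof (cases q rule: rev_cases)
          case Nil
          then have "v = j" using pq True by simp
          then have "g = 0 + basis (k, p, v) \<star> \<rho> j"
            unfolding g_def Nil using idem_mult_Fn(2)[OF mesh_relation_Fn, of j j] True
            by (simp add: path_mult_assoc)
          moreover have "basis (k, p, v) \<in> Fn n i j"
            using basis_Fn[OF pq(1)] True Nil \<open>v = j\<close> by simp
          ultimately show ?thesis using FS.subspace_0[OF subE] by blast
        next
          case (snoc q' b)
          have b: "b \<in> arcs G" "head G b = l" "(v, q', tail G b) \<in> paths G" using pq(2) snoc by auto
          define g' where "g' = basis (k, p, v) \<star> \<rho> v \<star> basis (v, q', tail G b)"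
          have g: "g = g' \<star> arr b"
            unfolding g_def g'_def snoc arr_def using b(2) by (simp add: path_mult_assoc basis_mult_basis)
          have g': "g' \<in> Fn (n + 1) i (tail G b)"
            using generator_Fn[OF pq(1) b(3)] True snoc unfolding g'_def by (simp add: numeral_2_eq_2)
          moreover have "g' \<in> I"
            unfolding g'_def by (rule mesh_multiple_I[OF pq(1) b(3)])
          moreover have "g \<in> Fn (Suc (n + 1)) i j" using gF True by simp
          ultimately have "g \<in> extend (In (n + 1) i) (n + 1) i j"
            using last_coeff_mult_arr[OF g'] FS.subspace_0[OF subspace_In]
            unfolding extend_def In_def g by auto
          then have "g + 0 \<star> \<rho> j \<in> ?S" using FS.subspace_0[OF subspace_Fn] by blast
          then show ?thesis by simp
        qed
        then show ?thesis using cg unfolding g_def by simp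
      qed
    qed
    then show "x \<in> ?S" using x comp_Fn[of x "n + 2" i j "n + 2" i j] unfolding In_def by simp
  qed
  show "?S \<subseteq> In (n + 2) i j"
  proof
    fix x assume "x \<in> ?S"
    then obtain a y where x: "x = a + y \<star> \<rho> j" "a \<in> extend (In (n + 1) i) (n + 1) i j" "y \<in> Fn n i j"
      by blast
    have aF: "a \<in> Fn (Suc (n + 1)) i j" using x(2) unfolding extend_def by simp
    have "(\<Sum>b\<in>{b \<in> arcs G. head G b = j}. last_coeff b a \<star> arr b) \<in> I"
      using x(2) arr_F
      by (intro FS.subspace_sum[OF subspace_I] mult_I(2)) (auto simp: extend_def In_def)
    then have "a \<in> I" using Fn_eq_sum_last_coeff[OF aF] by simp
    moreover have "y \<star> \<rho> j \<in> I" using x(3) Fn_subset_F by (intro mult_I(1) mesh_relation_I) blast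
    moreover have "y \<star> \<rho> j \<in> Fn (n + 2) i j" by (rule mult_Fn[OF x(3) mesh_relation_Fn])
    ultimately show "x \<in> In (n + 2) i j"
      using aF unfolding x(1) In_def
      by (auto intro!: FS.subspace_add[OF subspace_I] FS.subspace_add[OF subspace_Fn])
  qed
qed

lemma dim_In_Suc_Suc:
  "FS.dim (In (n + 2) i j) + FS.dim (Kn n i j) =
    (\<Sum>k\<in>UNIV. arrow_count k j * FS.dim (In (n + 1) i k)) + FS.dim (Fn n i j)"
proof -
  let ?E = "extend (In (n + 1) i) (n + 1) i j"
  have "FS.subspace ?E" by (intro subspace_extend subspace_In)
  moreover have "FS.finite_dim ?E"
    by (rule FS.finite_dim_mono[OF finite_dim_Fn]) (auto simp: extend_def)
  ultimately have "FS.dim {a + y \<star> \<rho> j | a y. a \<in> ?E \<and> y \<in> Fn n i j} +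
      FS.dim {y \<in> Fn n i j. y \<star> \<rho> j \<in> ?E} = FS.dim ?E + FS.dim (Fn n i j)"
    by (intro FS.dim_sum_image module_hom_mult_right subspace_Fn finite_dim_Fn)
  moreover have "{y \<in> Fn n i j. y \<star> \<rho> j \<in> ?E} = Kn n i j"
    using mult_mesh_extend_iff by (auto simp: Kn_def)
  moreover have "FS.dim ?E = (\<Sum>k\<in>UNIV. arrow_count k j * FS.dim (In (n + 1) i k))"
    using dim_extend[of "In (n + 1) i" "n + 1" i j] subspace_In
      sum_arrows_into[where j = j and f = "\<lambda>k. FS.dim (In (n + 1) i k)"] by (simp add: In_def)
  ultimately show ?thesis unfolding In_Suc_Suc by simp
qed

definition dim_Pi :: "nat \<Rightarrow> 'v \<Rightarrow> 'v \<Rightarrow> int" where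
  "dim_Pi n i j = int (FS.dim (Fn n i j)) - int (FS.dim (In n i j))"

definition dim_soc :: "nat \<Rightarrow> 'v \<Rightarrow> 'v \<Rightarrow> int" where
  "dim_soc n i j = int (FS.dim (Kn n i j)) - int (FS.dim (In n i j))"

lemma In_low: "n < 2 \<Longrightarrow> In n i j = {0}"
  using I_low_degree FS.subspace_0[OF subspace_In] by (auto simp: In_def)

lemma dim_Pi_0: "dim_Pi 0 i j = (if i = j then 1 else 0)"
  by (simp add: dim_Pi_def dim_Fn_0 In_low)

lemma dim_Pi_1: "dim_Pi 1 i j = int (arrow_count i j)"
  using dim_Fn_1 by (simp add: dim_Pi_def In_low)

text \<open>The entrywise form of \<open>h_\<Pi> (1 - C t + t^2) = 1 + t^2 h_S\<close> in degrees
  from 2 on. It is the recurrence of the free path algebra minus that of the ideal; the deviation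
  from a Chebyshev recurrence is exactly the socle term.\<close>

lemma dim_Pi_Suc_Suc:
  "dim_Pi (n + 2) i j = (\<Sum>k\<in>UNIV. dim_Pi (n + 1) i k * int (arrow_count k j)) - dim_Pi n i j + dim_soc n i j"
proof -
  have "int (FS.dim (In (n + 2) i j)) + int (FS.dim (Kn n i j)) =
      (\<Sum>k\<in>UNIV. int (arrow_count k j) * int (FS.dim (In (n + 1) i k))) + int (FS.dim (Fn n i j))"
    using arg_cong[OF dim_In_Suc_Suc, of int n i j] by simp
  moreover have "int (FS.dim (Fn (n + 2) i j)) =
      (\<Sum>k\<in>UNIV. int (arrow_count k j) * int (FS.dim (Fn (n + 1) i k)))"
    using arg_cong[OF dim_Fn_Suc, of int "n + 1" i j] by simp
  ultimately show ?thesis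
    unfolding dim_Pi_def dim_soc_def
    by (simp add: algebra_simps sum_subtractf)
qed

end


section \<open>The preprojective algebra as a quotient\<close>

lemma (in ring) subfield_range:
  fixes sc :: "'k::field \<Rightarrow> 'a"
  assumes car: "\<And>c. sc c \<in> carrier R" and one: "sc 1 = \<one>" and nz: "\<one> \<noteq> \<zero>"
    and add: "\<And>c d. sc (c + d) = sc c \<oplus> sc d" and mult: "\<And>c d. sc (c * d) = sc c \<otimes> sc d"
  shows "subfield (range sc) R"
proof (rule subfieldI)
  have zero: "sc 0 = \<zero>" using add[of 0 0] car[of 0] by (simp add: add.r_cancel_one')
  have neg: "\<ominus> sc c = sc (- c)" for c
    using minus_equality[of "sc (- c)" "sc c"] add[of "- c" c] zero car by simp
  have sub: "subring (range sc) R"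
  proof (rule subringI)
    show "\<one> \<in> range sc" using one by (metis rangeI)
  qed (use car neg add[symmetric] mult[symmetric] in auto)
  then show "subcring (range sc) R"
    by (rule subcringI) (auto simp: mult[symmetric] mult.commute)
  show "Units (R\<lparr>carrier := range sc\<rparr>) = range sc - {\<zero>}"
  proof (intro Set.set_eqI iffI)
    fix x assume "x \<in> Units (R\<lparr>carrier := range sc\<rparr>)"
    then obtain y where "x \<in> range sc" "y \<in> range sc" "x \<otimes> y = \<one>" unfolding Units_def by auto
    then show "x \<in> range sc - {\<zero>}" using nz car by auto
  next
    fix x assume "x \<in> range sc - {\<zero>}"
    then obtain c where c: "x = sc c" "c \<noteq> 0" using zero by auto
    have "sc (inverse c) \<otimes> x = \<one>" "x \<otimes> sc (inverse c) = \<one>"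
      using c one by (simp_all add: mult[symmetric])
    then show "x \<in> Units (R\<lparr>carrier := range sc\<rparr>)" unfolding Units_def using c(1) by auto
  qed
qed

context finite_quiver
begin

lemma basis_mult_mult_basis:
  assumes "\<And>u p v. x (u, p, v) \<noteq> 0 \<Longrightarrow> length p = n"
  shows "basis (i, [], i) \<star> x \<star> basis (j, [], j) = comp n i j x"
  using assms by (auto simp: comp_def fun_eq_iff mult_basis_apply basis_mult_apply)

lemma adjacency_matrix_eq:
  "adjacency_matrix K G = Sqmat (\<chi> i j. int (arrow_count i j))"
proof -
  have sc: "path_scalar G c = (c *\<^sub>F path_one :: ('v, 'b) path \<Rightarrow> 'k)" for c
    unfolding path_scalar_def by (simp add: fun_scale_def)
  have nz: "path_one \<noteq> (0 :: ('v, 'b) path \<Rightarrow> 'k)"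
  proof
    assume "path_one = (0 :: ('v, 'b) path \<Rightarrow> 'k)"
    from fun_cong[OF this, of "(undefined, [], undefined)"] show False
      by (simp add: path_one_def pointwise)
  qed
  have sf: "subfield (range (path_scalar G :: 'k \<Rightarrow> _)) (path_algebra G)"
    by (rule ring.subfield_range[OF ring_path_algebra])
      (use nz in \<open>simp_all add: sc scale_F one_F FS.scale_left_distrib\<close>)
  have "{basis (i, [], i) \<otimes>\<^bsub>path_algebra G\<^esub> x \<otimes>\<^bsub>path_algebra G\<^esub> basis (j, [], j) | x.
      x \<in> (path_degree G 1 :: (('v, 'b) path \<Rightarrow> 'k) set)} = id ` Fn 1 i j" for i j
  proof (intro Set.set_eqI iffI)
    fix y :: "('v, 'b) path \<Rightarrow> 'k"
    assume "y \<in> {basis (i, [], i) \<otimes>\<^bsub>path_algebra G\<^esub> x \<otimes>\<^bsub>path_algebra G\<^esub> basis (j, [], j) | x.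
      x \<in> path_degree G 1}"
    then obtain x where x: "y = basis (i, [], i) \<star> x \<star> basis (j, [], j)" "x \<in> F"
      "\<forall>u p v. x (u, p, v) \<noteq> 0 \<longrightarrow> length p = 1"
      unfolding path_degree_def by auto
    have "y = comp 1 i j x"
      unfolding x(1) by (rule basis_mult_mult_basis) (use x(3) in blast)
    then show "y \<in> id ` Fn 1 i j" using comp_in_Fn[OF x(2)] by simp
  next
    fix y :: "('v, 'b) path \<Rightarrow> 'k"
    assume "y \<in> id ` Fn 1 i j"
    then have y: "y \<in> Fn 1 i j" by simp
    then have "y \<in> path_degree G 1" using Fn_subset_F unfolding path_degree_def Fn_def by blast
    moreover have "y = basis (i, [], i) \<star> y \<star> basis (j, [], j)" using y by (simp add: idem_mult_Fn)
    ultimately show "y \<in> {basis (i, [], i) \<otimes>\<^bsub>path_algebra G\<^esub> x \<otimes>\<^bsub>path_algebra G\<^esub> basis (j, [], j) | x.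
      x \<in> path_degree G 1}" by auto
  qed
  moreover have "int (ring.dim (path_algebra G) (range (path_scalar G :: 'k \<Rightarrow> _)) (id ` Fn 1 i j)) =
      int (FS.dim (Fn 1 i j)) - int (FS.dim (Fn 1 i j \<inter> {0}))" for i j
    by (rule FS.dim_linear_image_ring[OF ring_path_algebra sf])
      (use Fn_subset_F in \<open>auto simp: subspace_Fn finite_dim_Fn sc\<close>)
  moreover have "Fn 1 i j \<inter> {0} = {0}" for i j
    using FS.subspace_0[OF subspace_Fn] by auto
  ultimately show ?thesis
    unfolding adjacency_matrix_def dim_matrix_def using dim_Fn_1 by simp
qed

end

context preprojective_quiver
begin

abbreviation Pi :: "('v, 'a, 'k) preproj ring" where
  "Pi \<equiv> preproj_algebra Q"

abbreviation cl :: "(('v, 'a darrow) path \<Rightarrow> 'k) \<Rightarrow> ('v, 'a, 'k) preproj" where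
  "cl \<equiv> preproj_class Q"

lemma ring_Pi: "ring Pi"
  unfolding preproj_algebra_def by (rule ideal.quotient_is_ring[OF ideal_I])

lemma cl_hom: "cl \<in> ring_hom (path_algebra G) Pi"
  using ideal.rcos_ring_hom[OF ideal_I] unfolding preproj_algebra_def preproj_class_def[abs_def] .

lemma cl_closed: "f \<in> F \<Longrightarrow> cl f \<in> carrier Pi"
  using ring_hom_closed[OF cl_hom] by simp

lemma cl_add: "f \<in> F \<Longrightarrow> g \<in> F \<Longrightarrow> cl (f + g) = cl f \<oplus>\<^bsub>Pi\<^esub> cl g"
  using ring_hom_add[OF cl_hom] by simp

lemma cl_mult: "f \<in> F \<Longrightarrow> g \<in> F \<Longrightarrow> cl (f \<star> g) = cl f \<otimes>\<^bsub>Pi\<^esub> cl g"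
  using ring_hom_mult[OF cl_hom] by simp

lemma cl_one: "cl path_one = \<one>\<^bsub>Pi\<^esub>"
  using ring_hom_one[OF cl_hom] by simp

lemma carrier_Pi: "carrier Pi = cl ` F"
  unfolding preproj_algebra_def preproj_class_def FactRing_def A_RCOSETS_def' by auto

lemma cl_eq: "cl f = (\<lambda>h. h + f) ` I"
  unfolding preproj_class_def a_r_coset_def' by auto

lemma cl_eq_iff: "cl f = cl g \<longleftrightarrow> f - g \<in> I"
proof
  assume "cl f = cl g"
  moreover have "f \<in> cl f" unfolding cl_eq using FS.subspace_0[OF subspace_I] by (metis add_0 image_eqI)
  ultimately obtain h where "h \<in> I" "f = h + g" unfolding cl_eq by auto
  then show "f - g \<in> I" by simp
next
  have sub: "cl f \<subseteq> cl g" if "f - g \<in> I" for f g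
  proof
    fix x assume "x \<in> cl f"
    then obtain h where "h \<in> I" "x = h + f" unfolding cl_eq by auto
    then have "h + (f - g) \<in> I" "x = (h + (f - g)) + g"
      using FS.subspace_add[OF subspace_I _ that] by simp_all
    then show "x \<in> cl g" unfolding cl_eq by blast
  qed
  assume "f - g \<in> I"
  moreover from this have "g - f \<in> I" using FS.subspace_neg[OF subspace_I] by fastforce
  ultimately show "cl f = cl g" using sub by blast
qed

lemma cl_zero: "cl 0 = \<zero>\<^bsub>Pi\<^esub>"
  by (simp add: preproj_algebra_def FactRing_def cl_eq)

lemma preproj_scalar_eq: "preproj_scalar Q c = cl (c *\<^sub>F path_one)"
proof -
  have "path_scalar G c = c *\<^sub>F path_one" unfolding path_scalar_def by (simp add: fun_scale_def)
  then show ?thesis unfolding preproj_scalar_def by simp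
qed

lemma preproj_scalar_mult: "f \<in> F \<Longrightarrow> preproj_scalar Q c \<otimes>\<^bsub>Pi\<^esub> cl f = cl (c *\<^sub>F f)"
  using cl_mult[of "c *\<^sub>F path_one" f] by (simp add: preproj_scalar_eq scale_F one_F)

lemma comp_0_one: "comp 0 i i path_one = basis (i, [], i)"
  by (auto simp: comp_def path_one_def basis_def fun_eq_iff)

lemma basis_nonzero: "basis q \<noteq> (0 :: ('v, 'a darrow) path \<Rightarrow> 'k)"
proof
  assume "basis q = (0 :: ('v, 'a darrow) path \<Rightarrow> 'k)"
  from fun_cong[OF this, of q] show False by (simp add: basis_def pointwise)
qed

lemma one_notin_I: "path_one \<notin> I"
proof
  assume one: "path_one \<in> I"
  have "basis (i, [], i) \<in> I" for i using comp_I[OF one, of 0 i i] unfolding comp_0_one .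
  then show False
    using I_low_degree[of 0] basis_Fn[of _ "[]"] basis_nonzero by fastforce
qed

lemma subfield_scalars: "subfield (range (preproj_scalar Q)) Pi"
proof (rule ring.subfield_range[OF ring_Pi])
  show "preproj_scalar Q c \<in> carrier Pi" for c
    unfolding preproj_scalar_eq by (intro cl_closed scale_F one_F)
  show "preproj_scalar Q 1 = \<one>\<^bsub>Pi\<^esub>" by (simp add: preproj_scalar_eq cl_one)
  show "\<one>\<^bsub>Pi\<^esub> \<noteq> \<zero>\<^bsub>Pi\<^esub>"
    using one_notin_I cl_eq_iff[of path_one 0] by (simp add: cl_one cl_zero)
  show "preproj_scalar Q (c + d) = preproj_scalar Q c \<oplus>\<^bsub>Pi\<^esub> preproj_scalar Q d" for c d
    by (simp add: preproj_scalar_eq cl_add[symmetric] scale_F one_F FS.scale_left_distrib)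
  show "preproj_scalar Q (c * d) = preproj_scalar Q c \<otimes>\<^bsub>Pi\<^esub> preproj_scalar Q d" for c d
    using preproj_scalar_mult[of "d *\<^sub>F path_one" c] by (simp add: preproj_scalar_eq scale_F one_F)
qed

lemma preproj_degree_component:
  "{preproj_idem Q i \<otimes>\<^bsub>Pi\<^esub> x \<otimes>\<^bsub>Pi\<^esub> preproj_idem Q j | x. x \<in> preproj_degree Q n} = cl ` Fn n i j"
proof (intro Set.set_eqI iffI)
  have e: "basis (k, [], k) \<in> F" for k by (intro basis_F) simp
  have m: "preproj_idem Q i \<otimes>\<^bsub>Pi\<^esub> cl f \<otimes>\<^bsub>Pi\<^esub> preproj_idem Q j =
      cl (basis (i, [], i) \<star> f \<star> basis (j, [], j))" if "f \<in> F" for f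
    unfolding preproj_idem_def using that e by (simp add: cl_mult mult_F)
  {
    fix y assume "y \<in> {preproj_idem Q i \<otimes>\<^bsub>Pi\<^esub> x \<otimes>\<^bsub>Pi\<^esub> preproj_idem Q j | x. x \<in> preproj_degree Q n}"
    then obtain f where f: "y = preproj_idem Q i \<otimes>\<^bsub>Pi\<^esub> cl f \<otimes>\<^bsub>Pi\<^esub> preproj_idem Q j"
      "f \<in> path_degree G n" unfolding preproj_degree_def by auto
    then have fF: "f \<in> F" "\<And>u p v. f (u, p, v) \<noteq> 0 \<Longrightarrow> length p = n"
      unfolding path_degree_def by auto
    have "basis (i, [], i) \<star> f \<star> basis (j, [], j) = comp n i j f"
      by (rule basis_mult_mult_basis) (rule fF(2))
    then show "y \<in> cl ` Fn n i j"
      unfolding f(1) m[OF fF(1)] using comp_in_Fn[OF fF(1)] by auto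
  }
  {
    fix y assume "y \<in> cl ` Fn n i j"
    then obtain f where f: "y = cl f" "f \<in> Fn n i j" by auto
    then have fF: "f \<in> F" using Fn_subset_F by blast
    have "f \<in> path_degree G n" using f(2) fF unfolding path_degree_def Fn_def by blast
    moreover have "y = preproj_idem Q i \<otimes>\<^bsub>Pi\<^esub> cl f \<otimes>\<^bsub>Pi\<^esub> preproj_idem Q j"
      unfolding m[OF fF] f(1) using f(2) by (simp add: idem_mult_Fn)
    ultimately show "y \<in> {preproj_idem Q i \<otimes>\<^bsub>Pi\<^esub> x \<otimes>\<^bsub>Pi\<^esub> preproj_idem Q j | x. x \<in> preproj_degree Q n}"
      unfolding preproj_degree_def by blast
  }
qed

lemma ring_dim_component: "int (ring.dim Pi (range (preproj_scalar Q)) (cl ` Fn n i j)) = dim_Pi n i j"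
  unfolding dim_Pi_def In_def
proof (rule FS.dim_linear_image_ring[OF ring_Pi subfield_scalars subspace_Fn finite_dim_Fn subspace_I])
  fix x y c assume x: "x \<in> Fn n i j"
  then have xF: "x \<in> F" using Fn_subset_F by blast
  show "cl x \<in> carrier Pi" by (rule cl_closed[OF xF])
  show "cl (c *\<^sub>F x) = preproj_scalar Q c \<otimes>\<^bsub>Pi\<^esub> cl x" by (rule preproj_scalar_mult[OF xF, symmetric])
  assume y: "y \<in> Fn n i j"
  then have yF: "y \<in> F" using Fn_subset_F by blast
  show "cl (x + y) = cl x \<oplus>\<^bsub>Pi\<^esub> cl y" by (rule cl_add[OF xF yF])
  show "cl x = cl y \<longleftrightarrow> x - y \<in> I" by (rule cl_eq_iff)
qed

text \<open>\<open>dim_Pi\<close> is a difference of integers; its sign, on which the Chebyshev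
  argument rests, comes from its meaning as a dimension in the quotient.\<close>

lemma dim_Pi_nonneg: "dim_Pi n i j \<ge> 0"
  unfolding ring_dim_component[symmetric] by simp

lemma hilbert_series_nth:
  "fps_nth (hilbert_series K Q) n = Sqmat (\<chi> i j. dim_Pi n i j)"
  unfolding hilbert_series_def dim_matrix_def preproj_degree_component
  by (simp add: ring_dim_component)


section \<open>Degree-zero coefficients and their action on the socle\<close>

abbreviation idem :: "'v \<Rightarrow> ('v, 'a darrow) path \<Rightarrow> 'k" where
  "idem j \<equiv> basis (j, [], j)"

text \<open>On \<open>F\<close> this is the character of the simple module at \<open>u\<close>. It
  is multiplicative and vanishes on \<open>I\<close>, so it detects idempotents of the quotient by
  their degree-zero parts.\<close>

definition vertex_coeff :: "(('v, 'a darrow) path \<Rightarrow> 'k) \<Rightarrow> 'v \<Rightarrow> 'k" where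
  "vertex_coeff f u = f (u, [], u)"

lemma idem_F: "idem j \<in> F"
  by (intro basis_F) simp

lemma vertex_coeff_add: "vertex_coeff (f + g) u = vertex_coeff f u + vertex_coeff g u"
  by (simp add: vertex_coeff_def pointwise)

lemma vertex_coeff_scale: "vertex_coeff (c *\<^sub>F f) u = c * vertex_coeff f u"
  by (simp add: vertex_coeff_def pointwise)

lemma vertex_coeff_diff: "vertex_coeff (f - g) u = vertex_coeff f u - vertex_coeff g u"
  by (simp add: vertex_coeff_def pointwise)

lemma vertex_coeff_zero [simp]: "vertex_coeff 0 u = 0"
  by (simp add: vertex_coeff_def pointwise)

lemma vertex_coeff_basis: "vertex_coeff (basis (i, p, j)) u = (if p = [] \<and> i = u \<and> j = u then 1 else 0)"
  by (auto simp: vertex_coeff_def basis_def)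

lemma vertex_coeff_mult:
  assumes "f \<in> F"
  shows "vertex_coeff (f \<star> g) u = vertex_coeff f u * vertex_coeff g u"
proof -
  have "f (u, [], v) = 0" if "v \<noteq> u" for v
    using assms that unfolding F_iff by (metis path_Nil)
  then have "(\<Sum>v\<in>UNIV. f (u, [], v) * g (v, [], u)) = (\<Sum>v\<in>UNIV. if v = u then f (u, [], u) * g (u, [], u) else 0)"
    by (intro sum.cong) auto
  then show ?thesis unfolding vertex_coeff_def path_mult_apply by simp
qed

lemma vertex_coeff_I:
  assumes "x \<in> I"
  shows "vertex_coeff x u = 0"
proof -
  have "comp 0 u u x \<in> Fn 0 u u" using assms I_subset_F comp_in_Fn by blast
  then have "comp 0 u u x = 0" using I_low_degree[OF _ comp_I[OF assms], of 0] by (simp only: zero_less_numeral)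
  from fun_cong[OF this, of "(u, [], u)"] show ?thesis
    by (simp add: comp_def vertex_coeff_def pointwise)
qed

text \<open>Modulo \<open>I\<close>, every path of positive length kills \<open>z\<close>, either by
  its first arrow or because it does not start at \<open>j\<close>; so \<open>y\<close> acts on
  \<open>z\<close> through its constant term at \<open>j\<close>.\<close>

lemma Kn_mult:
  assumes z: "z \<in> Kn n i j" and y: "y \<in> F"
  shows "z \<star> y - vertex_coeff y j *\<^sub>F z \<in> I"
  using y
proof (induction rule: F_induct)
  case (basis q)
  obtain u p w where q: "q = (u, p, w)" by (cases q) auto
  have zF: "z \<in> Fn n i j" using z by (simp add: Kn_def)
  show ?case
  proof (cases p)
    case Nil
    then have "u = w" using basis q by simp
    then show ?thesis
      unfolding q Nil \<open>u = w\<close> vertex_coeff_basis idem_mult_Fn(2)[OF zF]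
      using FS.subspace_0[OF subspace_I] by auto
  next
    case (Cons b p')
    then have b: "b \<in> arcs G" "tail G b = u" "(head G b, p', w) \<in> paths G" using basis q by auto
    have e: "basis q = arr b \<star> basis (head G b, p', w)"
      unfolding q Cons arr_def using b(2) by (simp add: basis_mult_basis)
    have "z \<star> arr b \<in> I"
    proof (cases "u = j")
      case True
      then show ?thesis using z b unfolding Kn_def by simp
    next
      case False
      have "z \<star> arr b = z \<star> (idem j \<star> arr b)"
        using idem_mult_Fn(2)[OF zF, of j] by (simp add: path_mult_assoc[symmetric])
      also have "\<dots> = 0" unfolding arr_def basis_mult_basis using b(2) False by simp
      finally show ?thesis using FS.subspace_0[OF subspace_I] by simp
    qed
    then have "z \<star> basis q \<in> I"
      unfolding e path_mult_assoc[symmetric] by (rule mult_I(2)[OF basis_F[OF b(3)]])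
    then show ?thesis unfolding q vertex_coeff_basis Cons by simp
  qed
next
  case zero
  show ?case using FS.subspace_0[OF subspace_I] by simp
next
  case (add f g)
  have "z \<star> (f + g) - vertex_coeff (f + g) j *\<^sub>F z =
      (z \<star> f - vertex_coeff f j *\<^sub>F z) + (z \<star> g - vertex_coeff g j *\<^sub>F z)"
    by (simp add: path_mult_distrib_left vertex_coeff_add FS.scale_left_distrib algebra_simps)
  then show ?case using FS.subspace_add[OF subspace_I add] by simp
next
  case (scale c f)
  have "z \<star> (c *\<^sub>F f) - vertex_coeff (c *\<^sub>F f) j *\<^sub>F z = c *\<^sub>F (z \<star> f - vertex_coeff f j *\<^sub>F z)"
    by (simp add: vertex_coeff_scale FS.scale_right_diff_distrib)
  then show ?case using FS.subspace_scale[OF subspace_I scale] by simp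
qed

lemma comp_mult_arr:
  "comp n i (tail G b) x \<star> arr b = comp (Suc n) i (head G b) (x \<star> arr b)"
  unfolding arr_def by (auto simp: fun_eq_iff comp_def mult_basis_apply)

end


section \<open>Frobenius forms and the socle\<close>

text \<open>
  In the intended instance, \<open>form x\<close> is \<open>\<phi>(1)(x)\<close> and \<open>twist j\<close> is a lift of \<open>\<nu>(e\<^sub>j)\<close> to the path algebra.
\<close>

locale frobenius_quiver = preprojective_quiver Q K
  for Q :: "('v::finite, 'a) pre_digraph" and K :: "'k::field itself" +
  fixes form :: "(('v, 'a darrow) path \<Rightarrow> 'k) \<Rightarrow> 'k"
    and twist :: "'v \<Rightarrow> ('v, 'a darrow) path \<Rightarrow> 'k"
    and \<sigma> :: "'v \<Rightarrow> 'v"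
  assumes form_add: "f \<in> F \<Longrightarrow> g \<in> F \<Longrightarrow> form (f + g) = form f + form g"
    and form_scale: "f \<in> F \<Longrightarrow> form (c *\<^sub>F f) = c * form f"
    and form_I: "f \<in> I \<Longrightarrow> form f = 0"
    and nondegenerate: "f \<in> F \<Longrightarrow> (\<And>g. g \<in> F \<Longrightarrow> form (f \<star> g) = 0) \<Longrightarrow> f \<in> I"
    and represents: "\<exists>f\<in>F. \<forall>g\<in>F. form (f \<star> g) = vertex_coeff g j"
    and twist_F: "twist j \<in> F"
    and form_twist: "f \<in> F \<Longrightarrow> form (f \<star> idem j) = form (twist j \<star> f)"
    and vertex_coeff_twist: "vertex_coeff (twist j) u = (if u = \<sigma> j then 1 else 0)"
begin

lemma form_diff: "f \<in> F \<Longrightarrow> g \<in> F \<Longrightarrow> form (f - g) = form f - form g"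
  using form_add[of "f - g" g] diff_F[of f g] by simp

lemma form_cong:
  assumes "f \<in> F" "g \<in> F" "f - g \<in> I"
  shows "form f = form g"
  using form_diff[OF assms(1,2)] form_I[OF assms(3)] by simp

lemma form_zero: "form 0 = 0"
  using form_I FS.subspace_0[OF subspace_I] by blast

lemma form_sum: "(\<And>a. a \<in> A \<Longrightarrow> f a \<in> F) \<Longrightarrow> form (\<Sum>a\<in>A. f a) = (\<Sum>a\<in>A. form (f a))"
  by (induction A rule: infinite_finite_induct) (simp_all add: form_add sum_F form_zero)

lemma Kn_F: "z \<in> Kn n i j \<Longrightarrow> z \<in> F"
  using Fn_subset_F by (auto simp: Kn_def)

lemma form_Kn_mult:
  assumes z: "z \<in> Kn n i j" and y: "y \<in> F"
  shows "form (z \<star> y) = vertex_coeff y j * form z"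
  using form_cong[OF mult_F[OF Kn_F[OF z] y] scale_F[OF Kn_F[OF z]] Kn_mult[OF z y]]
    form_scale[OF Kn_F[OF z]] by simp

text \<open>By \<open>form_Kn_mult\<close>, the form vanishes on all right multiples of this
  combination, so nondegeneracy applies. As the degrees and left vertices are arbitrary, this is the
  one-dimensionality of the whole of \<open>S e_j\<close>.\<close>

lemma form_combination_I:
  assumes z: "z \<in> Kn n i j" and z': "z' \<in> Kn n' i' j"
  shows "form z *\<^sub>F z' - form z' *\<^sub>F z \<in> I"
proof (rule nondegenerate)
  have F: "z \<in> F" "z' \<in> F" using z z' Kn_F by blast+
  then show "form z *\<^sub>F z' - form z' *\<^sub>F z \<in> F" by (intro diff_F scale_F)
  fix y assume y: "y \<in> F"
  have zy: "z \<star> y \<in> F" "z' \<star> y \<in> F" using F y mult_F by blast+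
  then show "form ((form z *\<^sub>F z' - form z' *\<^sub>F z) \<star> y) = 0"
    using form_Kn_mult[OF z y] form_Kn_mult[OF z' y]
    by (simp add: path_mult_diff form_diff form_scale scale_F)
qed

lemma socle_generator:
  obtains n i z where "z \<in> Kn n i j" "form z \<noteq> 0"
proof -
  obtain x where x: "x \<in> F" "\<And>g. g \<in> F \<Longrightarrow> form (x \<star> g) = vertex_coeff g j"
    using represents by blast
  \<comment> \<open>Multiplying by \<open>idem j\<close> does not change the functional represented
    by \<open>x\<close> and makes \<open>x'\<close> end at \<open>j\<close>. Its products with
    arrows represent zero, because an arrow has no degree-zero part; hence \<open>x'\<close> is a
    socle element.\<close>
  define x' where "x' = x \<star> idem j"
  have x'F: "x' \<in> F" unfolding x'_def by (intro mult_F x idem_F)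
  have x': "form (x' \<star> g) = vertex_coeff g j" if "g \<in> F" for g
    unfolding x'_def path_mult_assoc using x(2)[OF mult_F[OF idem_F that]]
    by (simp add: vertex_coeff_mult[OF idem_F] vertex_coeff_basis)
  have arrI: "x' \<star> arr b \<in> I" if "b \<in> arcs G" for b
  proof (rule nondegenerate)
    show "x' \<star> arr b \<in> F" by (intro mult_F x'F arr_F that)
    fix g assume "g \<in> F"
    then show "form (x' \<star> arr b \<star> g) = 0"
      unfolding path_mult_assoc using x'[OF mult_F[OF arr_F[OF that]]]
      by (simp add: vertex_coeff_mult[OF arr_F[OF that]]) (simp add: arr_def vertex_coeff_basis)
  qed
  \<comment> \<open>The form need not be homogeneous, and neither need \<open>x'\<close>. As
    \<open>form x' = 1\<close>, some homogeneous component has nonzero form, and this component is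
    again in the socle because \<open>I\<close> is graded.\<close>
  obtain N where N: "x' = (\<Sum>n<N. \<Sum>i\<in>UNIV. \<Sum>k\<in>UNIV. comp n i k x')"
    using F_eq_sum_comp[OF x'F] .
  have cF: "comp n i k x' \<in> F" for n i k using comp_in_Fn[OF x'F] Fn_subset_F by blast
  have "vertex_coeff path_one j = (1 :: 'k)" by (simp add: vertex_coeff_def path_one_def)
  then have "form x' = 1" using x'[OF one_F] by simp
  moreover have "form x' = (\<Sum>n<N. \<Sum>i\<in>UNIV. \<Sum>k\<in>UNIV. form (comp n i k x'))"
    by (subst N) (simp add: form_sum sum_F cF)
  ultimately have "(\<Sum>n<N. \<Sum>i\<in>UNIV. \<Sum>k\<in>UNIV. form (comp n i k x')) \<noteq> 0" by simp
  then obtain n i k where nz: "form (comp n i k x') \<noteq> 0"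
    by (meson sum.not_neutral_contains_not_neutral)
  have "k = j"
  proof (rule ccontr)
    assume "k \<noteq> j"
    then have "comp n i k x' = 0"
      unfolding x'_def by (auto simp: comp_def fun_eq_iff mult_basis_apply pointwise)
    then show False using nz form_zero by simp
  qed
  have "comp n i j x' \<in> Kn n i j"
    unfolding Kn_def
  proof (intro CollectI conjI ballI impI)
    show "comp n i j x' \<in> Fn n i j" by (rule comp_in_Fn[OF x'F])
    fix b assume b: "b \<in> arcs G" "tail G b = j"
    show "comp n i j x' \<star> arr b \<in> I"
      using comp_mult_arr[of n i b x'] comp_I[OF arrI[OF b(1)]] b(2) by simp
  qed
  then show thesis using that nz \<open>k = j\<close> by blast
qed

lemma Kn_left_mult:
  assumes z: "z \<in> Kn n i j" and p: "(u, p, i) \<in> paths G"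
  shows "basis (u, p, i) \<star> z \<in> Kn (length p + n) u j"
  using z mult_Fn[OF basis_Fn[OF p], of z n j] mult_I(1)[OF basis_F[OF p]]
  unfolding Kn_def by (simp add: path_mult_assoc)

text \<open>The combination of the previous lemmas has its two terms in different homogeneous
  components, and \<open>I\<close> contains each component of its elements; so a multiple of
  \<open>z'\<close> by a nonzero scalar lies in \<open>I\<close>.\<close>

lemma Kn_other_subset_I:
  assumes z: "z \<in> Kn n i j" "form z \<noteq> 0" and z': "z' \<in> Kn n' i' j" and ne: "(n', i') \<noteq> (n, i)"
  shows "z' \<in> I"
proof -
  have Fn: "z \<in> Fn n i j" "z' \<in> Fn n' i' j" using z z' by (auto simp: Kn_def)
  have "comp n' i' j (form z *\<^sub>F z' + (- form z') *\<^sub>F z) \<in> I"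
    using comp_I[OF form_combination_I[OF z(1) z']] by simp
  then have "form z *\<^sub>F z' \<in> I"
    unfolding comp_add comp_scale comp_Fn[OF Fn(1)] comp_Fn[OF Fn(2)] using ne by auto
  from FS.subspace_scale[OF subspace_I this, of "inverse (form z)"] show ?thesis
    using z(2) by simp
qed

text \<open>
  A nontrivial path \<open>f\<close> maps \<open>z\<close> into the socle in a higher degree, where the previous lemma leaves only \<open>I\<close>.
\<close>

lemma form_left_mult:
  assumes z: "z \<in> Kn n i j" "form z \<noteq> 0" and f: "f \<in> F"
  shows "form (f \<star> z) = vertex_coeff f i * form z"
proof -
  \<comment> \<open>Membership in \<open>F\<close> is carried along because \<open>F_induct\<close>
    does not supply it for the summands.\<close>
  have "f \<in> F \<and> form (f \<star> z) = vertex_coeff f i * form z"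
    using f
  proof (induction rule: F_induct)
    case (basis q)
    obtain u p w where q: "q = (u, p, w)" by (cases q) auto
    have zF: "z \<in> Fn n i j" using z by (simp add: Kn_def)
    have "form (basis q \<star> z) = vertex_coeff (basis q) i * form z"
    proof (cases "w = i")
      case False
      have "basis q \<star> z = basis q \<star> (idem i \<star> z)" using idem_mult_Fn(1)[OF zF, of i] by simp
      also have "\<dots> = 0" unfolding path_mult_assoc[symmetric] q basis_mult_basis using False by simp
      finally show ?thesis using False by (simp add: form_zero q vertex_coeff_basis)
    next
      case True
      then have p: "(u, p, i) \<in> paths G" using basis q by simp
      show ?thesis
      proof (cases p)
        case Nil
        then show ?thesis using p True idem_mult_Fn(1)[OF zF, of i] by (simp add: q vertex_coeff_basis)
      next
        case (Cons b p')
        then have "basis (u, p, i) \<star> z \<in> I"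
          by (intro Kn_other_subset_I[OF z Kn_left_mult[OF z(1) p]]) simp
        then show ?thesis using form_I True Cons by (simp add: q vertex_coeff_basis)
      qed
    qed
    then show ?case using basis_F[OF basis] by simp
  next
    case zero
    show ?case by (simp add: form_zero)
  next
    case (add f g)
    then show ?case
      by (simp add: path_mult_distrib_right form_add mult_F Kn_F[OF z(1)] vertex_coeff_add distrib_right add_F)
  next
    case (scale c f)
    then show ?case
      by (simp add: form_scale mult_F Kn_F[OF z(1)] vertex_coeff_scale mult.assoc scale_F)
  qed
  then show ?thesis ..
qed

lemma dim_socle:
  obtains m where "\<And>n i. dim_soc n i j = (if i = \<sigma> j \<and> n = m then 1 else 0)"
proof -
  obtain n i z where z: "z \<in> Kn n i j" "form z \<noteq> 0" by (rule socle_generator)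
  have zF: "z \<in> Fn n i j" using z by (simp add: Kn_def)
  \<comment> \<open>The Nakayama automorphism locates \<open>i\<close>: moving \<open>idem j\<close>
    to the left turns it into \<open>twist j\<close>, whose only nonzero vertex coefficient is at
    \<open>\<sigma> j\<close>, and \<open>form z\<close> survives only if this vertex is
    \<open>i\<close>.\<close>
  have "form z = form (z \<star> idem j)" using idem_mult_Fn(2)[OF zF, of j] by simp
  also have "\<dots> = form (twist j \<star> z)" by (rule form_twist[OF Kn_F[OF z(1)]])
  also have "\<dots> = vertex_coeff (twist j) i * form z" by (rule form_left_mult[OF z twist_F])
  finally have i: "i = \<sigma> j" using z(2) by (auto simp: vertex_coeff_twist split: if_splits)
  have "z \<notin> I" using z(2) form_I by blast
  have other: "dim_soc n' i' j = 0" if "(n', i') \<noteq> (n, i)" for n' i'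
  proof -
    have "Kn n' i' j = In n' i' j"
      using Kn_other_subset_I[OF z _ that] In_subset_Kn[of n' i' j] by (auto simp: In_def Kn_def)
    then show ?thesis by (simp add: dim_soc_def)
  qed
  have "Kn n i j = FS.span (insert z (In n i j))"
  proof
    show "FS.span (insert z (In n i j)) \<subseteq> Kn n i j"
      using z(1) In_subset_Kn by (intro FS.span_minimal subspace_Kn) auto
    show "Kn n i j \<subseteq> FS.span (insert z (In n i j))"
    proof
      fix z' assume z': "z' \<in> Kn n i j"
      define y where "y = form z *\<^sub>F z' - form z' *\<^sub>F z"
      have "y \<in> In n i j"
        using form_combination_I[OF z(1) z'] zF z' FS.subspace_diff[OF subspace_Fn]
          FS.subspace_scale[OF subspace_Fn] unfolding In_def y_def by (simp add: Kn_def)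
      then have "inverse (form z) *\<^sub>F y + (form z' / form z) *\<^sub>F z \<in> FS.span (insert z (In n i j))"
        by (intro FS.span_add FS.span_scale FS.span_base) auto
      moreover have "inverse (form z) *\<^sub>F y + (form z' / form z) *\<^sub>F z = z'"
        unfolding y_def using z(2) by (simp add: FS.scale_right_diff_distrib divide_inverse mult.commute)
      ultimately show "z' \<in> FS.span (insert z (In n i j))" by simp
    qed
  qed
  moreover have "z \<notin> In n i j" using \<open>z \<notin> I\<close> by (simp add: In_def)
  ultimately have "FS.dim (Kn n i j) = Suc (FS.dim (In n i j))"
    using FS.dim_insert_notin[OF subspace_In finite_dim_In] by simp
  then have "dim_soc n i j = 1" by (simp add: dim_soc_def)
  then show thesis using other i by (intro that[of n]) auto
qed

end

text \<open>The bimodule map is determined by \<open>\<phi>\<close> at one: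
  \<open>\<phi> x y\<close> is the form of \<open>x y\<close>, and \<open>\<phi> (\<nu> a) y\<close>
  is the form of \<open>y a\<close>. Injectivity of \<open>\<phi>\<close> gives
  \<open>nondegenerate\<close>, surjectivity gives \<open>represents\<close>, and comparing both
  formulas gives \<open>form_twist\<close>.\<close>

lemma (in preprojective_quiver) frobenius_quiver_exists:
  assumes "nakayama_automorphism Q (\<nu> :: ('v, 'a, 'k) preproj \<Rightarrow> ('v, 'a, 'k) preproj)"
    and "nakayama_permutation Q \<nu> \<sigma>"
  shows "inj \<sigma>" and "\<exists>(form :: _ \<Rightarrow> 'k) twist. frobenius_quiver Q form twist \<sigma>"
proof -
  interpret Pi: ring Pi by (rule ring_Pi)
  have hom: "\<nu> \<in> ring_hom Pi Pi"
    using assms(1) unfolding nakayama_automorphism_def Let_def ring_iso_def by blast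
  obtain \<phi> where bij: "bij_betw \<phi> (carrier Pi) (preproj_dual Q)"
    and twisted: "\<And>a x b y. a \<in> carrier Pi \<Longrightarrow> x \<in> carrier Pi \<Longrightarrow> b \<in> carrier Pi \<Longrightarrow> y \<in> carrier Pi \<Longrightarrow>
      \<phi> (\<nu> a \<otimes>\<^bsub>Pi\<^esub> x \<otimes>\<^bsub>Pi\<^esub> b) y = \<phi> x (b \<otimes>\<^bsub>Pi\<^esub> y \<otimes>\<^bsub>Pi\<^esub> a)"
    using assms(1) unfolding nakayama_automorphism_def Let_def by blast
  have \<nu>_closed: "\<nu> a \<in> carrier Pi" if "a \<in> carrier Pi" for a
    using ring_hom_closed[OF hom that] .
  define form where "form f = \<phi> \<one>\<^bsub>Pi\<^esub> (cl f)" for f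
  have dual: "\<phi> x \<in> preproj_dual Q" if "x \<in> carrier Pi" for x
    using bij that unfolding bij_betw_def by blast
  have one_dual: "\<phi> \<one>\<^bsub>Pi\<^esub> \<in> preproj_dual Q" by (rule dual) simp
  have form_add: "form (f + g) = form f + form g" if "f \<in> F" "g \<in> F" for f g
    using one_dual that unfolding form_def preproj_dual_def by (simp add: cl_add cl_closed)
  have form_scale: "form (c *\<^sub>F f) = c * form f" if "f \<in> F" for c f
    using one_dual that unfolding form_def preproj_dual_def
    by (simp add: preproj_scalar_mult[symmetric] cl_closed)
  have form_I: "form f = 0" if "f \<in> I" for f
  proof -
    have "cl f = cl 0" using that by (simp add: cl_eq_iff)
    then have "form f = form (0 *\<^sub>F 0)" by (simp add: form_def)
    also have "\<dots> = 0" by (subst form_scale) simp_all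
    finally show ?thesis .
  qed
  have right: "\<phi> (cl f) (cl g) = form (f \<star> g)" if "f \<in> F" "g \<in> F" for f g
    using twisted[of "\<one>\<^bsub>Pi\<^esub>" "\<one>\<^bsub>Pi\<^esub>" "cl f" "cl g"] that ring_hom_one[OF hom]
    by (simp add: cl_closed form_def cl_mult)
  have left: "\<phi> (\<nu> (cl f)) (cl g) = form (g \<star> f)" if "f \<in> F" "g \<in> F" for f g
    using twisted[of "cl f" "\<one>\<^bsub>Pi\<^esub>" "\<one>\<^bsub>Pi\<^esub>" "cl g"] that \<nu>_closed[OF cl_closed[OF that(1)]]
    by (simp add: cl_closed form_def cl_mult)
  have nondeg: "f \<in> I" if f: "f \<in> F" and "\<And>g. g \<in> F \<Longrightarrow> form (f \<star> g) = 0" for f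
  proof -
    have "\<phi> (cl f) y = \<phi> (cl 0) y" if y: "y \<in> carrier Pi" for y
    proof -
      obtain g where g: "g \<in> F" "y = cl g" using y unfolding carrier_Pi by blast
      show ?thesis
        unfolding g(2) right[OF f g(1)] right[OF zero_F g(1)]
        using \<open>\<And>g. g \<in> F \<Longrightarrow> form (f \<star> g) = 0\<close>[OF g(1)] form_I[OF FS.subspace_0[OF subspace_I]] by simp
    qed
    then have "\<phi> (cl f) = \<phi> (cl 0)"
      using dual[OF cl_closed[OF f]] dual[OF cl_closed[OF zero_F]] unfolding preproj_dual_def
      by (intro extensionalityI[of _ "carrier Pi"]) auto
    then have "cl f = cl 0"
      using bij cl_closed[OF f] cl_closed[OF zero_F] unfolding bij_betw_def inj_on_def by blast
    then show "f \<in> I" by (simp add: cl_eq_iff)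
  qed
  have represents: "\<exists>f\<in>F. \<forall>g\<in>F. form (f \<star> g) = vertex_coeff g j" for j
  proof -
    \<comment> \<open>The vertex coefficient descended to the quotient. The chosen lift does not
      matter, since \<open>vertex_coeff\<close> vanishes on \<open>I\<close>; the value
      \<open>undefined\<close> outside the carrier makes the functional extensional, as
      \<open>preproj_dual\<close> requires.\<close>
    define h where "h = (\<lambda>z. if z \<in> carrier Pi then vertex_coeff (SOME f. f \<in> F \<and> cl f = z) j else undefined)"
    have h: "h (cl f) = vertex_coeff f j" if "f \<in> F" for f
    proof -
      define f' where "f' = (SOME f'. f' \<in> F \<and> cl f' = cl f)"
      have "f' \<in> F \<and> cl f' = cl f" unfolding f'_def by (rule someI[of _ f]) (simp add: that)
      then have "vertex_coeff (f' - f) j = 0" using cl_eq_iff vertex_coeff_I by blast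
      then show ?thesis using cl_closed[OF that] unfolding h_def f'_def by (simp add: vertex_coeff_diff)
    qed
    have "h \<in> preproj_dual Q"
      unfolding preproj_dual_def
    proof (intro CollectI conjI ballI allI)
      show "h \<in> extensional (carrier Pi)" by (simp add: h_def extensional_def)
    next
      fix x y assume "x \<in> carrier Pi" "y \<in> carrier Pi"
      then obtain f g where "x = cl f" "f \<in> F" "y = cl g" "g \<in> F" unfolding carrier_Pi by blast
      then show "h (x \<oplus>\<^bsub>Pi\<^esub> y) = h x + h y"
        using h add_F by (simp add: cl_add[symmetric] vertex_coeff_add)
    next
      fix c x assume "x \<in> carrier Pi"
      then obtain f where "x = cl f" "f \<in> F" unfolding carrier_Pi by blast
      then show "h (preproj_scalar Q c \<otimes>\<^bsub>Pi\<^esub> x) = c * h x"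
        using h scale_F by (simp add: preproj_scalar_mult vertex_coeff_scale)
    qed
    then obtain x where "x \<in> carrier Pi" "h = \<phi> x" using bij unfolding bij_betw_def by blast
    then obtain f where f: "f \<in> F" "h = \<phi> (cl f)" unfolding carrier_Pi by blast
    then show ?thesis using h right by metis
  qed
  have e_closed: "cl (idem j) \<in> carrier Pi" for j using cl_closed[OF idem_F] .
  have e_idem: "cl (idem j) \<otimes>\<^bsub>Pi\<^esub> cl (idem j) = cl (idem j)" for j
    by (simp add: cl_mult[symmetric] idem_F basis_mult_basis)
  have "\<exists>n\<in>F. cl n = \<nu> (cl (idem j)) \<and> (\<forall>u. vertex_coeff n u = (if u = \<sigma> j then 1 else 0))" for j
  proof -
    define a where "a = \<nu> (cl (idem j))"
    define e where "e = cl (idem (\<sigma> j))"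
    have a: "a \<in> carrier Pi" "a \<otimes>\<^bsub>Pi\<^esub> a = a"
      unfolding a_def using \<nu>_closed[OF e_closed] ring_hom_mult[OF hom e_closed e_closed, of j j] e_idem[of j]
      by simp_all
    have e: "e \<in> carrier Pi" "e \<otimes>\<^bsub>Pi\<^esub> e = e"
      unfolding e_def using e_closed e_idem by simp_all
    have "left_ideals_isomorphic Pi (left_ideal_of Pi a) (left_ideal_of Pi e)"
      using assms(2) unfolding nakayama_permutation_def verts_Q preproj_idem_def a_def e_def by blast
    then obtain \<psi> where \<psi>: "bij_betw \<psi> (left_ideal_of Pi a) (left_ideal_of Pi e)"
      and "\<forall>b\<in>carrier Pi. \<forall>x\<in>left_ideal_of Pi a. \<psi> (b \<otimes>\<^bsub>Pi\<^esub> x) = b \<otimes>\<^bsub>Pi\<^esub> \<psi> x"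
      unfolding left_ideals_isomorphic_def by (elim exE conjE)
    then have \<psi>_mult: "\<psi> (b \<otimes>\<^bsub>Pi\<^esub> x) = b \<otimes>\<^bsub>Pi\<^esub> \<psi> x"
      if "b \<in> carrier Pi" "x \<in> left_ideal_of Pi a" for b x
      using that by simp
    have aM: "a \<in> left_ideal_of Pi a" unfolding left_ideal_of_def using a by force
    have eN: "e \<in> left_ideal_of Pi e" unfolding left_ideal_of_def using e by force
    obtain y' where y': "\<psi> a = y' \<otimes>\<^bsub>Pi\<^esub> e" "y' \<in> carrier Pi"
      using \<psi> aM unfolding bij_betw_def left_ideal_of_def by blast
    obtain z where z: "z \<in> left_ideal_of Pi a" "\<psi> z = e"
      using \<psi> eN unfolding bij_betw_def by (metis imageE)
    then obtain z' where z': "z = z' \<otimes>\<^bsub>Pi\<^esub> a" "z' \<in> carrier Pi" unfolding left_ideal_of_def by blast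
    \<comment> \<open>On \<open>left_ideal_of Pi a\<close> the isomorphism is right multiplication
      by \<open>y\<close>, and its inverse is right multiplication by \<open>z\<close>. This yields
      the usual equivalence of idempotents: \<open>y z = a\<close> and
      \<open>z y = e\<close>.\<close>
    define y where "y = \<psi> a"
    have yC: "y \<in> carrier Pi" unfolding y_def y' using y' e by simp
    have zC: "z \<in> carrier Pi" unfolding z' using z' a by simp
    have ye: "y \<otimes>\<^bsub>Pi\<^esub> e = y" unfolding y_def y'(1) using y'(2) e by (simp add: Pi.m_assoc)
    have ay: "a \<otimes>\<^bsub>Pi\<^esub> y = y" using \<psi>_mult[OF a(1) aM] a(2) unfolding y_def by simp
    have zy: "z \<otimes>\<^bsub>Pi\<^esub> y = e"
    proof -
      have "e = z' \<otimes>\<^bsub>Pi\<^esub> y" using z(2) \<psi>_mult[OF z'(2) aM] unfolding z'(1) y_def by simp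
      also have "\<dots> = z \<otimes>\<^bsub>Pi\<^esub> y" unfolding z'(1) using ay z'(2) a(1) yC by (simp add: Pi.m_assoc)
      finally show ?thesis ..
    qed
    have yz: "y \<otimes>\<^bsub>Pi\<^esub> z = a"
    proof -
      have "y \<otimes>\<^bsub>Pi\<^esub> z = (y \<otimes>\<^bsub>Pi\<^esub> z') \<otimes>\<^bsub>Pi\<^esub> a" unfolding z'(1) using z'(2) a(1) yC by (simp add: Pi.m_assoc)
      then have "y \<otimes>\<^bsub>Pi\<^esub> z \<in> left_ideal_of Pi a" unfolding left_ideal_of_def using yC z'(2) by blast
      moreover have "\<psi> (y \<otimes>\<^bsub>Pi\<^esub> z) = \<psi> a" using \<psi>_mult[OF yC z(1)] z(2) ye unfolding y_def by simp
      ultimately show ?thesis using \<psi> aM unfolding bij_betw_def inj_on_def by blast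
    qed
    txt \<open>As \<open>y z = \<nu>(e\<^sub>j)\<close> and \<open>z y\<close> is the idempotent at \<open>\<sigma> j\<close>, both have the same image in the
      commutative degree-zero part.\<close>
    obtain f g n where fg: "f \<in> F" "y = cl f" "g \<in> F" "z = cl g" "n \<in> F" "a = cl n"
      using yC zC a(1) unfolding carrier_Pi by blast
    have "cl (f \<star> g) = cl n" "cl (g \<star> f) = cl (idem (\<sigma> j))"
      using yz zy fg by (simp_all add: cl_mult e_def)
    then have "vertex_coeff (f \<star> g - n) u = 0" "vertex_coeff (g \<star> f - idem (\<sigma> j)) u = 0" for u
      unfolding cl_eq_iff using vertex_coeff_I by blast+
    then have "vertex_coeff n u = vertex_coeff (idem (\<sigma> j)) u" for u
      using fg by (simp add: vertex_coeff_diff vertex_coeff_mult mult.commute)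
    then show ?thesis using fg by (intro bexI[of _ n]) (auto simp: vertex_coeff_basis a_def)
  qed
  then obtain twist where twist: "\<And>j. twist j \<in> F" "\<And>j. cl (twist j) = \<nu> (cl (idem j))"
    "\<And>j u. vertex_coeff (twist j) u = (if u = \<sigma> j then 1 else 0)"
    by metis
  \<comment> \<open>Distinct vertices have orthogonal idempotents, and \<open>\<nu>\<close>
    preserves orthogonality. If \<open>\<sigma> j = \<sigma> k\<close>, the product of the two
    images would have coefficient 1 at that vertex.\<close>
  show "inj \<sigma>"
  proof (rule injI, rule ccontr)
    fix j k assume jk: "\<sigma> j = \<sigma> k" "j \<noteq> k"
    have "idem j \<star> idem k = 0" using jk(2) by (simp add: basis_mult_basis)
    then have "\<nu> (cl (idem j)) \<otimes>\<^bsub>Pi\<^esub> \<nu> (cl (idem k)) = \<nu> (cl 0)"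
      using ring_hom_mult[OF hom e_closed e_closed, of j k] by (simp add: cl_mult[symmetric] idem_F)
    also have "\<nu> (cl 0) = cl 0"
      using ring_hom_zero[OF hom ring_Pi ring_Pi] by (simp add: cl_zero)
    finally have "cl (twist j \<star> twist k) = cl 0" using twist by (simp add: cl_mult)
    then have "twist j \<star> twist k \<in> I" by (simp add: cl_eq_iff)
    from vertex_coeff_I[OF this, of "\<sigma> j"] show False
      using twist jk(1) by (simp add: vertex_coeff_mult)
  qed
  have form_twist: "form (f \<star> idem j) = form (twist j \<star> f)" if "f \<in> F" for f j
    using left[OF idem_F that, of j] right[OF twist(1) that, of j] twist(2)[of j] by simp
  have "frobenius_quiver Q form twist \<sigma>"
    by unfold_locales
      (use form_add form_scale form_I nondeg represents twist form_twist in auto)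
  then show "\<exists>(form :: _ \<Rightarrow> 'k) twist. frobenius_quiver Q form twist \<sigma>" by blast
qed


section \<open>The Hilbert series\<close>

lemma dynkin_edgeD:
  assumes "dynkin_valid T" "E \<in> dynkin_edges T"
  obtains a b where "E = {a, b}" "a \<noteq> b" "a \<in> {1..dynkin_rank T}" "b \<in> {1..dynkin_rank T}"
proof -
  have "\<exists>a b. E = {a, b} \<and> a \<noteq> b \<and> a \<in> {1..dynkin_rank T} \<and> b \<in> {1..dynkin_rank T}"
  proof (cases "\<exists>n. n \<le> dynkin_rank T \<and> E \<in> chain_edges n")
    case True
    then obtain n i where "E = {i, i + 1}" "1 \<le> i" "i < n" "n \<le> dynkin_rank T"
      unfolding chain_edges_def by blast
    then show ?thesis by (intro exI[of _ i] exI[of _ "i + 1"]) auto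
  next
    case False
    then have nc: "E \<notin> chain_edges n" if "n \<le> dynkin_rank T" for n using that by blast
    show ?thesis
    proof (cases T)
      case (Dynkin_D n)
      then have "E = {n - 2, n}" "n \<ge> 4" using assms nc[of "n - 1"] by auto
      then show ?thesis using Dynkin_D by (intro exI[of _ "n - 2"] exI[of _ n]) auto
    next
      case (Dynkin_A n)
      then show ?thesis using assms nc[of n] by auto
    next
      case Dynkin_E6
      then have "E = {3, 6}" using assms nc[of 5] by auto
      then show ?thesis using Dynkin_E6 by (intro exI[of _ 3] exI[of _ 6]) auto
    next
      case Dynkin_E7
      then have "E = {3, 7}" using assms nc[of 6] by auto
      then show ?thesis using Dynkin_E7 by (intro exI[of _ 3] exI[of _ 7]) auto
    next
      case Dynkin_E8
      then have "E = {3, 8}" using assms nc[of 7] by auto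
      then show ?thesis using Dynkin_E8 by (intro exI[of _ 3] exI[of _ 8]) auto
    qed
  qed
  then show thesis using that by blast
qed

lemma coxeter_number_ge_2: "dynkin_valid T \<Longrightarrow> coxeter_number T \<ge> 2"
  by (cases T) auto

context preprojective_quiver
begin

text \<open>Independent of the orientation: each edge comes from one arrow of \<open>Q\<close>, and
  this arrow together with its opposite gives one arrow in each direction.\<close>

lemma arrow_count_dynkin:
  assumes valid: "dynkin_valid T" and f: "bij_betw f {1..dynkin_rank T} UNIV"
    and edges: "bij_betw (\<lambda>a. {tail Q a, head Q a}) (arcs Q) ((`) f ` dynkin_edges T)"
    and a: "a \<in> {1..dynkin_rank T}" and b: "b \<in> {1..dynkin_rank T}"
  shows "arrow_count (f a) (f b) = (if {a, b} \<in> dynkin_edges T then 1 else 0)"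
proof -
  have inj: "inj_on f {1..dynkin_rank T}" using f by (simp add: bij_betw_def)
  have edge_iff: "{f a, f b} \<in> (`) f ` dynkin_edges T \<longleftrightarrow> {a, b} \<in> dynkin_edges T"
  proof
    assume "{f a, f b} \<in> (`) f ` dynkin_edges T"
    then obtain E where E: "E \<in> dynkin_edges T" "{f a, f b} = f ` E" by blast
    have "E \<subseteq> {1..dynkin_rank T}" using dynkin_edgeD[OF valid E(1)] by blast
    moreover have "{a, b} \<subseteq> {1..dynkin_rank T}" using a b by blast
    moreover have "f ` {a, b} = f ` E" using E(2) by simp
    ultimately have "{a, b} = E" using inj_on_image_eq_iff[OF inj] by blast
    then show "{a, b} \<in> dynkin_edges T" using E(1) by simp
  next
    assume "{a, b} \<in> dynkin_edges T"
    then show "{f a, f b} \<in> (`) f ` dynkin_edges T" by (intro image_eqI[of _ _ "{a, b}"]) auto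
  qed
  define A where "A u w = {c \<in> arcs Q. tail Q c = u \<and> head Q c = w}" for u w
  have fin: "finite (A u w)" for u w unfolding A_def using finite_arcs_Q by simp
  have "{c \<in> arcs G. tail G c = f a \<and> head G c = f b} = Arr ` A (f a) (f b) \<union> Opp ` A (f b) (f a)"
    unfolding A_def by (auto simp: double_quiver_def)
  then have "arrow_count (f a) (f b) = card (Arr ` A (f a) (f b) \<union> Opp ` A (f b) (f a))"
    unfolding arrow_count_def by simp
  also have "\<dots> = card (Arr ` A (f a) (f b)) + card (Opp ` A (f b) (f a))"
    using fin by (intro card_Un_disjoint) auto
  also have "\<dots> = card (A (f a) (f b)) + card (A (f b) (f a))"
    by (simp add: card_image inj_on_def)
  finally have count: "arrow_count (f a) (f b) = card (A (f a) (f b)) + card (A (f b) (f a))" .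
  show ?thesis
  proof (cases "{a, b} \<in> dynkin_edges T")
    case True
    then obtain c d where cd: "{a, b} = {c, d}" "c \<noteq> d" by (rule dynkin_edgeD[OF valid])
    then have ab: "a \<noteq> b" by (auto simp: doubleton_eq_iff)
    then have fab: "f a \<noteq> f b" using inj_onD[OF inj _ a b] by blast
    have "{f a, f b} \<in> (\<lambda>a. {tail Q a, head Q a}) ` arcs Q"
      using edges edge_iff True by (simp add: bij_betw_def)
    then obtain e where e: "e \<in> arcs Q" "{tail Q e, head Q e} = {f a, f b}" by blast
    have "A (f a) (f b) \<union> A (f b) (f a) = {e}"
    proof -
      have "x = e" if "x \<in> A (f a) (f b) \<union> A (f b) (f a)" for x
      proof -
        have "x \<in> arcs Q" "{tail Q x, head Q x} = {tail Q e, head Q e}"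
          using that e(2) unfolding A_def by auto
        then show ?thesis using edges e(1) unfolding bij_betw_def inj_on_def by blast
      qed
      moreover have "e \<in> A (f a) (f b) \<union> A (f b) (f a)"
        using e unfolding A_def by (auto simp: doubleton_eq_iff)
      ultimately show ?thesis by blast
    qed
    moreover have "card (A (f a) (f b)) + card (A (f b) (f a)) = card (A (f a) (f b) \<union> A (f b) (f a))"
      using fab by (intro card_Un_disjoint[symmetric] fin) (auto simp: A_def)
    ultimately show ?thesis using True count by simp
  next
    case False
    have "x \<notin> A (f a) (f b)" "x \<notin> A (f b) (f a)" for x
    proof -
      have no: "{tail Q x, head Q x} \<noteq> {f a, f b}" if "x \<in> arcs Q"
      proof
        assume eq: "{tail Q x, head Q x} = {f a, f b}"
        have "{tail Q x, head Q x} \<in> (`) f ` dynkin_edges T" using bij_betwE[OF edges] that by blast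
        then show False using eq edge_iff False by simp
      qed
      show "x \<notin> A (f a) (f b)" using no unfolding A_def by auto
      show "x \<notin> A (f b) (f a)" using no unfolding A_def by (auto simp: insert_commute)
    qed
    then have "A (f a) (f b) = {}" "A (f b) (f a) = {}" by blast+
    then show ?thesis using False count by simp
  qed
qed

lemma arrow_count_sym: "arrow_count i j = arrow_count j i"
  unfolding arrow_count_def
  by (rule bij_betw_same_card[of opposite], rule bij_betw_byWitness[of _ opposite]) auto

lemma dynkin_vertex_weights:
  assumes "dynkin_quiver Q T"
  shows "\<exists>v :: 'v \<Rightarrow> real. \<forall>i. v i > 0 \<and>
    (\<Sum>k\<in>UNIV. arrow_count i k * v k) = 2 * cos (pi / coxeter_number T) * v i"
proof -
  obtain f where f: "bij_betw f {1..dynkin_rank T} UNIV"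
    and edges: "bij_betw (\<lambda>a. {tail Q a, head Q a}) (arcs Q) ((`) f ` dynkin_edges T)"
    and valid: "dynkin_valid T"
    using assms unfolding dynkin_quiver_def verts_Q by blast
  obtain w :: "nat \<Rightarrow> real" where w: "\<And>i. i \<in> {1..dynkin_rank T} \<Longrightarrow> w i > 0"
    "\<And>i. i \<in> {1..dynkin_rank T} \<Longrightarrow> (\<Sum>j | j \<in> {1..dynkin_rank T} \<and> {i, j} \<in> dynkin_edges T. w j) =
      2 * cos (pi / coxeter_number T) * w i"
    using dynkin_eigenvector[OF valid] by blast
  define g where "g = inv_into {1..dynkin_rank T} f"
  have gf: "g (f a) = a" if "a \<in> {1..dynkin_rank T}" for a
    using that f unfolding g_def bij_betw_def by simp
  have fg: "f (g i) = i" "g i \<in> {1..dynkin_rank T}" for i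
    using f unfolding g_def bij_betw_def by (metis UNIV_I f_inv_into_f, metis UNIV_I inv_into_into)
  show ?thesis
  proof (intro exI[of _ "\<lambda>i. w (g i)"] allI conjI)
    fix i
    show "w (g i) > 0" by (rule w(1)[OF fg(2)])
    have "(\<Sum>k\<in>UNIV. arrow_count i k * w (g k)) = (\<Sum>b\<in>{1..dynkin_rank T}. arrow_count i (f b) * w (g (f b)))"
      by (rule sum.reindex_bij_betw[OF f, symmetric])
    also have "\<dots> = (\<Sum>b\<in>{1..dynkin_rank T}. if {g i, b} \<in> dynkin_edges T then w b else 0)"
    proof (rule sum.cong[OF refl])
      fix b assume b: "b \<in> {1..dynkin_rank T}"
      have "arrow_count i (f b) = (if {g i, b} \<in> dynkin_edges T then 1 else 0)"
        using arrow_count_dynkin[OF valid f edges fg(2)[of i] b] by (simp add: fg(1))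
      then show "arrow_count i (f b) * w (g (f b)) = (if {g i, b} \<in> dynkin_edges T then w b else 0)"
        using gf[OF b] by simp
    qed
    also have "\<dots> = (\<Sum>b | b \<in> {1..dynkin_rank T} \<and> {g i, b} \<in> dynkin_edges T. w b)"
      by (rule sum.inter_filter[symmetric]) simp
    also have "\<dots> = 2 * cos (pi / coxeter_number T) * w (g i)" by (rule w(2)[OF fg(2)])
    finally show "(\<Sum>k\<in>UNIV. arrow_count i k * w (g k)) = 2 * cos (pi / coxeter_number T) * w (g i)" .
  qed
qed

text \<open>The weighted row sums of row \<open>\<sigma> k\<close> satisfy
  \<open>nonneg_chebyshev_sequence\<close> with an impulse \<open>v k\<close> at
  \<open>m k + 2\<close>, which forces \<open>m k + 2 = h\<close> for every \<open>k\<close>. All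
  rows arise in this way, because an injective \<open>\<sigma>\<close> on a finite set is
  surjective.\<close>

lemma socle_degree:
  fixes h :: nat and form :: "(('v, 'a darrow) path \<Rightarrow> 'k) \<Rightarrow> 'k"
  assumes T: "dynkin_quiver Q T" and h: "h = coxeter_number T" and \<sigma>: "inj \<sigma>"
    and frob: "frobenius_quiver Q form twist \<sigma>"
  shows "dim_soc n i j = (if i = \<sigma> j \<and> n + 2 = h then 1 else 0)"
    and "n \<ge> h - 1 \<Longrightarrow> dim_Pi n i j = 0"
proof -
  interpret frobenius_quiver Q K form twist \<sigma> by (fact frob)
  have "\<forall>j. \<exists>m. \<forall>n i. dim_soc n i j = (if i = \<sigma> j \<and> n = m then 1 else 0)"
  proof
    fix j
    show "\<exists>m. \<forall>n i. dim_soc n i j = (if i = \<sigma> j \<and> n = m then 1 else 0)"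
      by (rule dim_socle[of j]) blast
  qed
  from choice[OF this] obtain m
    where m: "\<And>n i j. dim_soc n i j = (if i = \<sigma> j \<and> n = m j then 1 else 0)" by blast
  obtain v :: "'v \<Rightarrow> real" where v: "\<And>i. v i > 0"
    "\<And>i. (\<Sum>k\<in>UNIV. arrow_count i k * v k) = 2 * cos (pi / h) * v i"
    using dynkin_vertex_weights[OF T] unfolding h by blast
  have surj: "\<exists>k. i = \<sigma> k" for i
    using surjD[OF finite_UNIV_inj_surj[OF finite \<sigma>], of i] by blast
  have h2: "h \<ge> 2" using T coxeter_number_ge_2 unfolding h dynkin_quiver_def by blast
  define w where "w i n = (\<Sum>k\<in>UNIV. real_of_int (dim_Pi n i k) * v k)" for i n
  have term_nonneg: "real_of_int (dim_Pi n i k) * v k \<ge> 0" for n i k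
    using dim_Pi_nonneg less_imp_le[OF v(1)] by simp
  have w_nonneg: "w i n \<ge> 0" for i n
    unfolding w_def using term_nonneg by (intro sum_nonneg)
  have w0: "w i 0 = v i" for i
    unfolding w_def dim_Pi_0 by (simp add: if_distrib if_distribR cong: if_cong)
  have w1: "w i 1 = 2 * cos (pi / h) * v i" for i
    unfolding w_def dim_Pi_1 using v(2) by simp
  have rec: "w (\<sigma> k) (n + 2) = 2 * cos (pi / h) * w (\<sigma> k) (n + 1) - w (\<sigma> k) n +
      (if n + 2 = m k + 2 then v k else 0)" for k n
  proof -
    have "w (\<sigma> k) (n + 2) = (\<Sum>j\<in>UNIV. (\<Sum>l\<in>UNIV. real_of_int (dim_Pi (n + 1) (\<sigma> k) l) * (arrow_count l j * v j)))
        - w (\<sigma> k) n + (\<Sum>j\<in>UNIV. real_of_int (dim_soc n (\<sigma> k) j) * v j)"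
      unfolding w_def dim_Pi_Suc_Suc
      by (simp add: distrib_right left_diff_distrib sum.distrib sum_subtractf sum_distrib_right mult.assoc)
    also have "(\<Sum>j\<in>UNIV. (\<Sum>l\<in>UNIV. real_of_int (dim_Pi (n + 1) (\<sigma> k) l) * (arrow_count l j * v j))) =
        (\<Sum>l\<in>UNIV. real_of_int (dim_Pi (n + 1) (\<sigma> k) l) * (\<Sum>j\<in>UNIV. arrow_count l j * v j))"
      by (subst sum.swap) (simp add: sum_distrib_left)
    also have "\<dots> = 2 * cos (pi / h) * w (\<sigma> k) (n + 1)"
      unfolding v(2) w_def sum_distrib_left by (intro sum.cong refl) simp
    \<comment> \<open>Injectivity of \<open>\<sigma>\<close> leaves column \<open>k\<close> as the
      only one whose socle lies in row \<open>\<sigma> k\<close>.\<close>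
    also have "(\<Sum>j\<in>UNIV. real_of_int (dim_soc n (\<sigma> k) j) * v j) = (\<Sum>j\<in>UNIV. if j = k then (if n = m k then v k else 0) else 0)"
      unfolding m using injD[OF \<sigma>] by (intro sum.cong refl) auto
    finally show ?thesis by simp
  qed
  have key: "m k + 2 = h \<and> (\<forall>n\<ge>h - 1. w (\<sigma> k) n = 0)" for k
    using nonneg_chebyshev_sequence[of h "m k + 2" "v (\<sigma> k)" "w (\<sigma> k)" "v k",
        OF h2 _ v(1) w0 w1 rec w_nonneg] by simp
  then have "n = m j \<longleftrightarrow> n + 2 = h" by (metis add_right_cancel)
  then show "dim_soc n i j = (if i = \<sigma> j \<and> n + 2 = h then 1 else 0)" unfolding m by simp
  show "dim_Pi n i j = 0" if "n \<ge> h - 1"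
  proof -
    have "w i n = 0" using surj[of i] key that by blast
    then have "real_of_int (dim_Pi n i j) * v j = 0"
      unfolding w_def using sum_nonneg_eq_0_iff[of UNIV "\<lambda>k. real_of_int (dim_Pi n i k) * v k"] term_nonneg
      by simp
    then show ?thesis using v(1)[of j] by simp
  qed
qed

end

section \<open>Matrix recurrences and power series\<close>

lemma mat_of_simps:
  fixes A B :: "('a::ring_1, 'v::finite) sqmat"
  shows "mat_of (0 :: ('a, 'v) sqmat) = 0" "mat_of (1 :: ('a, 'v) sqmat) = mat 1"
    "mat_of (A + B) = mat_of A + mat_of B" "mat_of (A - B) = mat_of A - mat_of B"
    "mat_of (A * B) = mat_of A ** mat_of B"
  by (simp_all add: zero_sqmat_def one_sqmat_def plus_sqmat_def minus_sqmat_def times_sqmat_def sqmat_simps)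

lemma sqmat_eqI: "(\<And>i j. mat_of A $ i $ j = mat_of B $ i $ j) \<Longrightarrow> A = B"
  by (simp add: mat_of_inject[symmetric] vec_eq_iff)

definition sq_transpose :: "('a, 'v::finite) sqmat \<Rightarrow> ('a, 'v) sqmat" where
  "sq_transpose A = Sqmat (transpose (mat_of A))"

lemma sq_transpose_mult: "sq_transpose (A * B) = sq_transpose B * sq_transpose (A :: ('a::comm_ring_1, 'v::finite) sqmat)"
  by (simp add: sq_transpose_def times_sqmat_def sqmat_simps matrix_transpose_mul)

lemma sq_transpose_diff: "sq_transpose (A - B) = sq_transpose A - sq_transpose (B :: ('a::ring_1, 'v::finite) sqmat)"
  by (simp add: sq_transpose_def minus_sqmat_def sqmat_simps transpose_def Sqmat_inject vec_eq_iff)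

lemma sq_transpose_one: "sq_transpose 1 = (1 :: ('a::ring_1, 'v::finite) sqmat)"
  by (simp add: sq_transpose_def one_sqmat_def sqmat_simps)

text \<open>Below \<open>h\<close> no impulse has occurred, so \<open>a n\<close> is a polynomial in
  \<open>C\<close>. Symmetry and commutation are proved together, as transposing
  \<open>a (n + 1) * C\<close> reverses the factors.\<close>

lemma symmetric_chebyshev_matrices:
  fixes C :: "(int, 'v::finite) sqmat" and a :: "nat \<Rightarrow> (int, 'v) sqmat"
  assumes C: "sq_transpose C = C" and a0: "a 0 = 1" and a1: "a 1 = C"
    and rec: "\<And>n. n + 2 < h \<Longrightarrow> a (n + 2) = a (n + 1) * C - a n"
  shows "n < h \<Longrightarrow> a n * C = C * a n \<and> sq_transpose (a n) = a n"
proof (induction n rule: less_induct)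
  case (less n)
  consider "n = 0" | "n = 1" | k where "n = k + 2"
    by (metis One_nat_def add_2_eq_Suc' not0_implies_Suc)
  then show ?case
  proof cases
    case 3
    have IH: "a (k + 1) * C = C * a (k + 1)" "sq_transpose (a (k + 1)) = a (k + 1)"
      "a k * C = C * a k" "sq_transpose (a k) = a k"
      using less 3 by auto
    have an: "a n = a (k + 1) * C - a k" using rec[of k] less.prems 3 by simp
    have "a n * C = C * a n" 
      by (simp only: an left_diff_distrib right_diff_distrib mult.assoc[symmetric] IH(1,3)[symmetric])
    moreover have "sq_transpose (a n) = a n"
      by (simp only: an sq_transpose_diff sq_transpose_mult C IH)
    ultimately show ?thesis ..
  qed (use a0 a1 C sq_transpose_one in auto)
qed

text \<open>The recurrence multiplies by \<open>C\<close> on the right, so it says that the series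
  times the denominator, placed on the right, is \<open>1 + P t^h\<close>; cancelling then takes a
  right inverse of the denominator.\<close>

lemma fps_chebyshev:
  fixes C :: "'a::ring_1" and a :: "nat \<Rightarrow> 'a"
  assumes "a 0 = 1" "a 1 = C" "\<And>n. a (n + 2) = a (n + 1) * C - a n + (if n + 2 = h then P else 0)"
    and "h \<ge> 2"
  shows "Abs_fps a = (1 + fps_const P * fps_X ^ h) * fps_right_inverse (1 - fps_const C * fps_X + fps_X\<^sup>2) 1"
proof -
  define M where "M = 1 - fps_const C * fps_X + fps_X\<^sup>2"
  have "Abs_fps a * M = 1 + fps_const P * fps_X ^ h"
  proof (rule fps_ext)
    fix n
    have M: "fps_nth (Abs_fps a * M) n = a n - (if n = 0 then 0 else a (n - 1) * C) + (if n < 2 then 0 else a (n - 2))"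
      unfolding M_def by (simp add: distrib_left right_diff_distrib mult.assoc[symmetric] fps_X_power_mult_right_nth)
    have "n = 0 \<or> n = 1 \<or> (\<exists>k. n = k + 2)"
      by (metis One_nat_def add_2_eq_Suc' not0_implies_Suc)
    then consider "n = 0" | "n = 1" | k where "n = k + 2" by blast
    then show "fps_nth (Abs_fps a * M) n = fps_nth (1 + fps_const P * fps_X ^ h) n"
    proof cases
      case 1
      then show ?thesis unfolding M using assms(1,4) by simp
    next
      case 2
      then show ?thesis unfolding M using assms(1,2,4) by simp
    next
      case 3
      then show ?thesis unfolding M using assms(3)[of k] assms(4) by simp
    qed
  qed
  moreover have "M * fps_right_inverse M 1 = 1"
    by (rule fps_right_inverse) (simp add: M_def)
  ultimately have "Abs_fps a = (1 + fps_const P * fps_X ^ h) * fps_right_inverse M 1"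
    by (metis mult.assoc mult.right_neutral)
  then show ?thesis unfolding M_def .
qed

theorem theorem3p2:
  fixes Q :: "('v::finite, 'a) pre_digraph"
    and T :: dynkin_type
    and \<nu> :: "('v, 'a, 'k::field) preproj \<Rightarrow> ('v, 'a, 'k) preproj"
    and \<sigma> :: "'v \<Rightarrow> 'v"
  defines "C \<equiv> adjacency_matrix TYPE('k) (double_quiver Q)"
    and "P \<equiv> permutation_matrix \<sigma>"
    and "h \<equiv> coxeter_number T"
  assumes "verts Q = UNIV"
    and "dynkin_quiver Q T"
    and "nakayama_automorphism Q \<nu>"
    and "nakayama_permutation Q \<nu> \<sigma>"
  shows "hilbert_series TYPE('k) Q =
    (1 + fps_const P * fps_X ^ h) * fps_right_inverse (1 - fps_const C * fps_X + fps_X\<^sup>2) 1"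
proof -
  interpret preprojective_quiver Q "TYPE('k)"
    using assms(4,5) by unfold_locales (auto simp: dynkin_quiver_def fin_digraph_def fin_digraph_axioms_def)
  have valid: "dynkin_valid T" using assms(5) unfolding dynkin_quiver_def by blast
  have h2: "h \<ge> 2" unfolding h_def by (rule coxeter_number_ge_2[OF valid])
  obtain form :: "_ \<Rightarrow> 'k" and twist where frob: "frobenius_quiver Q form twist \<sigma>" and \<sigma>: "inj \<sigma>"
    using frobenius_quiver_exists[OF assms(6,7)] by blast
  note soc = socle_degree[OF assms(5) h_def[THEN meta_eq_to_obj_eq] \<sigma> frob]
  define a :: "nat \<Rightarrow> (int, 'v) sqmat" where "a n = Sqmat (\<chi> i j. dim_Pi n i j)" for n
  have C: "C = Sqmat (\<chi> i j. int (arrow_count i j))" unfolding C_def by (rule adjacency_matrix_eq)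
  have a0: "a 0 = 1" by (simp add: a_def one_sqmat_def dim_Pi_0 mat_def)
  have a1: "a 1 = C" by (simp add: a_def C dim_Pi_1[unfolded One_nat_def])
  have mat_a: "mat_of (a n) $ i $ j = dim_Pi n i j" for n i j by (simp add: a_def sqmat_simps)
  have mat_C: "mat_of C $ i $ j = int (arrow_count i j)" for i j by (simp add: C sqmat_simps)
  \<comment> \<open>The socle of column \<open>j\<close> sits in row \<open>\<sigma> j\<close>,
    which is the transpose of the convention in \<open>permutation_matrix\<close>.\<close>
  have mat_P: "mat_of (sq_transpose P) $ i $ j = (if i = \<sigma> j then 1 else 0)" for i j
    unfolding P_def permutation_matrix_def sq_transpose_def sqmat_simps transpose_def by auto
  have rec: "a (n + 2) = a (n + 1) * C - a n + (if n + 2 = h then sq_transpose P else 0)" for n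
  proof (rule sqmat_eqI)
    fix i j
    have "mat_of (if n + 2 = h then sq_transpose P else 0) $ i $ j = dim_soc n i j"
      unfolding soc(1) by (simp add: mat_P mat_of_simps)
    moreover have "mat_of (a (n + 1) * C) $ i $ j = (\<Sum>k\<in>UNIV. dim_Pi (n + 1) i k * int (arrow_count k j))"
      by (simp add: mat_of_simps matrix_matrix_mult_def mat_a mat_C)
    ultimately show "mat_of (a (n + 2)) $ i $ j =
        mat_of (a (n + 1) * C - a n + (if n + 2 = h then sq_transpose P else 0)) $ i $ j"
      unfolding mat_of_simps(3,4) vector_add_component vector_minus_component mat_a dim_Pi_Suc_Suc by simp
  qed
  have vanish: "a n = 0" if "n \<ge> h - 1" for n
    using soc(2)[OF that] by (simp add: a_def zero_sqmat_def Sqmat_inject vec_eq_iff)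
  have C_sym: "sq_transpose C = C"
    by (simp add: C sq_transpose_def sqmat_simps Sqmat_inject transpose_def arrow_count_sym)
  \<comment> \<open>In the recurrence for \<open>a h\<close> both \<open>a h\<close> and
    \<open>a (h - 1)\<close> vanish, so the impulse must cancel \<open>a (h - 2)\<close>. This is
    the top degree, where the socle is concentrated.\<close>
  have "sq_transpose P = a (h - 2)"
    using rec[of "h - 2"] vanish[of h] vanish[of "h - 1"] h2 by (simp add: Suc_diff_Suc numeral_2_eq_2)
  moreover have "sq_transpose (a (h - 2)) = a (h - 2)"
    using symmetric_chebyshev_matrices[OF C_sym a0 a1, of h "h - 2"] rec h2 by simp
  ultimately have "sq_transpose P = P"
    by (metis sq_transpose_def sqmat_simps transpose_transpose)
  then have "Abs_fps a = (1 + fps_const P * fps_X ^ h) * fps_right_inverse (1 - fps_const C * fps_X + fps_X\<^sup>2) 1"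
    using rec h2 by (intro fps_chebyshev a0 a1) simp_all
  moreover have "hilbert_series TYPE('k) Q = Abs_fps a"
    by (rule fps_ext) (simp add: hilbert_series_nth a_def)
  ultimately show ?thesis by simp
qed

end
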